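(* Consider the system of partial differential equations $$u^\alpha_{xy}+C^\alpha_{\beta\gamma}(x,y,u^\tau)\,u^\beta_x u^\gamma_y+A^\alpha_\gamma(x,y,u^\tau)\,u^\gamma_x+B^\alpha_\gamma(x,y,u^\tau)\,u^\gamma_y+G^\alpha(x,y,u^\tau)=0,\qquad \alpha=1,\dots,m,$$ with smooth coefficients, and let $M_{\alpha\beta}=M_{\beta\alpha}$ be smooth functions of $(x,y,u^\tau)$. The system is multiplier variational with multiplier $M_{\alpha\beta}$ if and only if $\det(M_{\alpha\beta})\neq 0$ and $$M_{\alpha\sigma}H^\sigma_\beta=M_{\beta\sigma}K^\sigma_\alpha,\qquad M_{\alpha\sigma}S^\sigma_{\beta\gamma}=-M_{\beta\sigma}S^\sigma_{\alpha\gamma},$$ $$dM_{\alpha\beta}=M_{\alpha\sigma}\,\Omega^\sigma_\beta+M_{\beta\sigma}\,\Omega^\sigma_\alpha$$ for all $\alpha,\beta,\gamma$, where $\Omega^\sigma_\alpha=C^\sigma_{\alpha\tau}\,du^\tau+A^\sigma_\alpha\,dy+B^\sigma_\alpha\,dx$.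
   Context: Repeated indices are summed. All functions are $C^\infty$ and all statements are local. Write the system as $u^\alpha_{xy}=f^\alpha$, with $f^\alpha=-(C^\alpha_{\beta\gamma}u^\beta_xu^\gamma_y+A^\alpha_\gamma u^\gamma_x+B^\alpha_\gamma u^\gamma_y+G^\alpha)$. "Multiplier variational with multiplier $M_{\alpha\beta}$" means: $\det(M_{\alpha\beta})\ne0$ and there is a smooth first-order Lagrangian $L(x,y,u^\gamma,u^\gamma_x,u^\gamma_y)$ with $E_\alpha(L)=M_{\alpha\beta}(u^\beta_{xy}-f^\beta)$ identically in the jet variables, where $E_\alpha(L)=\frac{\partial L}{\partial u^\alpha}-D_x\frac{\partial L}{\partial u^\alpha_x}-D_y\frac{\partial L}{\partial u^\alpha_y}$ and $D_x,D_y$ are the (unconstrained) total derivatives. The quantities $H,K,S$ are $$H^\gamma_\alpha=\frac{\partial f^\gamma}{\partial u^\alpha}+\frac{\partial f^\gamma}{\partial u^\sigma_y}\frac{\partial f^\sigma}{\partial u^\alpha_x}-\frac{\partial^2 f^\gamma}{\partial u^\alpha_x\partial x}-\frac{\partial^2 f^\gamma}{\partial u^\alpha_x\partial u^\beta}u^\beta_x-\frac{\partial^2 f^\gamma}{\partial u^\alpha_x\partial u^\beta_y}f^\beta-\frac{\partial^2 f^\gamma}{\partial u^\alpha_x\partial u^\beta_x}u^\beta_{xx},$$ $$K^\gamma_\alpha=\frac{\partial f^\gamma}{\partial u^\alpha}+\frac{\partial f^\gamma}{\partial u^\sigma_x}\frac{\partial f^\sigma}{\partial u^\alpha_y}-\frac{\partial^2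 f^\gamma}{\partial u^\alpha_y\partial y}-\frac{\partial^2 f^\gamma}{\partial u^\alpha_y\partial u^\beta}u^\beta_y-\frac{\partial^2 f^\gamma}{\partial u^\alpha_y\partial u^\beta_x}f^\beta-\frac{\partial^2 f^\gamma}{\partial u^\alpha_y\partial u^\beta_y}u^\beta_{yy},$$ $$S^\gamma_{\alpha\beta}=\frac{\partial^2 f^\gamma}{\partial u^\beta_x\partial u^\alpha_y}-\frac{\partial^2 f^\gamma}{\partial u^\alpha_x\partial u^\beta_y}.$$ For systems of the form $u^\alpha_{xy}+C^\alpha_{\beta\gamma}u^\beta_xu^\gamma_y+A^\alpha_\gamma u^\gamma_x+B^\alpha_\gamma u^\gamma_y+G^\alpha=0$, with $C^\alpha_{\beta\gamma},A^\alpha_\gamma,B^\alpha_\gamma,G^\alpha$ functions of $(x,y,u^\tau)$, one has $S^\gamma_{\alpha\beta}=C^\gamma_{\alpha\beta}-C^\gamma_{\beta\alpha}$, and $H,K$ are functions of $(x,y,u,u_x,u_y)$, polynomial in $u_x,u_y$; the algebraic conditions are required for all values of $u_x,u_y$. *)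

theory Defs
  imports "HOL-Analysis.Analysis"
begin

fun Ck_on :: "nat \<Rightarrow> 'a::euclidean_space set \<Rightarrow> ('a \<Rightarrow> real) \<Rightarrow> bool" where
  "Ck_on 0 S F \<longleftrightarrow> continuous_on S F"
| "Ck_on (Suc k) S F \<longleftrightarrow>
     (\<forall>z\<in>S. F differentiable (at z)) \<and>
     (\<forall>v. Ck_on k S (\<lambda>z. frechet_derivative F (at z) v))"

text \<open>\<open>C\<^sup>\<infinity>\<close>; only meant for open sets \<open>S\<close>.\<close>

definition smooth_on :: "'a::euclidean_space set \<Rightarrow> ('a \<Rightarrow> real) \<Rightarrow> bool" where
  "smooth_on S F \<longleftrightarrow> (\<forall>k. Ck_on k S F)"

text \<open>Points of the base are \<open>(x, y, u)\<close>, first-order jets are \<open>(x, y, u, p, q)\<close>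
  with \<open>p = u\<^sub>x\<close> and \<open>q = u\<^sub>y\<close>.  Second-order jets are given by a first-order jet
  together with \<open>r\<close>, \<open>s\<close>, \<open>t\<close>, standing for the second derivatives \<open>u\<close> by \<open>xx\<close>,
  \<open>xy\<close> and \<open>yy\<close>.  The index type \<open>'m\<close> has \<open>m\<close> elements.\<close>

type_synonym 'm base = "real \<times> real \<times> (real, 'm) vec"
type_synonym 'm jet = "real \<times> real \<times> (real, 'm) vec \<times> (real, 'm) vec \<times> (real, 'm) vec"

definition jets_over :: "('m::finite) base set \<Rightarrow> 'm jet set" where
  "jets_over V = {(x, y, u, p, q). (x, y, u) \<in> V}"

definition d_x :: "(('m::finite) jet \<Rightarrow> real) \<Rightarrow> 'm jet \<Rightarrow> real" where
  "d_x F z = frechet_derivative F (at z) (1, 0, 0, 0, 0)"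

definition d_y :: "(('m::finite) jet \<Rightarrow> real) \<Rightarrow> 'm jet \<Rightarrow> real" where
  "d_y F z = frechet_derivative F (at z) (0, 1, 0, 0, 0)"

definition d_u :: "'m \<Rightarrow> (('m::finite) jet \<Rightarrow> real) \<Rightarrow> 'm jet \<Rightarrow> real" where
  "d_u \<alpha> F z = frechet_derivative F (at z) (0, 0, axis \<alpha> 1, 0, 0)"

definition d_ux :: "'m \<Rightarrow> (('m::finite) jet \<Rightarrow> real) \<Rightarrow> 'm jet \<Rightarrow> real" where
  "d_ux \<alpha> F z = frechet_derivative F (at z) (0, 0, 0, axis \<alpha> 1, 0)"

definition d_uy :: "'m \<Rightarrow> (('m::finite) jet \<Rightarrow> real) \<Rightarrow> 'm jet \<Rightarrow> real" where
  "d_uy \<alpha> F z = frechet_derivative F (at z) (0, 0, 0, 0, axis \<alpha> 1)"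

text \<open>Unconstrained total derivatives of functions on first-order jets.\<close>

fun total_x :: "(('m::finite) jet \<Rightarrow> real) \<Rightarrow> 'm jet \<Rightarrow> real^'m \<Rightarrow> real^'m \<Rightarrow> real" where
  "total_x F (x, y, u, p, q) r s =
     d_x F (x, y, u, p, q)
     + (\<Sum>\<beta>\<in>UNIV. d_u \<beta> F (x, y, u, p, q) * p $ \<beta>)
     + (\<Sum>\<beta>\<in>UNIV. d_ux \<beta> F (x, y, u, p, q) * r $ \<beta>)
     + (\<Sum>\<beta>\<in>UNIV. d_uy \<beta> F (x, y, u, p, q) * s $ \<beta>)"

fun total_y :: "(('m::finite) jet \<Rightarrow> real) \<Rightarrow> 'm jet \<Rightarrow> real^'m \<Rightarrow> real^'m \<Rightarrow> real" where
  "total_y F (x, y, u, p, q) s t =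
     d_y F (x, y, u, p, q)
     + (\<Sum>\<beta>\<in>UNIV. d_u \<beta> F (x, y, u, p, q) * q $ \<beta>)
     + (\<Sum>\<beta>\<in>UNIV. d_ux \<beta> F (x, y, u, p, q) * s $ \<beta>)
     + (\<Sum>\<beta>\<in>UNIV. d_uy \<beta> F (x, y, u, p, q) * t $ \<beta>)"

definition euler_lagrange ::
  "'m \<Rightarrow> (('m::finite) jet \<Rightarrow> real) \<Rightarrow> 'm jet \<Rightarrow> real^'m \<Rightarrow> real^'m \<Rightarrow> real^'m \<Rightarrow> real" where
  "euler_lagrange \<alpha> L z r s t =
     d_u \<alpha> L z - total_x (d_ux \<alpha> L) z r s - total_y (d_uy \<alpha> L) z s t"

text \<open>The system \<open>u\<^sub>x\<^sub>y = f\<close> over the open set \<open>U\<close>.  Being variational is a local property: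
  each point of \<open>U\<close> has a neighbourhood over which there is a Lagrangian, defined for all
  values of the derivatives.\<close>

definition multiplier_variational ::
  "('m::finite) base set \<Rightarrow> ('m \<Rightarrow> 'm jet \<Rightarrow> real) \<Rightarrow> ('m \<Rightarrow> 'm \<Rightarrow> 'm base \<Rightarrow> real) \<Rightarrow> bool" where
  "multiplier_variational U f M \<longleftrightarrow>
     (\<forall>b\<in>U. det (\<chi> \<alpha> \<beta>. M \<alpha> \<beta> b) \<noteq> 0) \<and>
     (\<forall>b\<in>U. \<exists>V L. open V \<and> b \<in> V \<and> V \<subseteq> U \<and> smooth_on (jets_over V) L \<and>
        (\<forall>x y u p q r s t \<alpha>. (x, y, u) \<in> V \<longrightarrow>
           euler_lagrange \<alpha> L (x, y, u, p, q) r s t =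
             (\<Sum>\<beta>\<in>UNIV. M \<alpha> \<beta> (x, y, u) * (s $ \<beta> - f \<beta> (x, y, u, p, q)))))"

text \<open>In what follows, upper indices come first: \<open>C \<alpha> \<beta> \<gamma>\<close> has upper index \<open>\<alpha>\<close> and lower
  indices \<open>\<beta> \<gamma>\<close>, and similarly for \<open>A\<close>, \<open>B\<close>, \<open>\<Omega>\<close>, \<open>H\<close>, \<open>K\<close>, \<open>S\<close>.\<close>

fun sys_rhs ::
  "('m \<Rightarrow> 'm \<Rightarrow> 'm \<Rightarrow> ('m::finite) base \<Rightarrow> real) \<Rightarrow> ('m \<Rightarrow> 'm \<Rightarrow> 'm base \<Rightarrow> real) \<Rightarrow>
   ('m \<Rightarrow> 'm \<Rightarrow> 'm base \<Rightarrow> real) \<Rightarrow> ('m \<Rightarrow> 'm base \<Rightarrow> real) \<Rightarrow> 'm \<Rightarrow> 'm jet \<Rightarrow> real" where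
  "sys_rhs C A B G \<alpha> (x, y, u, p, q) =
     - ((\<Sum>\<beta>\<in>UNIV. \<Sum>\<gamma>\<in>UNIV. C \<alpha> \<beta> \<gamma> (x, y, u) * p $ \<beta> * q $ \<gamma>)
        + (\<Sum>\<gamma>\<in>UNIV. A \<alpha> \<gamma> (x, y, u) * p $ \<gamma>)
        + (\<Sum>\<gamma>\<in>UNIV. B \<alpha> \<gamma> (x, y, u) * q $ \<gamma>)
        + G \<alpha> (x, y, u))"

fun inv_H :: "('m \<Rightarrow> ('m::finite) jet \<Rightarrow> real) \<Rightarrow> 'm \<Rightarrow> 'm \<Rightarrow> 'm jet \<Rightarrow> real^'m \<Rightarrow> real" where
  "inv_H f \<gamma> \<alpha> (x, y, u, p, q) r = (let z = (x, y, u, p, q) in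
     d_u \<alpha> (f \<gamma>) z
     + (\<Sum>\<sigma>\<in>UNIV. d_uy \<sigma> (f \<gamma>) z * d_ux \<alpha> (f \<sigma>) z)
     - d_x (d_ux \<alpha> (f \<gamma>)) z
     - (\<Sum>\<beta>\<in>UNIV. d_u \<beta> (d_ux \<alpha> (f \<gamma>)) z * p $ \<beta>)
     - (\<Sum>\<beta>\<in>UNIV. d_uy \<beta> (d_ux \<alpha> (f \<gamma>)) z * f \<beta> z)
     - (\<Sum>\<beta>\<in>UNIV. d_ux \<beta> (d_ux \<alpha> (f \<gamma>)) z * r $ \<beta>))"

fun inv_K :: "('m \<Rightarrow> ('m::finite) jet \<Rightarrow> real) \<Rightarrow> 'm \<Rightarrow> 'm \<Rightarrow> 'm jet \<Rightarrow> real^'m \<Rightarrow> real" where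
  "inv_K f \<gamma> \<alpha> (x, y, u, p, q) t = (let z = (x, y, u, p, q) in
     d_u \<alpha> (f \<gamma>) z
     + (\<Sum>\<sigma>\<in>UNIV. d_ux \<sigma> (f \<gamma>) z * d_uy \<alpha> (f \<sigma>) z)
     - d_y (d_uy \<alpha> (f \<gamma>)) z
     - (\<Sum>\<beta>\<in>UNIV. d_u \<beta> (d_uy \<alpha> (f \<gamma>)) z * q $ \<beta>)
     - (\<Sum>\<beta>\<in>UNIV. d_ux \<beta> (d_uy \<alpha> (f \<gamma>)) z * f \<beta> z)
     - (\<Sum>\<beta>\<in>UNIV. d_uy \<beta> (d_uy \<alpha> (f \<gamma>)) z * t $ \<beta>))"

definition inv_S :: "('m \<Rightarrow> ('m::finite) jet \<Rightarrow> real) \<Rightarrow> 'm \<Rightarrow> 'm \<Rightarrow> 'm \<Rightarrow> 'm jet \<Rightarrow> real" where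
  "inv_S f \<gamma> \<alpha> \<beta> z = d_ux \<beta> (d_uy \<alpha> (f \<gamma>)) z - d_ux \<alpha> (d_uy \<beta> (f \<gamma>)) z"

text \<open>The one-form \<open>\<Omega>\<close> at the base point \<open>b\<close>, evaluated on the tangent vector
  \<open>(dx, dy, du)\<close>.\<close>

fun Omega ::
  "('m \<Rightarrow> 'm \<Rightarrow> 'm \<Rightarrow> ('m::finite) base \<Rightarrow> real) \<Rightarrow> ('m \<Rightarrow> 'm \<Rightarrow> 'm base \<Rightarrow> real) \<Rightarrow>
   ('m \<Rightarrow> 'm \<Rightarrow> 'm base \<Rightarrow> real) \<Rightarrow> 'm \<Rightarrow> 'm \<Rightarrow> 'm base \<Rightarrow> 'm base \<Rightarrow> real" where
  "Omega C A B \<sigma> \<alpha> b (dx, dy, du) =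
     (\<Sum>\<tau>\<in>UNIV. C \<sigma> \<alpha> \<tau> b * du $ \<tau>) + A \<sigma> \<alpha> b * dy + B \<sigma> \<alpha> b * dx"

end

theory Submission
  imports Defs
begin

text \<open>
  Multiply the system by \<open>M\<close> and put \<open>F\<^sub>\<alpha> = M\<^sub>\<alpha>\<^sub>\<beta> (u\<^sub>x\<^sub>y - f)\<^sup>\<beta>\<close>.  With lowered coefficients
  \<open>c = M C\<close>, \<open>a = M A\<close>, \<open>b = M B\<close>, \<open>g = M G\<close> this is
  \<open>M u\<^sub>x\<^sub>y + c p q + a p + b q + g\<close>, where \<open>p = u\<^sub>x\<close> and \<open>q = u\<^sub>y\<close>.

  Since \<open>F\<close> contains neither \<open>u\<^sub>x\<^sub>x\<close> nor \<open>u\<^sub>y\<^sub>y\<close>, a Lagrangian for \<open>F\<close> is affine in \<open>p\<close> and affine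
  in \<open>q\<close>, hence \<open>L = h p q + P p + Q q + R\<close> with coefficients on the base.  Its Euler-Lagrange
  expression has the same bi-affine shape, so the system is variational exactly if
  the coefficients \<open>h, P, Q, R\<close> can be found, locally, from a first-order linear system of equations
  (\<open>lagrangian_iff_coeffs\<close>).  The integrability conditions of that system are the Helmholtz conditions
  on \<open>M, c, a, b, g\<close>:

  \<^item> \<open>dM\<close> is \<open>c du + a dy + b dx\<close> plus its transpose, and the part of \<open>c\<close> skew in its last two indices
    is skew in all three (first-order conditions);

  \<^item> the bi-affine polynomial in \<open>p, q\<close> with coefficients \<open>helm_c, helm_a, helm_b, helm_g\<close>
    vanishes (zero-order condition).

  They are necessary because second derivatives of \<open>h, P, Q, R\<close> commute
  (\<open>lagrangian_coeffs_imp_helmholtz\<close>).  Conversely, subtracting the Euler-Lagrange expression of \<open>- M p q / 2\<close>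
  removes the second-order term and leaves coefficients \<open>c', a', b', g\<close> that are skew in all their
  fibre indices.  They are the components of a 3-form on the base with at least one leg
  along the fibre \<open>u\<close>, and the zero-order condition says that this form is closed.  Contracting
  it with the radial field in \<open>u\<close> alone and integrating along the segments to a fixed \<open>u0\<close> gives a
  potential, which is precisely the list of missing coefficients (\<open>skew_closed_imp_EL\<close>,
  \<open>helmholtz_imp_lagrangian_coeffs\<close>).

  It remains to compare the Helmholtz conditions with the algebraic ones.  The conditions on \<open>dM\<close> and on \<open>S\<close> are
  the first-order Helmholtz conditions with an index of \<open>C, A, B\<close> not yet lowered.  Modulo these, \<open>M H\<close> and \<open>M K\<close>
  differ by the zero-order Helmholtz polynomial: the derivatives of \<open>M\<close> trade the products of first
  derivatives of \<open>f\<close> occurring in \<open>H\<close> and in \<open>K\<close> for one and the same double sum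
  (\<open>multiplier_H_K\<close>); a polynomial in \<open>p, q\<close> vanishes identically exactly if its coefficients do.
\<close>

section \<open>Smooth functions and directional derivatives\<close>

text \<open>The function argument comes before the point, so that partial derivatives iterate:
  \<open>dd v (dd w F)\<close>.\<close>

definition dd :: "'a::euclidean_space \<Rightarrow> ('a \<Rightarrow> real) \<Rightarrow> 'a \<Rightarrow> real" where
  "dd v F z = frechet_derivative F (at z) v"

lemma dd_eq:
  assumes "(F has_derivative F') (at z)" shows "dd v F z = F' v"
  using frechet_derivative_at[OF assms] by (simp add: dd_def)

lemma has_derivative_dd:
  "F differentiable (at z) \<Longrightarrow> (F has_derivative (\<lambda>v. dd v F z)) (at z)"
  by (simp add: dd_def frechet_derivative_works[symmetric])

lemma linear_dd: "F differentiable (at z) \<Longrightarrow> linear (\<lambda>v. dd v F z)"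
  using linear_frechet_derivative[of F "at z"] by (simp add: dd_def)

lemma dd_const [simp]: "dd v (\<lambda>_. c) z = 0"
  by (rule dd_eq) simp

lemma dd_arith:
  assumes "F differentiable (at z)" "G differentiable (at z)"
  shows dd_diff: "dd v (\<lambda>w. F w - G w) z = dd v F z - dd v G z"
    and dd_add: "dd v (\<lambda>w. F w + G w) z = dd v F z + dd v G z"
  by (rule dd_eq, intro derivative_intros has_derivative_dd assms)+

lemma dd_cmult: "F differentiable (at z) \<Longrightarrow> dd v (\<lambda>w. k * F w) z = k * dd v F z"
  by (rule dd_eq, intro derivative_intros has_derivative_dd)

lemma dd_minus: "F differentiable (at z) \<Longrightarrow> dd v (\<lambda>w. - F w) z = - dd v F z"
  by (rule dd_eq, intro derivative_intros has_derivative_dd)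

lemma dd_lincomb:
  assumes "F differentiable (at z)"
  shows "dd (\<Sum>i\<in>I. k i *\<^sub>R e i) F z = (\<Sum>i\<in>I. k i * dd (e i) F z)"
  by (simp add: linear_sum[OF linear_dd[OF assms]] linear_scale[OF linear_dd[OF assms]])

lemma axis_expansion: "(\<Sum>\<beta>\<in>UNIV. p $ \<beta> *\<^sub>R axis \<beta> 1) = (p :: real^'m)"
  using basis_expansion[of p] by (simp add: scalar_mult_eq_scaleR)

lemma differentiable_cong_open:
  assumes "open S" "z \<in> S" "\<And>w. w \<in> S \<Longrightarrow> F w = G w" "F differentiable (at z)"
  shows "G differentiable (at z)"
  using assms has_derivative_transform_within_open unfolding differentiable_def by blast

lemma dd_cong:
  assumes "open S" "z \<in> S" "\<And>w. w \<in> S \<Longrightarrow> F w = G w"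
  shows "dd v F z = dd v G z"
proof (cases "F differentiable (at z)")
  case True
  then show ?thesis
    using frechet_derivative_transform_within_open[OF True, of S G] assms by (simp add: dd_def)
next
  case False
  moreover have "\<not> G differentiable (at z)"
    using differentiable_cong_open[of S z G F] assms False by auto
  ultimately show ?thesis by (auto simp: dd_def frechet_derivative_def differentiable_def)
qed

lemma Ck_on_Suc:
  "Ck_on (Suc k) S F \<longleftrightarrow> (\<forall>z\<in>S. F differentiable (at z)) \<and> (\<forall>v. Ck_on k S (dd v F))"
  by (simp add: dd_def[abs_def])

declare Ck_on.simps(2)[simp del]

lemma Ck_on_cong:
  assumes "open S" "\<And>z. z \<in> S \<Longrightarrow> F z = G z" "Ck_on k S F"
  shows "Ck_on k S G"
  using assms(2,3)
proof (induction k arbitrary: F G)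
  case 0
  then show ?case using continuous_on_cong by force
next
  case (Suc k)
  have "Ck_on k S (dd v G)" for v
    using Suc.IH[of "dd v F" "dd v G"] Suc.prems dd_cong[OF assms(1)] by (metis Ck_on_Suc)
  then show ?case
    using Suc.prems differentiable_cong_open[OF assms(1)] by (metis Ck_on_Suc)
qed

lemma Ck_on_mono_Suc: "Ck_on (Suc k) S F \<Longrightarrow> Ck_on k S F"
proof (induction k arbitrary: F)
  case 0
  then show ?case
    by (simp add: Ck_on_Suc continuous_at_imp_continuous_on differentiable_imp_continuous_within)
next
  case (Suc k)
  then show ?case by (metis Ck_on_Suc)
qed

text \<open>All closure properties below are inductions on the order of differentiability with this rule: it
  suffices to exhibit the directional derivatives on the open set, where they agree with the ones
  taken by \<^const>\<open>dd\<close>.\<close>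

lemma Ck_on_SucI:
  assumes "open S"
    and "\<And>z. z \<in> S \<Longrightarrow> (F has_derivative (\<lambda>v. F' v z)) (at z)"
    and "\<And>v. Ck_on k S (F' v)"
  shows "Ck_on (Suc k) S F"
proof -
  have "Ck_on k S (dd v F)" for v
    by (rule Ck_on_cong[OF assms(1) _ assms(3)[of v]]) (simp add: dd_eq[OF assms(2)])
  then show ?thesis using assms(2) by (auto simp: Ck_on_Suc differentiable_def)
qed

lemma Ck_on_const: "open S \<Longrightarrow> Ck_on k S (\<lambda>_. c)"
proof (induction k arbitrary: c)
  case 0 show ?case by simp
next
  case (Suc k)
  then show ?case by (intro Ck_on_SucI[where F'="\<lambda>_ _. 0"]) auto
qed

lemma Ck_on_add:
  assumes "open S" shows "Ck_on k S F \<Longrightarrow> Ck_on k S G \<Longrightarrow> Ck_on k S (\<lambda>z. F z + G z)"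
proof (induction k arbitrary: F G)
  case 0 then show ?case by (simp add: continuous_on_add continuous_on_mult)
next
  case (Suc k)
  show ?case
    by (rule Ck_on_SucI[where F'="\<lambda>v z. dd v F z + dd v G z"])
       (use Suc assms in \<open>auto simp: Ck_on_Suc intro!: derivative_intros has_derivative_dd\<close>)
qed

lemma Ck_on_mult:
  assumes "open S" shows "Ck_on k S F \<Longrightarrow> Ck_on k S G \<Longrightarrow> Ck_on k S (\<lambda>z. F z * G z)"
proof (induction k arbitrary: F G)
  case 0 then show ?case by (simp add: continuous_on_add continuous_on_mult)
next
  case (Suc k)
  show ?case
  proof (rule Ck_on_SucI[where F'="\<lambda>v z. F z * dd v G z + dd v F z * G z", OF assms])
    show "((\<lambda>z. F z * G z) has_derivative (\<lambda>v. F z * dd v G z + dd v F z * G z)) (at z)"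
      if "z \<in> S" for z
      using Suc.prems that by (auto simp: Ck_on_Suc intro!: derivative_intros has_derivative_dd)
    show "Ck_on k S (\<lambda>z. F z * dd v G z + dd v F z * G z)" for v
      using Suc.prems Suc.prems[THEN Ck_on_mono_Suc]
      by (intro Ck_on_add[OF assms] Suc.IH) (auto simp: Ck_on_Suc)
  qed
qed

lemma Ck_on_compose_affine:
  assumes "open T" "\<And>z. (l has_derivative l') (at z)" "\<And>z. z \<in> T \<Longrightarrow> l z \<in> S"
  shows "Ck_on k S F \<Longrightarrow> Ck_on k T (\<lambda>z. F (l z))"
proof (induction k arbitrary: F)
  case 0
  have "continuous_on T l"
    using has_derivative_continuous[OF assms(2)] by (simp add: continuous_at_imp_continuous_on)
  with 0 show ?case using assms(3) by (auto intro!: continuous_on_compose2[of S F T l])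
next
  case (Suc k)
  show ?case
  proof (rule Ck_on_SucI[where F'="\<lambda>v z. dd (l' v) F (l z)", OF assms(1)])
    show "((\<lambda>z. F (l z)) has_derivative (\<lambda>v. dd (l' v) F (l z))) (at z)" if "z \<in> T" for z
      using has_derivative_compose[OF assms(2) has_derivative_dd[of F "l z"]] Suc.prems
        assms(3)[OF that] by (simp add: Ck_on_Suc)
    show "Ck_on k T (\<lambda>z. dd (l' v) F (l z))" for v
      using Suc by (auto simp: Ck_on_Suc)
  qed
qed

lemma smooth_on_imp_differentiable: "smooth_on S F \<Longrightarrow> z \<in> S \<Longrightarrow> F differentiable (at z)"
  unfolding smooth_on_def by (metis Ck_on_Suc)

lemma smooth_on_imp_continuous: "smooth_on S F \<Longrightarrow> continuous_on S F"
  unfolding smooth_on_def by (metis Ck_on.simps(1))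

lemma smooth_on_dd: "smooth_on S F \<Longrightarrow> smooth_on S (dd v F)"
  unfolding smooth_on_def by (metis Ck_on_Suc)

lemma smooth_on_const: "open S \<Longrightarrow> smooth_on S (\<lambda>_. c)"
  by (simp add: smooth_on_def Ck_on_const)

lemma smooth_on_add:
  "open S \<Longrightarrow> smooth_on S F \<Longrightarrow> smooth_on S G \<Longrightarrow> smooth_on S (\<lambda>z. F z + G z)"
  by (simp add: smooth_on_def Ck_on_add)

lemma smooth_on_mult:
  "open S \<Longrightarrow> smooth_on S F \<Longrightarrow> smooth_on S G \<Longrightarrow> smooth_on S (\<lambda>z. F z * G z)"
  by (simp add: smooth_on_def Ck_on_mult)

lemma smooth_on_minus: "open S \<Longrightarrow> smooth_on S F \<Longrightarrow> smooth_on S (\<lambda>z. - F z)"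
  using smooth_on_mult[OF _ smooth_on_const[of S "-1"], of F] by simp

lemma smooth_on_diff:
  "open S \<Longrightarrow> smooth_on S F \<Longrightarrow> smooth_on S G \<Longrightarrow> smooth_on S (\<lambda>z. F z - G z)"
  using smooth_on_add[of S F "\<lambda>z. - G z"] smooth_on_minus by force

lemma smooth_on_sum:
  assumes "open S" "\<And>i. i \<in> I \<Longrightarrow> smooth_on S (F i)"
  shows "smooth_on S (\<lambda>z. \<Sum>i\<in>I. F i z)"
  using assms(2)
  by (induction I rule: infinite_finite_induct)
     (auto intro: smooth_on_add[OF assms(1)] smooth_on_const[OF assms(1)])

lemma smooth_on_compose_affine:
  assumes "open T" "\<And>z. (l has_derivative l') (at z)" "\<And>z. z \<in> T \<Longrightarrow> l z \<in> S" "smooth_on S F"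
  shows "smooth_on T (\<lambda>z. F (l z))"
  using assms(4) Ck_on_compose_affine[OF assms(1-3)] by (simp add: smooth_on_def)

lemma smooth_on_affine:
  assumes "open S" "\<And>z. (l has_derivative l') (at z)"
  shows "smooth_on S l"
  unfolding smooth_on_def
proof
  fix k show "Ck_on k S l"
  proof (cases k)
    case 0
    then show ?thesis
      using has_derivative_continuous[OF assms(2)] by (simp add: continuous_at_imp_continuous_on)
  next
    case (Suc n)
    then show ?thesis using assms Ck_on_const[OF assms(1)]
      by (auto intro!: Ck_on_SucI[where F'="\<lambda>v _. l' v"])
  qed
qed

lemma smooth_on_subset: "smooth_on S F \<Longrightarrow> T \<subseteq> S \<Longrightarrow> open T \<Longrightarrow> smooth_on T F"
  using smooth_on_compose_affine[of T "\<lambda>z. z" "\<lambda>z. z" S F] by auto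

text \<open>The mean value theorem, applied in direction \<open>v\<close> to the increment of \<open>F\<close> in direction \<open>w\<close> and
  then in direction \<open>w\<close>.\<close>

lemma second_difference_mvt:
  assumes diff: "\<And>a b. 0 \<le> a \<Longrightarrow> a \<le> h \<Longrightarrow> 0 \<le> b \<Longrightarrow> b \<le> h \<Longrightarrow> z + a *\<^sub>R v + b *\<^sub>R w \<in> S"
    and "smooth_on S F" "h > 0"
  obtains a b where "0 \<le> a" "a \<le> h" "0 \<le> b" "b \<le> h"
    "F (z + h *\<^sub>R v + h *\<^sub>R w) - F (z + h *\<^sub>R v) - F (z + h *\<^sub>R w) + F z
       = h^2 * dd w (dd v F) (z + a *\<^sub>R v + b *\<^sub>R w)"
proof -
  have D: "((\<lambda>s. G (c + s *\<^sub>R e)) has_real_derivative dd e G (c + s *\<^sub>R e)) (at s)"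
    if "smooth_on S G" "c + s *\<^sub>R e \<in> S" for G and c e :: 'a and s
  proof -
    have G: "G differentiable (at (c + s *\<^sub>R e))"
      using smooth_on_imp_differentiable that by blast
    have "((\<lambda>s. G (c + s *\<^sub>R e)) has_derivative (\<lambda>t. dd (t *\<^sub>R e) G (c + s *\<^sub>R e))) (at s)"
      by (rule has_derivative_compose[of "\<lambda>s. c + s *\<^sub>R e" "\<lambda>t. t *\<^sub>R e", OF _ has_derivative_dd[OF G]])
         (auto intro!: derivative_eq_intros)
    moreover have "(\<lambda>t. dd (t *\<^sub>R e) G (c + s *\<^sub>R e)) = (*) (dd e G (c + s *\<^sub>R e))"
      by (rule ext) (simp add: linear_scale[OF linear_dd[OF G]])
    ultimately show ?thesis by (simp add: has_field_derivative_def)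
  qed
  let ?g = "\<lambda>s. F ((z + h *\<^sub>R w) + s *\<^sub>R v) - F (z + s *\<^sub>R v)"
  have in1: "z + s *\<^sub>R v \<in> S" "(z + h *\<^sub>R w) + s *\<^sub>R v \<in> S" if "0 \<le> s" "s \<le> h" for s
    using diff[of s 0] diff[of s h] that \<open>h > 0\<close> by (auto simp: algebra_simps)
  have "\<exists>a. 0 < a \<and> a < h \<and> ?g h - ?g 0 =
      (h - 0) * (dd v F ((z + h *\<^sub>R w) + a *\<^sub>R v) - dd v F (z + a *\<^sub>R v))"
    by (rule MVT2) (auto intro!: DERIV_diff D assms in1)
  then obtain a where a: "0 < a" "a < h" and ga: "?g h - ?g 0 =
      h * (dd v F ((z + h *\<^sub>R w) + a *\<^sub>R v) - dd v F (z + a *\<^sub>R v))" by auto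
  have "\<exists>b. 0 < b \<and> b < h \<and> dd v F ((z + a *\<^sub>R v) + h *\<^sub>R w) - dd v F ((z + a *\<^sub>R v) + 0 *\<^sub>R w) =
      (h - 0) * dd w (dd v F) ((z + a *\<^sub>R v) + b *\<^sub>R w)"
    by (rule MVT2) (use a diff \<open>h > 0\<close> in \<open>auto intro!: D smooth_on_dd assms\<close>)
  then obtain b where b: "0 < b" "b < h" and gb:
    "dd v F ((z + a *\<^sub>R v) + h *\<^sub>R w) - dd v F (z + a *\<^sub>R v) = h * dd w (dd v F) (z + a *\<^sub>R v + b *\<^sub>R w)"
    by auto
  show thesis
  proof
    have e1: "(z + h *\<^sub>R w) + a *\<^sub>R v = (z + a *\<^sub>R v) + h *\<^sub>R w"
      and e2: "z + h *\<^sub>R w + h *\<^sub>R v = z + h *\<^sub>R v + h *\<^sub>R w"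
      by (simp_all add: algebra_simps)
    have "F (z + h *\<^sub>R v + h *\<^sub>R w) - F (z + h *\<^sub>R v) - (F (z + h *\<^sub>R w) - F z) =
        h * (h * dd w (dd v F) (z + a *\<^sub>R v + b *\<^sub>R w))"
      using ga unfolding e1 e2 gb by simp
    then show "F (z + h *\<^sub>R v + h *\<^sub>R w) - F (z + h *\<^sub>R v) - F (z + h *\<^sub>R w) + F z
       = h^2 * dd w (dd v F) (z + a *\<^sub>R v + b *\<^sub>R w)"
      by (simp add: power2_eq_square)
  qed (use a b in auto)
qed

text \<open>The second difference, symmetric in \<open>v\<close> and \<open>w\<close>, is \<open>h\<^sup>2\<close> times either mixed derivative at some nearby point.  If the
  two derivatives differed at \<open>z\<close>, continuity would keep them apart near \<open>z\<close>.\<close>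

lemma dd_commute:
  assumes "open S" "z \<in> S" "smooth_on S F"
  shows "dd v (dd w F) z = dd w (dd v F) z"
proof (rule ccontr)
  assume ne: "dd v (dd w F) z \<noteq> dd w (dd v F) z"
  \<comment> \<open>Radius for which the balls around the two values are disjoint.\<close>
  define e where "e = \<bar>dd v (dd w F) z - dd w (dd v F) z\<bar> / 2"
  have "e > 0" using ne by (simp add: e_def)
  have close: "\<exists>d>0. \<forall>y. dist y z < d \<longrightarrow> y \<in> S \<and> dist (H y) (H z) < e"
    if "smooth_on S H" for H
  proof -
    have "continuous (at z) H"
      using smooth_on_imp_differentiable[OF that assms(2)] differentiable_imp_continuous_within by blast
    then obtain d where "d > 0" "\<forall>y. dist y z < d \<longrightarrow> dist (H y) (H z) < e"
      using \<open>e > 0\<close> by (auto simp: continuous_at_eps_delta)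
    moreover obtain d' where "d' > 0" "\<forall>y. dist y z < d' \<longrightarrow> y \<in> S"
      using assms(1,2) by (auto simp: open_dist)
    ultimately show ?thesis by (intro exI[of _ "min d d'"]) auto
  qed
  obtain d1 where d1: "d1 > 0" "\<And>y. dist y z < d1 \<Longrightarrow> y \<in> S \<and> dist (dd v (dd w F) y) (dd v (dd w F) z) < e"
    using close[of "dd v (dd w F)"] assms(3) smooth_on_dd by blast
  obtain d2 where d2: "d2 > 0" "\<And>y. dist y z < d2 \<Longrightarrow> y \<in> S \<and> dist (dd w (dd v F) y) (dd w (dd v F) z) < e"
    using close[of "dd w (dd v F)"] assms(3) smooth_on_dd by blast
  \<comment> \<open>Small enough for the parallelogram spanned at \<open>z\<close> by \<open>h v\<close> and \<open>h w\<close> to stay in both balls.\<close>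
  define h where "h = min d1 d2 / (2 * (norm v + norm w + 1))"
  have h: "h > 0" using d1 d2 by (simp add: h_def add_nonneg_pos)
  have near: "dist (z + a *\<^sub>R v + b *\<^sub>R w) z < min d1 d2"
    if "0 \<le> a" "a \<le> h" "0 \<le> b" "b \<le> h" for a b
  proof -
    have "dist (z + a *\<^sub>R v + b *\<^sub>R w) z \<le> a * norm v + b * norm w"
      using norm_triangle_ineq[of "a *\<^sub>R v" "b *\<^sub>R w"] that by (simp add: dist_norm add.assoc)
    also have "\<dots> \<le> h * norm v + h * norm w"
      using that by (intro add_mono mult_right_mono) auto
    also have "\<dots> \<le> h * (norm v + norm w + 1)" using h by (simp add: algebra_simps)
    also have "\<dots> = min d1 d2 / 2"
      by (simp add: h_def divide_simps add_nonneg_eq_0_iff)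
    also have "\<dots> < min d1 d2" using d1(1) d2(1) by (simp add: min_def)
    finally show ?thesis .
  qed
  obtain a b where ab: "0 \<le> a" "a \<le> h" "0 \<le> b" "b \<le> h" and 1:
    "F (z + h *\<^sub>R v + h *\<^sub>R w) - F (z + h *\<^sub>R v) - F (z + h *\<^sub>R w) + F z
       = h^2 * dd w (dd v F) (z + a *\<^sub>R v + b *\<^sub>R w)"
    by (rule second_difference_mvt[of h z v w S F, OF _ assms(3) h])
       (use near d1 in \<open>force\<close>)+
  obtain c d where cd: "0 \<le> c" "c \<le> h" "0 \<le> d" "d \<le> h" and 2:
    "F (z + h *\<^sub>R w + h *\<^sub>R v) - F (z + h *\<^sub>R w) - F (z + h *\<^sub>R v) + F z
       = h^2 * dd v (dd w F) (z + c *\<^sub>R w + d *\<^sub>R v)"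
  proof (rule second_difference_mvt[of h z w v S F, OF _ assms(3) h])
    fix a b assume "0 \<le> a" "a \<le> h" "0 \<le> b" "b \<le> h"
    then show "z + a *\<^sub>R w + b *\<^sub>R v \<in> S" using near[of b a] d1(2) by (simp add: algebra_simps)
  qed
  have e1: "z + h *\<^sub>R w + h *\<^sub>R v = z + h *\<^sub>R v + h *\<^sub>R w"
    and e2: "z + c *\<^sub>R w + d *\<^sub>R v = z + d *\<^sub>R v + c *\<^sub>R w"
    by (simp_all add: algebra_simps)
  have "h^2 * dd v (dd w F) (z + d *\<^sub>R v + c *\<^sub>R w) = h^2 * dd w (dd v F) (z + a *\<^sub>R v + b *\<^sub>R w)"
    using 1 2 unfolding e1 e2 by linarith
  then have "dd v (dd w F) (z + d *\<^sub>R v + c *\<^sub>R w) = dd w (dd v F) (z + a *\<^sub>R v + b *\<^sub>R w)"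
    using h by simp
  moreover have "dist (dd v (dd w F) (z + d *\<^sub>R v + c *\<^sub>R w)) (dd v (dd w F) z) < e"
    using d1(2) near[of d c] cd by auto
  moreover have "dist (dd w (dd v F) (z + a *\<^sub>R v + b *\<^sub>R w)) (dd w (dd v F) z) < e"
    using d2(2) near[of a b] ab by auto
  ultimately show False by (simp add: e_def dist_real_def abs_if split: if_splits)
qed

section \<open>Integrals along segments\<close>

definition seg_int :: "('a::euclidean_space \<Rightarrow> 'a) \<Rightarrow> ('a \<Rightarrow> 'a) \<Rightarrow> nat \<Rightarrow> ('a \<Rightarrow> real) \<Rightarrow> 'a \<Rightarrow> real" where
  "seg_int A B n F z = integral {0..1} (\<lambda>t. t ^ n * F (A z + t *\<^sub>R B z))"

text \<open>\<open>A z + t B z\<close> moves from \<open>A z\<close> at \<open>t = 0\<close> to \<open>A z + B z\<close> at \<open>t = 1\<close>.  Both maps are affine,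
  with linear parts \<open>a\<close> and \<open>b\<close>; for the fibrewise contraction to \<open>u0\<close> they are
  \<open>(x, y, u0)\<close> and \<open>(0, 0, u - u0)\<close>.\<close>

locale dilation =
  fixes A B a b :: "'a::euclidean_space \<Rightarrow> 'a" and S W :: "'a set"
  assumes A: "\<And>z. (A has_derivative a) (at z)"
    and B: "\<And>z. (B has_derivative b) (at z)"
    and open_W: "open W" and convex_W: "convex W"
    and maps_into: "\<And>z t. z \<in> W \<Longrightarrow> 0 \<le> t \<Longrightarrow> t \<le> 1 \<Longrightarrow> A z + t *\<^sub>R B z \<in> S"
begin

lemma continuous_A: "continuous_on T A"
  using has_derivative_continuous[OF A] by (simp add: continuous_at_imp_continuous_on)

lemma continuous_B: "continuous_on T B"
  using has_derivative_continuous[OF B] by (simp add: continuous_at_imp_continuous_on)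

lemma continuous_on_dilate:
  assumes "continuous_on S F"
  shows "continuous_on (W \<times> cbox 0 1) (\<lambda>(z, t). t ^ n * F (A z + t *\<^sub>R B z))"
proof -
  have A': "continuous_on (W \<times> cbox 0 1) (\<lambda>x. A (fst x))"
    if "continuous_on UNIV A" for A :: "'a \<Rightarrow> 'a"
    by (rule continuous_on_compose2[OF that continuous_on_fst]) (auto intro: continuous_intros)
  have "continuous_on (W \<times> cbox (0::real) 1) (\<lambda>x. A (fst x) + snd x *\<^sub>R B (fst x))"
    by (intro continuous_intros A' continuous_A continuous_B)
  then have "continuous_on (W \<times> cbox (0::real) 1) (\<lambda>x. F (A (fst x) + snd x *\<^sub>R B (fst x)))"
    by (rule continuous_on_compose2[OF assms]) (auto simp: maps_into)
  then show ?thesis by (auto simp: split_beta intro!: continuous_intros)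
qed

lemma integrable_dilate:
  assumes "continuous_on S F" "z \<in> W"
  shows "(\<lambda>t. t ^ n * F (A z + t *\<^sub>R B z)) integrable_on {0..1}"
proof (rule integrable_continuous_real)
  show "continuous_on {0..1} (\<lambda>t. t ^ n * F (A z + t *\<^sub>R B z))"
  proof -
    have pair: "continuous_on {0..1} (\<lambda>t::real. (z, t))" by (intro continuous_intros)
    have "(\<lambda>t. (z, t)) ` {0..1::real} \<subseteq> W \<times> cbox 0 1" using assms(2) by auto
    from continuous_on_compose2[OF continuous_on_dilate[OF assms(1), of n] pair this]
    show ?thesis by simp
  qed
qed

lemma seg_int_add:
  assumes "continuous_on S F" "continuous_on S G" "z \<in> W"
  shows "seg_int A B n (\<lambda>w. F w + G w) z = seg_int A B n F z + seg_int A B n G z"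
  unfolding seg_int_def distrib_left
  using assms by (intro integral_add integrable_dilate)

lemma seg_int_cmult: "seg_int A B n (\<lambda>w. c * F w) z = c * seg_int A B n F z"
  unfolding seg_int_def by (simp add: mult.left_commute[of _ c])

lemma seg_int_cong:
  assumes "\<And>w. w \<in> S \<Longrightarrow> F w = G w" "z \<in> W"
  shows "seg_int A B n F z = seg_int A B n G z"
  unfolding seg_int_def by (intro Henstock_Kurzweil_Integration.integral_cong) (use assms maps_into in auto)

lemma seg_int_sum:
  assumes "\<And>i. i \<in> I \<Longrightarrow> continuous_on S (F i)" "z \<in> W"
  shows "seg_int A B n (\<lambda>w. \<Sum>i\<in>I. F i w) z = (\<Sum>i\<in>I. seg_int A B n (F i) z)"
  using assms(1)
proof (induction I rule: infinite_finite_induct)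
  case (insert i I)
  then show ?case using assms(2) by (simp add: seg_int_add continuous_on_sum)
qed (simp_all add: seg_int_def)

text \<open>The chain rule produces \<open>a v + t b v\<close> as direction; the factor \<open>t\<close> raises the weight of the second
  integral by one.  So the family of all \<^const>\<open>seg_int\<close> is closed under differentiation, which is why
  the weight \<open>t ^ n\<close> is part of the definition.\<close>

lemma has_derivative_seg_int:
  assumes F: "smooth_on S F" and z: "z \<in> W"
  shows "(seg_int A B n F has_derivative
    (\<lambda>v. seg_int A B n (dd (a v) F) z + seg_int A B (Suc n) (dd (b v) F) z)) (at z)"
proof -
  have cont: "continuous_on S (dd v F)" for v
    by (rule smooth_on_imp_continuous[OF smooth_on_dd[OF F]])
  let ?D = "\<lambda>w t v. t ^ n * dd (a v) F (A w + t *\<^sub>R B w) + t ^ Suc n * dd (b v) F (A w + t *\<^sub>R B w)"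
  have D: "((\<lambda>w. t ^ n * F (A w + t *\<^sub>R B w)) has_derivative ?D w t) (at w)"
    if "w \<in> W" "t \<in> cbox 0 1" for w t
  proof -
    have d: "F differentiable (at (A w + t *\<^sub>R B w))"
      using that maps_into smooth_on_imp_differentiable[OF F] by auto
    have "((\<lambda>w. A w + t *\<^sub>R B w) has_derivative (\<lambda>v. a v + t *\<^sub>R b v)) (at w)"
      by (intro derivative_intros A B)
    from has_derivative_compose[OF this has_derivative_dd[OF d]]
    have "((\<lambda>w. t ^ n * F (A w + t *\<^sub>R B w)) has_derivative
        (\<lambda>v. t ^ n * dd (a v + t *\<^sub>R b v) F (A w + t *\<^sub>R B w))) (at w)"
      by (intro derivative_intros)
    then show ?thesis
      by (simp add: linear_add[OF linear_dd[OF d]] linear_scale[OF linear_dd[OF d]] algebra_simps)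
  qed
  define fx where "fx w t = Blinfun (?D w t)" for w t
  have fx: "blinfun_apply (fx w t) = ?D w t" if "w \<in> W" "t \<in> cbox 0 1" for w t
    unfolding fx_def using has_derivative_bounded_linear[OF D[OF that]] by (rule bounded_linear_Blinfun_apply)
  \<comment> \<open>The Leibniz rule wants the derivative as a continuous map into the bounded linear operators; continuity on a basis is enough.\<close>
  have cont_fx: "continuous_on (W \<times> cbox 0 1) (\<lambda>(w, t). fx w t)"
  proof (rule continuous_on_blinfun_componentwise)
    fix i :: 'a
    have "continuous_on (W \<times> cbox 0 1) (\<lambda>x. (case x of (w, t) \<Rightarrow> t ^ n * dd (a i) F (A w + t *\<^sub>R B w))
       + (case x of (w, t) \<Rightarrow> t ^ Suc n * dd (b i) F (A w + t *\<^sub>R B w)))"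
      by (intro continuous_on_add continuous_on_dilate cont)
    then show "continuous_on (W \<times> cbox 0 1) (\<lambda>x. blinfun_apply (case x of (w, t) \<Rightarrow> fx w t) i)"
      by (rule continuous_on_eq) (auto simp: fx simp del: power_Suc)
  qed
  have int_fx: "fx z integrable_on cbox 0 1"
  proof (rule integrable_continuous)
    show "continuous_on (cbox 0 1) (fx z)"
    proof -
      have pair: "continuous_on (cbox 0 1) (\<lambda>t::real. (z, t))" by (intro continuous_intros)
      have "(\<lambda>t. (z, t)) ` cbox 0 (1::real) \<subseteq> W \<times> cbox 0 1" using z by auto
      from continuous_on_compose2[OF cont_fx pair this] show ?thesis by simp
    qed
  qed
  have "((\<lambda>w. integral (cbox 0 1) (\<lambda>t. t ^ n * F (A w + t *\<^sub>R B w))) has_derivative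
      integral (cbox 0 1) (fx z)) (at z within W)"
  proof (rule leibniz_rule[OF _ _ cont_fx z convex_W])
    show "((\<lambda>w. t ^ n * F (A w + t *\<^sub>R B w)) has_derivative blinfun_apply (fx w t)) (at w within W)"
      if "w \<in> W" "t \<in> cbox 0 1" for w t
      using D[OF that] fx[OF that] has_derivative_at_withinI by metis
    show "(\<lambda>t. t ^ n * F (A w + t *\<^sub>R B w)) integrable_on cbox 0 1" if "w \<in> W" for w
      using integrable_dilate[OF smooth_on_imp_continuous[OF F] that] by simp
  qed
  moreover have "blinfun_apply (integral (cbox 0 1) (fx z)) =
      (\<lambda>v. seg_int A B n (dd (a v) F) z + seg_int A B (Suc n) (dd (b v) F) z)"
  proof
    fix v
    have "blinfun_apply (integral (cbox 0 1) (fx z)) v = integral {0..1} (\<lambda>t. ?D z t v)"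
      unfolding blinfun_apply_integral[OF int_fx] unfolding box_real
      by (rule Henstock_Kurzweil_Integration.integral_cong) (simp add: fx[OF z])
    also have "\<dots> = seg_int A B n (dd (a v) F) z + seg_int A B (Suc n) (dd (b v) F) z"
      unfolding seg_int_def by (intro integral_add integrable_dilate cont z)
    finally show "blinfun_apply (integral (cbox 0 1) (fx z)) v =
      seg_int A B n (dd (a v) F) z + seg_int A B (Suc n) (dd (b v) F) z" .
  qed
  ultimately show ?thesis
    unfolding at_within_open[OF z open_W] seg_int_def[abs_def] box_real by (simp only:)
qed

lemma smooth_on_seg_int:
  assumes "smooth_on S F" shows "smooth_on W (seg_int A B n F)"
proof -
  have "Ck_on k W (seg_int A B n F)" for k
    using assms
  proof (induction k arbitrary: F n)
    case 0
    show ?case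
      using has_derivative_continuous[OF has_derivative_seg_int[OF 0]]
      by (simp add: continuous_at_imp_continuous_on)
  next
    case (Suc k)
    show ?case
      by (rule Ck_on_SucI[OF open_W has_derivative_seg_int[OF Suc.prems]])
         (assumption, intro Ck_on_add[OF open_W] Suc.IH smooth_on_dd Suc.prems)
  qed
  then show ?thesis by (simp add: smooth_on_def)
qed

text \<open>The fundamental theorem of calculus for \<open>t ^ (n + 1) * F (A z + t B z)\<close>.\<close>

lemma seg_int_homotopy:
  assumes F: "smooth_on S F" and z: "z \<in> W"
  shows "real (Suc n) * seg_int A B n F z + seg_int A B (Suc n) (dd (B z) F) z = F (A z + B z)"
proof -
  have "((\<lambda>t. t ^ Suc n * F (A z + t *\<^sub>R B z)) has_vector_derivative
      real (Suc n) * (t ^ n * F (A z + t *\<^sub>R B z)) + t ^ Suc n * dd (B z) F (A z + t *\<^sub>R B z))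
      (at t within {0..1})"
    if "t \<in> {0..1}" for t
  proof -
    have d: "F differentiable (at (A z + t *\<^sub>R B z))"
      using that maps_into z smooth_on_imp_differentiable[OF F] by auto
    have "((\<lambda>t. F (A z + t *\<^sub>R B z)) has_derivative (\<lambda>s. dd (s *\<^sub>R B z) F (A z + t *\<^sub>R B z)))
        (at t within {0..1})"
      by (rule has_derivative_compose[of "\<lambda>t. A z + t *\<^sub>R B z" "\<lambda>s. s *\<^sub>R B z", OF _ has_derivative_dd[OF d]])
         (auto intro!: derivative_eq_intros)
    moreover have "(\<lambda>s. dd (s *\<^sub>R B z) F (A z + t *\<^sub>R B z)) = (*) (dd (B z) F (A z + t *\<^sub>R B z))"
      by (rule ext) (simp add: linear_scale[OF linear_dd[OF d]])
    ultimately have "((\<lambda>t. F (A z + t *\<^sub>R B z)) has_real_derivative dd (B z) F (A z + t *\<^sub>R B z))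
        (at t within {0..1})"
      by (simp add: has_field_derivative_def)
    moreover have "((\<lambda>t. t ^ Suc n) has_real_derivative real (Suc n) * t ^ n) (at t within {0..1})"
      by (auto intro!: derivative_eq_intros simp del: power_Suc)
    ultimately have "((\<lambda>t. t ^ Suc n * F (A z + t *\<^sub>R B z)) has_real_derivative
        real (Suc n) * t ^ n * F (A z + t *\<^sub>R B z) + dd (B z) F (A z + t *\<^sub>R B z) * t ^ Suc n)
        (at t within {0..1})"
      by (rule DERIV_mult[rotated])
    then show ?thesis
      by (simp add: has_real_derivative_iff_has_vector_derivative mult_ac del: power_Suc of_nat_Suc)
  qed
  from fundamental_theorem_of_calculus[OF _ this]
  have "((\<lambda>t. real (Suc n) * (t ^ n * F (A z + t *\<^sub>R B z)) + t ^ Suc n * dd (B z) F (A z + t *\<^sub>R B z))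
      has_integral F (A z + B z)) {0..1}" by simp
  then have "F (A z + B z) = integral {0..1} (\<lambda>t. real (Suc n) * (t ^ n * F (A z + t *\<^sub>R B z))
      + t ^ Suc n * dd (B z) F (A z + t *\<^sub>R B z))"
    by (rule integral_unique[symmetric])
  also have "\<dots> = integral {0..1} (\<lambda>t. real (Suc n) * (t ^ n * F (A z + t *\<^sub>R B z)))
      + integral {0..1} (\<lambda>t. t ^ Suc n * dd (B z) F (A z + t *\<^sub>R B z))"
    by (intro integral_add integrable_on_mult_right integrable_dilate smooth_on_imp_continuous F smooth_on_dd z)
  finally show ?thesis by (simp add: seg_int_def del: of_nat_Suc)
qed

end

section \<open>Bi-affine functions on jets\<close>

abbreviation Dx :: "(('m::finite) base \<Rightarrow> real) \<Rightarrow> 'm base \<Rightarrow> real" where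
  "Dx \<equiv> dd (1, 0, 0)"
abbreviation Dy :: "(('m::finite) base \<Rightarrow> real) \<Rightarrow> 'm base \<Rightarrow> real" where
  "Dy \<equiv> dd (0, 1, 0)"
abbreviation Du :: "'m \<Rightarrow> (('m::finite) base \<Rightarrow> real) \<Rightarrow> 'm base \<Rightarrow> real" where
  "Du \<alpha> \<equiv> dd (0, 0, axis \<alpha> 1)"

definition base_pt :: "('m::finite) jet \<Rightarrow> 'm base" where
  "base_pt z = (fst z, fst (snd z), fst (snd (snd z)))"

definition ux :: "('m::finite) jet \<Rightarrow> real^'m" where
  "ux z = fst (snd (snd (snd z)))"

definition uy :: "('m::finite) jet \<Rightarrow> real^'m" where
  "uy z = snd (snd (snd (snd z)))"

lemmas jet_proj = base_pt_def ux_def uy_def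

lemma jets_over_eq: "jets_over V = base_pt -` V"
  by (auto simp: jets_over_def base_pt_def)

lemma mem_jets_over [simp]: "(x, y, u, p, q) \<in> jets_over V \<longleftrightarrow> (x, y, u) \<in> V"
  by (simp add: jets_over_def)

lemma bounded_linear_base_pt: "bounded_linear base_pt"
  unfolding base_pt_def[abs_def]
  by (intro bounded_linear_Pair bounded_linear_fst bounded_linear_snd
      bounded_linear_compose[OF bounded_linear_fst] bounded_linear_compose[OF bounded_linear_snd])

lemma bounded_linear_ux: "bounded_linear (\<lambda>z. ux z $ i)"
  unfolding ux_def[abs_def]
  by (intro bounded_linear_compose[OF bounded_linear_vec_nth] bounded_linear_snd
      bounded_linear_compose[OF bounded_linear_fst] bounded_linear_compose[OF bounded_linear_snd])

lemma bounded_linear_uy: "bounded_linear (\<lambda>z. uy z $ i)"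
  unfolding uy_def[abs_def]
  by (intro bounded_linear_compose[OF bounded_linear_vec_nth] bounded_linear_snd
      bounded_linear_compose[OF bounded_linear_fst] bounded_linear_compose[OF bounded_linear_snd])

lemmas has_derivative_jet_proj =
  bounded_linear_imp_has_derivative[OF bounded_linear_base_pt]
  bounded_linear_imp_has_derivative[OF bounded_linear_ux]
  bounded_linear_imp_has_derivative[OF bounded_linear_uy]

lemma open_jets_over: "open V \<Longrightarrow> open (jets_over V)"
  unfolding jets_over_eq
  by (rule open_vimage) (auto simp: bounded_linear_base_pt linear_continuous_on)

lemma smooth_on_jets_base:
  assumes "open V" "smooth_on V F" shows "smooth_on (jets_over V) (\<lambda>z. F (base_pt z))"
  by (rule smooth_on_compose_affine[OF open_jets_over[OF assms(1)] has_derivative_jet_proj(1) _ assms(2)])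
     (simp add: jets_over_eq)

text \<open>The functions \<open>c p q + a p + b q + g\<close> with coefficients on the base.  The right-hand side of the
  system, its lowered form, the admissible Lagrangians and their Euler-Lagrange expressions all have this shape, and
  the shape is preserved by every partial derivative.\<close>

definition bipoly ::
  "('m \<Rightarrow> 'm \<Rightarrow> 'm base \<Rightarrow> real) \<Rightarrow> ('m \<Rightarrow> 'm base \<Rightarrow> real) \<Rightarrow> ('m \<Rightarrow> 'm base \<Rightarrow> real) \<Rightarrow>
   ('m base \<Rightarrow> real) \<Rightarrow> ('m::finite) jet \<Rightarrow> real" where
  "bipoly c a b g z =
     (\<Sum>\<beta>\<in>UNIV. \<Sum>\<gamma>\<in>UNIV. c \<beta> \<gamma> (base_pt z) * (ux z $ \<beta> * uy z $ \<gamma>))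
     + (\<Sum>\<beta>\<in>UNIV. a \<beta> (base_pt z) * ux z $ \<beta>)
     + (\<Sum>\<gamma>\<in>UNIV. b \<gamma> (base_pt z) * uy z $ \<gamma>)
     + g (base_pt z)"

lemma smooth_on_bipoly:
  assumes V: "open V" and "\<And>\<beta> \<gamma>. smooth_on V (c \<beta> \<gamma>)" "\<And>\<beta>. smooth_on V (a \<beta>)"
    "\<And>\<beta>. smooth_on V (b \<beta>)" "smooth_on V g"
  shows "smooth_on (jets_over V) (bipoly c a b g)"
  unfolding bipoly_def[abs_def]
  by (intro smooth_on_add smooth_on_sum smooth_on_mult open_jets_over V smooth_on_jets_base assms
      smooth_on_affine[OF _ has_derivative_jet_proj(2)] smooth_on_affine[OF _ has_derivative_jet_proj(3)])

lemma has_derivative_bipoly: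
  assumes "\<And>\<beta> \<gamma>. c \<beta> \<gamma> differentiable (at (base_pt z))" "\<And>\<beta>. a \<beta> differentiable (at (base_pt z))"
    "\<And>\<beta>. b \<beta> differentiable (at (base_pt z))" "g differentiable (at (base_pt z))"
  shows "(bipoly c a b g has_derivative (\<lambda>v.
      bipoly (\<lambda>\<beta> \<gamma>. dd (base_pt v) (c \<beta> \<gamma>)) (\<lambda>\<beta>. dd (base_pt v) (a \<beta>)) (\<lambda>\<beta>. dd (base_pt v) (b \<beta>))
        (dd (base_pt v) g) z
      + (\<Sum>\<beta>\<in>UNIV. \<Sum>\<gamma>\<in>UNIV. c \<beta> \<gamma> (base_pt z) * (ux v $ \<beta> * uy z $ \<gamma> + ux z $ \<beta> * uy v $ \<gamma>))
      + (\<Sum>\<beta>\<in>UNIV. a \<beta> (base_pt z) * ux v $ \<beta>)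
      + (\<Sum>\<gamma>\<in>UNIV. b \<gamma> (base_pt z) * uy v $ \<gamma>))) (at z)"
proof -
  have D: "((\<lambda>z. F (base_pt z)) has_derivative (\<lambda>v. dd (base_pt v) F (base_pt z))) (at z)"
    if "F differentiable (at (base_pt z))" for F :: "'a base \<Rightarrow> real"
    by (rule has_derivative_compose[OF has_derivative_jet_proj(1) has_derivative_dd[OF that]])
  show ?thesis
    unfolding bipoly_def[abs_def]
    by (rule has_derivative_eq_rhs, (rule has_derivative_add has_derivative_sum has_derivative_mult
        D assms has_derivative_jet_proj(2) has_derivative_jet_proj(3))+)
       (simp add: fun_eq_iff sum.distrib algebra_simps)
qed

text \<open>Derivatives along the base act on the coefficients; derivatives along \<open>p\<close> and \<open>q\<close> lower the degree
  and shift the coefficients.\<close>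

lemma d_bipoly:
  assumes "smooth_on V g" "\<And>\<beta> \<gamma>. smooth_on V (c \<beta> \<gamma>)" "\<And>\<beta>. smooth_on V (a \<beta>)"
    "\<And>\<beta>. smooth_on V (b \<beta>)" and z: "z \<in> jets_over V"
  shows d_x_bipoly: "d_x (bipoly c a b g) z =
      bipoly (\<lambda>\<beta> \<gamma>. Dx (c \<beta> \<gamma>)) (\<lambda>\<beta>. Dx (a \<beta>)) (\<lambda>\<beta>. Dx (b \<beta>)) (Dx g) z"
    and d_y_bipoly: "d_y (bipoly c a b g) z =
      bipoly (\<lambda>\<beta> \<gamma>. Dy (c \<beta> \<gamma>)) (\<lambda>\<beta>. Dy (a \<beta>)) (\<lambda>\<beta>. Dy (b \<beta>)) (Dy g) z"
    and d_u_bipoly: "d_u \<alpha> (bipoly c a b g) z =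
      bipoly (\<lambda>\<beta> \<gamma>. Du \<alpha> (c \<beta> \<gamma>)) (\<lambda>\<beta>. Du \<alpha> (a \<beta>)) (\<lambda>\<beta>. Du \<alpha> (b \<beta>)) (Du \<alpha> g) z"
    and d_ux_bipoly: "d_ux \<alpha> (bipoly c a b g) z = bipoly (\<lambda>_ _ _. 0) (\<lambda>_ _. 0) (c \<alpha>) (a \<alpha>) z"
    and d_uy_bipoly: "d_uy \<alpha> (bipoly c a b g) z = bipoly (\<lambda>_ _ _. 0) (\<lambda>\<beta>. c \<beta> \<alpha>) (\<lambda>_ _. 0) (b \<alpha>) z"
proof -
  have "base_pt z \<in> V" using z by (simp add: jets_over_eq)
  then have diff: "F differentiable (at (base_pt z))" if "smooth_on V F" for F
    using smooth_on_imp_differentiable that by blast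
  have D: "dd v (bipoly c a b g) z =
      bipoly (\<lambda>\<beta> \<gamma>. dd (base_pt v) (c \<beta> \<gamma>)) (\<lambda>\<beta>. dd (base_pt v) (a \<beta>)) (\<lambda>\<beta>. dd (base_pt v) (b \<beta>))
        (dd (base_pt v) g) z
      + (\<Sum>\<beta>\<in>UNIV. \<Sum>\<gamma>\<in>UNIV. c \<beta> \<gamma> (base_pt z) * (ux v $ \<beta> * uy z $ \<gamma> + ux z $ \<beta> * uy v $ \<gamma>))
      + (\<Sum>\<beta>\<in>UNIV. a \<beta> (base_pt z) * ux v $ \<beta>)
      + (\<Sum>\<gamma>\<in>UNIV. b \<gamma> (base_pt z) * uy v $ \<gamma>)" for v
    by (rule dd_eq[OF has_derivative_bipoly]) (intro diff assms)+
  have dd0: "dd 0 F (base_pt z) = 0" if "smooth_on V F" for F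
    using linear_0[OF linear_dd[OF diff[OF that]]] .
  have zero: "(0::'a base) = (0, 0, 0)" by (simp add: zero_prod_def)
  note dd0' = dd0[unfolded zero]
  show "d_x (bipoly c a b g) z =
      bipoly (\<lambda>\<beta> \<gamma>. Dx (c \<beta> \<gamma>)) (\<lambda>\<beta>. Dx (a \<beta>)) (\<lambda>\<beta>. Dx (b \<beta>)) (Dx g) z"
    "d_y (bipoly c a b g) z =
      bipoly (\<lambda>\<beta> \<gamma>. Dy (c \<beta> \<gamma>)) (\<lambda>\<beta>. Dy (a \<beta>)) (\<lambda>\<beta>. Dy (b \<beta>)) (Dy g) z"
    "d_u \<alpha> (bipoly c a b g) z =
      bipoly (\<lambda>\<beta> \<gamma>. Du \<alpha> (c \<beta> \<gamma>)) (\<lambda>\<beta>. Du \<alpha> (a \<beta>)) (\<lambda>\<beta>. Du \<alpha> (b \<beta>)) (Du \<alpha> g) z"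
    unfolding d_x_def d_y_def d_u_def dd_def[symmetric] D by (simp_all add: jet_proj)
  have sum_if: "(\<Sum>\<gamma>\<in>UNIV. if T then F \<gamma> else 0) = (if T then sum F UNIV else 0)"
    for T and F :: "'a \<Rightarrow> real" by simp
  show "d_ux \<alpha> (bipoly c a b g) z = bipoly (\<lambda>_ _ _. 0) (\<lambda>_ _. 0) (c \<alpha>) (a \<alpha>) z"
    unfolding d_ux_def dd_def[symmetric] D
    by (simp add: bipoly_def ux_def[of "(_, _)"] uy_def[of "(_, _)"] base_pt_def[of "(_, _)"]
        dd0' assms sum_if axis_def[of \<alpha>] if_distrib if_distribR cong: if_cong)
  show "d_uy \<alpha> (bipoly c a b g) z = bipoly (\<lambda>_ _ _. 0) (\<lambda>\<beta>. c \<beta> \<alpha>) (\<lambda>_ _. 0) (b \<alpha>) z"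
    unfolding d_uy_def dd_def[symmetric] D
    by (simp add: bipoly_def ux_def[of "(_, _)"] uy_def[of "(_, _)"] base_pt_def[of "(_, _)"]
        dd0' assms sum_if axis_def[of \<alpha>] if_distrib if_distribR cong: if_cong)
qed

section \<open>Euler-Lagrange expressions of bi-affine Lagrangians\<close>

text \<open>The coefficients of the Euler-Lagrange expression of \<open>h p q + P p + Q q + R\<close>, apart from that of \<open>u\<^sub>x\<^sub>y\<close>
  (see \<open>euler_lagrange_bipoly\<close>).\<close>

definition EL_c where
  "EL_c h \<alpha> \<beta> \<gamma> b = Du \<alpha> (h \<beta> \<gamma>) b - Du \<beta> (h \<alpha> \<gamma>) b - Du \<gamma> (h \<beta> \<alpha>) b"
definition EL_a where
  "EL_a h P \<alpha> \<beta> b = Du \<alpha> (P \<beta>) b - Du \<beta> (P \<alpha>) b - Dy (h \<beta> \<alpha>) b"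
definition EL_b where
  "EL_b h Q \<alpha> \<beta> b = Du \<alpha> (Q \<beta>) b - Du \<beta> (Q \<alpha>) b - Dx (h \<alpha> \<beta>) b"
definition EL_g where
  "EL_g P Q R \<alpha> b = Du \<alpha> R b - Dx (P \<alpha>) b - Dy (Q \<alpha>) b"

lemma d_cong:
  assumes "open V" "z \<in> jets_over V" "\<And>w. w \<in> jets_over V \<Longrightarrow> F w = G w"
  shows "d_x F z = d_x G z" "d_y F z = d_y G z" "d_u \<alpha> F z = d_u \<alpha> G z"
    "d_ux \<alpha> F z = d_ux \<alpha> G z" "d_uy \<alpha> F z = d_uy \<alpha> G z"
  using dd_cong[OF open_jets_over[OF assms(1)] assms(2,3)]
  by (simp_all add: d_x_def d_y_def d_u_def d_ux_def d_uy_def dd_def[symmetric])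

lemma total_cong:
  assumes "open V" "(x, y, u, p, q) \<in> jets_over V" "\<And>w. w \<in> jets_over V \<Longrightarrow> F w = G w"
  shows "total_x F (x, y, u, p, q) r s = total_x G (x, y, u, p, q) r s"
    "total_y F (x, y, u, p, q) s t = total_y G (x, y, u, p, q) s t"
  using d_cong[OF assms] by simp_all

lemma bipoly_eq:
  "bipoly c a b g (x, y, u, p, q) =
     (\<Sum>\<beta>\<in>UNIV. \<Sum>\<gamma>\<in>UNIV. c \<beta> \<gamma> (x, y, u) * (p $ \<beta> * q $ \<gamma>))
     + (\<Sum>\<beta>\<in>UNIV. a \<beta> (x, y, u) * p $ \<beta>) + (\<Sum>\<gamma>\<in>UNIV. b \<gamma> (x, y, u) * q $ \<gamma>) + g (x, y, u)"
  by (simp add: bipoly_def jet_proj)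

lemma total_x_bipoly:
  assumes V: "open V" "(x, y, u) \<in> V" and b: "\<And>\<beta>. smooth_on V (b \<beta>)" and g: "smooth_on V g"
  shows "total_x (bipoly (\<lambda>_ _ _. 0) (\<lambda>_ _. 0) b g) (x, y, u, p, q) r s =
    bipoly (\<lambda>\<beta> \<gamma>. Du \<beta> (b \<gamma>)) (\<lambda>\<beta>. Du \<beta> g) (\<lambda>\<gamma>. Dx (b \<gamma>)) (Dx g) (x, y, u, p, q)
    + (\<Sum>\<beta>\<in>UNIV. b \<beta> (x, y, u) * s $ \<beta>)"
  by (simp add: d_bipoly[where V=V, OF g _ _ b] smooth_on_const V)
     (simp add: bipoly_eq sum_distrib_left sum_distrib_right sum.distrib algebra_simps)

lemma total_y_bipoly:
  assumes V: "open V" "(x, y, u) \<in> V" and a: "\<And>\<beta>. smooth_on V (a \<beta>)" and g: "smooth_on V g"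
  shows "total_y (bipoly (\<lambda>_ _ _. 0) a (\<lambda>_ _. 0) g) (x, y, u, p, q) s t =
    bipoly (\<lambda>\<beta> \<gamma>. Du \<gamma> (a \<beta>)) (\<lambda>\<beta>. Dy (a \<beta>)) (\<lambda>\<gamma>. Du \<gamma> g) (Dy g) (x, y, u, p, q)
    + (\<Sum>\<beta>\<in>UNIV. a \<beta> (x, y, u) * s $ \<beta>)"
proof -
  have "(\<Sum>\<gamma>\<in>UNIV. \<Sum>\<beta>\<in>UNIV. p $ \<beta> * (q $ \<gamma> * Du \<gamma> (a \<beta>) (x, y, u))) =
      (\<Sum>\<beta>\<in>UNIV. \<Sum>\<gamma>\<in>UNIV. p $ \<beta> * (q $ \<gamma> * Du \<gamma> (a \<beta>) (x, y, u)))"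
    by (rule sum.swap)
  then show ?thesis
    by (simp add: d_bipoly[where V=V, OF g _ a] smooth_on_const V)
       (simp add: bipoly_eq sum_distrib_left sum_distrib_right sum.distrib algebra_simps)
qed

lemma bipoly_diff:
  "bipoly c a b g z - bipoly c' a' b' g' z = bipoly (\<lambda>\<beta> \<gamma> w. c \<beta> \<gamma> w - c' \<beta> \<gamma> w)
     (\<lambda>\<beta> w. a \<beta> w - a' \<beta> w) (\<lambda>\<beta> w. b \<beta> w - b' \<beta> w) (\<lambda>w. g w - g' w) z"
  by (simp add: bipoly_def sum_subtractf algebra_simps)

lemma euler_lagrange_bipoly:
  assumes V: "open V" "(x, y, u) \<in> V"
    and h: "\<And>\<beta> \<gamma>. smooth_on V (h \<beta> \<gamma>)" and P: "\<And>\<beta>. smooth_on V (P \<beta>)"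
    and Q: "\<And>\<beta>. smooth_on V (Q \<beta>)" and R: "smooth_on V R"
    and L: "\<And>z. z \<in> jets_over V \<Longrightarrow> L z = bipoly h P Q R z"
  shows "euler_lagrange \<alpha> L (x, y, u, p, q) r s t =
    - (\<Sum>\<beta>\<in>UNIV. (h \<alpha> \<beta> (x, y, u) + h \<beta> \<alpha> (x, y, u)) * s $ \<beta>)
    + bipoly (EL_c h \<alpha>) (EL_a h P \<alpha>) (EL_b h Q \<alpha>) (EL_g P Q R \<alpha>) (x, y, u, p, q)"
proof -
  let ?z = "(x, y, u, p, q)"
  have z: "?z \<in> jets_over V" using V by simp
  note D = d_bipoly[OF R h P Q]
  have 1: "d_u \<alpha> L ?z = bipoly (\<lambda>\<beta> \<gamma>. Du \<alpha> (h \<beta> \<gamma>)) (\<lambda>\<beta>. Du \<alpha> (P \<beta>)) (\<lambda>\<beta>. Du \<alpha> (Q \<beta>)) (Du \<alpha> R) ?z"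
    using d_cong(3)[OF V(1) z L] D(3)[OF z] by simp
  have "d_ux \<alpha> L w = bipoly (\<lambda>_ _ _. 0) (\<lambda>_ _. 0) (h \<alpha>) (P \<alpha>) w" if "w \<in> jets_over V" for w
    using d_cong(4)[OF V(1) that L] D(4)[OF that] by simp
  then have "total_x (d_ux \<alpha> L) ?z r s = total_x (bipoly (\<lambda>_ _ _. 0) (\<lambda>_ _. 0) (h \<alpha>) (P \<alpha>)) ?z r s"
    by (intro total_cong(1)[OF V(1) z])
  then
  have 2: "total_x (d_ux \<alpha> L) ?z r s = bipoly (\<lambda>\<beta> \<gamma>. Du \<beta> (h \<alpha> \<gamma>)) (\<lambda>\<beta>. Du \<beta> (P \<alpha>))
      (\<lambda>\<gamma>. Dx (h \<alpha> \<gamma>)) (Dx (P \<alpha>)) ?z + (\<Sum>\<beta>\<in>UNIV. h \<alpha> \<beta> (x, y, u) * s $ \<beta>)"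
    unfolding total_x_bipoly[OF V h P] .
  have "d_uy \<alpha> L w = bipoly (\<lambda>_ _ _. 0) (\<lambda>\<beta>. h \<beta> \<alpha>) (\<lambda>_ _. 0) (Q \<alpha>) w" if "w \<in> jets_over V" for w
    using d_cong(5)[OF V(1) that L] D(5)[OF that] by simp
  then have "total_y (d_uy \<alpha> L) ?z s t = total_y (bipoly (\<lambda>_ _ _. 0) (\<lambda>\<beta>. h \<beta> \<alpha>) (\<lambda>_ _. 0) (Q \<alpha>)) ?z s t"
    by (intro total_cong(2)[OF V(1) z])
  then
  have 3: "total_y (d_uy \<alpha> L) ?z s t = bipoly (\<lambda>\<beta> \<gamma>. Du \<gamma> (h \<beta> \<alpha>)) (\<lambda>\<beta>. Dy (h \<beta> \<alpha>))
      (\<lambda>\<gamma>. Du \<gamma> (Q \<alpha>)) (Dy (Q \<alpha>)) ?z + (\<Sum>\<beta>\<in>UNIV. h \<beta> \<alpha> (x, y, u) * s $ \<beta>)"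
    unfolding total_y_bipoly[OF V h Q] .
  have "euler_lagrange \<alpha> L ?z r s t = - (\<Sum>\<beta>\<in>UNIV. (h \<alpha> \<beta> (x, y, u) + h \<beta> \<alpha> (x, y, u)) * s $ \<beta>)
    + (bipoly (\<lambda>\<beta> \<gamma>. Du \<alpha> (h \<beta> \<gamma>)) (\<lambda>\<beta>. Du \<alpha> (P \<beta>)) (\<lambda>\<beta>. Du \<alpha> (Q \<beta>)) (Du \<alpha> R) ?z
    - bipoly (\<lambda>\<beta> \<gamma>. Du \<beta> (h \<alpha> \<gamma>)) (\<lambda>\<beta>. Du \<beta> (P \<alpha>)) (\<lambda>\<gamma>. Dx (h \<alpha> \<gamma>)) (Dx (P \<alpha>)) ?z
    - bipoly (\<lambda>\<beta> \<gamma>. Du \<gamma> (h \<beta> \<alpha>)) (\<lambda>\<beta>. Dy (h \<beta> \<alpha>)) (\<lambda>\<gamma>. Du \<gamma> (Q \<alpha>)) (Dy (Q \<alpha>)) ?z)"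
    unfolding euler_lagrange_def 1 2 3 by (simp add: distrib_right sum.distrib)
  also have "\<dots> = - (\<Sum>\<beta>\<in>UNIV. (h \<alpha> \<beta> (x, y, u) + h \<beta> \<alpha> (x, y, u)) * s $ \<beta>)
    + bipoly (EL_c h \<alpha>) (EL_a h P \<alpha>) (EL_b h Q \<alpha>) (EL_g P Q R \<alpha>) ?z"
    unfolding bipoly_diff by (simp add: bipoly_def EL_c_def EL_a_def EL_b_def EL_g_def algebra_simps)
  finally show ?thesis .
qed

lemma sum_axis_mult [simp]:
  fixes F :: "'m::finite \<Rightarrow> real"
  shows "(\<Sum>\<beta>\<in>UNIV. F \<beta> * axis \<alpha> 1 $ \<beta>) = F \<alpha>" "(\<Sum>\<beta>\<in>UNIV. axis \<alpha> 1 $ \<beta> * F \<beta>) = F \<alpha>"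
  by (simp_all add: axis_def if_distrib if_distribR cong: if_cong)

lemma bipoly_at_axes:
  "bipoly c a b g (x, y, u, 0, 0) = g (x, y, u)"
  "bipoly c a b g (x, y, u, axis \<beta> 1, 0) = a \<beta> (x, y, u) + g (x, y, u)"
  "bipoly c a b g (x, y, u, 0, axis \<gamma> 1) = b \<gamma> (x, y, u) + g (x, y, u)"
  "bipoly c a b g (x, y, u, axis \<beta> 1, axis \<gamma> 1) =
     c \<beta> \<gamma> (x, y, u) + a \<beta> (x, y, u) + b \<gamma> (x, y, u) + g (x, y, u)"
proof -
  show "bipoly c a b g (x, y, u, axis \<beta> 1, axis \<gamma> 1) =
     c \<beta> \<gamma> (x, y, u) + a \<beta> (x, y, u) + b \<gamma> (x, y, u) + g (x, y, u)"
    by (simp add: bipoly_eq mult.assoc[symmetric])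
qed (simp_all add: bipoly_eq)

lemma bipoly_coeffs_unique:
  assumes "\<And>p q. bipoly c a b g (x, y, u, p, q) = bipoly c' a' b' g' (x, y, u, p, q)"
  shows "c \<beta> \<gamma> (x, y, u) = c' \<beta> \<gamma> (x, y, u)" "a \<beta> (x, y, u) = a' \<beta> (x, y, u)"
    "b \<beta> (x, y, u) = b' \<beta> (x, y, u)" "g (x, y, u) = g' (x, y, u)"
  using assms[of 0 0] assms[of "axis \<beta> 1" 0] assms[of 0 "axis \<beta> 1"] assms[of 0 "axis \<gamma> 1"]
    assms[of "axis \<beta> 1" "axis \<gamma> 1"]
  by (simp_all add: bipoly_at_axes)

lemma bipoly_cong:
  assumes "\<And>\<beta> \<gamma>. c \<beta> \<gamma> (base_pt z) = c' \<beta> \<gamma> (base_pt z)" "\<And>\<beta>. a \<beta> (base_pt z) = a' \<beta> (base_pt z)"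
    "\<And>\<beta>. b \<beta> (base_pt z) = b' \<beta> (base_pt z)" "g (base_pt z) = g' (base_pt z)"
  shows "bipoly c a b g z = bipoly c' a' b' g' z"
  using assms by (simp add: bipoly_def)

lemma constant_if_partials_zero:
  fixes g :: "real^'m \<Rightarrow> real"
  assumes "\<And>p. g differentiable (at p)" "\<And>\<beta> p. dd (axis \<beta> 1) g p = 0"
  shows "g p = g q"
proof -
  have "dd v g p = 0" for v p
  proof -
    show ?thesis
      using dd_lincomb[OF assms(1), of "\<lambda>\<beta>. v $ \<beta>" "\<lambda>\<beta>. axis \<beta> 1" UNIV p]
      by (simp add: axis_expansion assms(2))
  qed
  then have "(g has_derivative (\<lambda>v. 0)) (at p within UNIV)" for p
    using has_derivative_dd[OF assms(1)[of p]] by simp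
  from has_derivative_zero_constant[OF convex_UNIV this] show ?thesis by auto
qed

text \<open>The first derivatives are constant, so \<open>f\<close> minus its linear part has derivative zero.  The
  coefficients are written as differences of values, so that they inherit
  smoothness in parameters from \<open>f\<close>.\<close>

lemma affine_if_second_partials_zero:
  fixes f :: "real^'m \<Rightarrow> real"
  assumes f: "smooth_on UNIV f" and zero: "\<And>\<alpha> \<beta> p. dd (axis \<beta> 1) (dd (axis \<alpha> 1) f) p = 0"
  shows "f p = f 0 + (\<Sum>\<alpha>\<in>UNIV. (f (axis \<alpha> 1) - f 0) * p $ \<alpha>)"
proof -
  define k where "k \<alpha> = dd (axis \<alpha> 1) f 0" for \<alpha>
  have diff: "F differentiable (at p)" if "smooth_on UNIV F" for F :: "real^'m \<Rightarrow> real" and p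
    using smooth_on_imp_differentiable[OF that] by simp
  have k: "dd (axis \<alpha> 1) f p = k \<alpha>" for \<alpha> p
    unfolding k_def
    by (rule constant_if_partials_zero[OF diff[OF smooth_on_dd[OF f]] zero])
  let ?g = "\<lambda>p. f p - (\<Sum>\<alpha>\<in>UNIV. k \<alpha> * p $ \<alpha>)"
  have D: "(?g has_derivative (\<lambda>v. dd v f p - (\<Sum>\<alpha>\<in>UNIV. k \<alpha> * v $ \<alpha>))) (at p)" for p
    by (intro has_derivative_diff has_derivative_dd diff f has_derivative_sum has_derivative_mult_right
        bounded_linear_imp_has_derivative bounded_linear_vec_nth)
  have g: "?g p = ?g 0" for p
  proof (rule constant_if_partials_zero)
    show "?g differentiable (at p)" for p using D unfolding differentiable_def by blast
    show "dd (axis \<beta> 1) ?g p = 0" for \<beta> p by (simp add: dd_eq[OF D] k)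
  qed
  have f': "f p = f 0 + (\<Sum>\<alpha>\<in>UNIV. k \<alpha> * p $ \<alpha>)" for p
    using g[of p] by simp
  have "f (axis \<alpha> 1) - f 0 = k \<alpha>" for \<alpha>
    using f'[of "axis \<alpha> 1"] by simp
  with f'[of p] show ?thesis by simp
qed

text \<open>The section of the jet bundle over the base with constant \<open>p\<close> and \<open>q\<close>.\<close>

definition embed_jet :: "real^'m \<Rightarrow> real^'m \<Rightarrow> ('m::finite) base \<Rightarrow> 'm jet" where
  "embed_jet p q b = (fst b, fst (snd b), snd (snd b), p, q)"

lemma embed_jet_eq [simp]: "embed_jet p q (x, y, u) = (x, y, u, p, q)"
  by (simp add: embed_jet_def)

lemma smooth_on_embed_jet:
  assumes "open V" "smooth_on (jets_over V) L"
  shows "smooth_on V (\<lambda>b. L (embed_jet p q b))"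
proof (rule smooth_on_compose_affine[OF assms(1) _ _ assms(2)])
  show "(embed_jet p q has_derivative (\<lambda>v. embed_jet 0 0 v)) (at z)" for z
    unfolding embed_jet_def[abs_def] by (auto intro!: derivative_eq_intros simp: zero_prod_def)
  show "embed_jet p q b \<in> jets_over V" if "b \<in> V" for b
    using that by (cases b) simp
qed

lemma smooth_on_fibre_x:
  assumes "smooth_on (jets_over V) L" "(x, y, u) \<in> V"
  shows "smooth_on UNIV (\<lambda>p. L (x, y, u, p, q))"
    and "dd (axis \<alpha> 1) (\<lambda>p. L (x, y, u, p, q)) p = d_ux \<alpha> L (x, y, u, p, q)"
proof -
  have D: "((\<lambda>p. (x, y, u, p, q)) has_derivative (\<lambda>v. (0, 0, 0, v, 0))) (at p)" for p
    by (auto intro!: derivative_eq_intros simp: zero_prod_def)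
  show "smooth_on UNIV (\<lambda>p. L (x, y, u, p, q))"
    by (rule smooth_on_compose_affine[OF _ D _ assms(1)]) (use assms in auto)
  have "L differentiable (at (x, y, u, p, q))"
    using smooth_on_imp_differentiable[OF assms(1)] assms(2) by simp
  from has_derivative_compose[OF D has_derivative_dd[OF this]]
  show "dd (axis \<alpha> 1) (\<lambda>p. L (x, y, u, p, q)) p = d_ux \<alpha> L (x, y, u, p, q)"
    by (simp add: dd_eq d_ux_def dd_def[symmetric])
qed

lemma smooth_on_fibre_y:
  assumes "smooth_on (jets_over V) L" "(x, y, u) \<in> V"
  shows "smooth_on UNIV (\<lambda>q. L (x, y, u, p, q))"
    and "dd (axis \<alpha> 1) (\<lambda>q. L (x, y, u, p, q)) q = d_uy \<alpha> L (x, y, u, p, q)"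
proof -
  have D: "((\<lambda>q. (x, y, u, p, q)) has_derivative (\<lambda>v. (0, 0, 0, 0, v))) (at q)" for q
    by (auto intro!: derivative_eq_intros simp: zero_prod_def)
  show "smooth_on UNIV (\<lambda>q. L (x, y, u, p, q))"
    by (rule smooth_on_compose_affine[OF _ D _ assms(1)]) (use assms in auto)
  have "L differentiable (at (x, y, u, p, q))"
    using smooth_on_imp_differentiable[OF assms(1)] assms(2) by simp
  from has_derivative_compose[OF D has_derivative_dd[OF this]]
  show "dd (axis \<alpha> 1) (\<lambda>q. L (x, y, u, p, q)) q = d_uy \<alpha> L (x, y, u, p, q)"
    by (simp add: dd_eq d_uy_def dd_def[symmetric])
qed

lemma smooth_on_d_jet:
  assumes "smooth_on S L" shows "smooth_on S (d_ux \<alpha> L)" "smooth_on S (d_uy \<alpha> L)"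
  using smooth_on_dd[OF assms] by (simp_all add: d_ux_def[abs_def] d_uy_def[abs_def] dd_def[abs_def])

text \<open>Affine in \<open>p\<close> with \<open>q\<close> fixed and affine in \<open>q\<close> with \<open>p\<close> fixed: the coefficients are second
  differences of the values of \<open>L\<close> at \<open>p, q\<close> zero or an axis vector.\<close>

lemma biaffine_lagrangian:
  assumes V: "open V" and L: "smooth_on (jets_over V) L"
    and xx: "\<And>z \<alpha> \<beta>. z \<in> jets_over V \<Longrightarrow> d_ux \<beta> (d_ux \<alpha> L) z = 0"
    and yy: "\<And>z \<alpha> \<beta>. z \<in> jets_over V \<Longrightarrow> d_uy \<beta> (d_uy \<alpha> L) z = 0"
  obtains h P Q R where "\<And>\<beta> \<gamma>. smooth_on V (h \<beta> \<gamma>)" "\<And>\<beta>. smooth_on V (P \<beta>)"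
    "\<And>\<beta>. smooth_on V (Q \<beta>)" "smooth_on V R"
    "\<And>z. z \<in> jets_over V \<Longrightarrow> L z = bipoly h P Q R z"
proof -
  let ?l = "\<lambda>p q b. L (embed_jet p q b)"
  define R where "R = ?l 0 0"
  define P where "P \<alpha> = (\<lambda>b. ?l (axis \<alpha> 1) 0 b - R b)" for \<alpha>
  define Q where "Q \<beta> = (\<lambda>b. ?l 0 (axis \<beta> 1) b - R b)" for \<beta>
  define h where "h \<alpha> \<beta> = (\<lambda>b. ?l (axis \<alpha> 1) (axis \<beta> 1) b - ?l (axis \<alpha> 1) 0 b - Q \<beta> b)" for \<alpha> \<beta>
  have sm: "smooth_on V R" "smooth_on V (P \<alpha>)" "smooth_on V (Q \<alpha>)" "smooth_on V (h \<alpha> \<beta>)" for \<alpha> \<beta>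
    unfolding R_def P_def Q_def h_def by (intro smooth_on_diff V smooth_on_embed_jet L)+
  have "L z = bipoly h P Q R z" if "z \<in> jets_over V" for z
  proof -
    obtain x y u p q where z: "z = (x, y, u, p, q)" by (metis prod_cases5)
    have b: "(x, y, u) \<in> V" using that z by simp
    have p: "L (x, y, u, p, q) = L (x, y, u, 0, q)
        + (\<Sum>\<alpha>\<in>UNIV. (L (x, y, u, axis \<alpha> 1, q) - L (x, y, u, 0, q)) * p $ \<alpha>)" for p q
    proof (rule affine_if_second_partials_zero[OF smooth_on_fibre_x(1)[OF L b]])
      fix \<alpha> \<beta> p
      have "dd (axis \<alpha> 1) (\<lambda>p. L (x, y, u, p, q)) = (\<lambda>p. d_ux \<alpha> L (x, y, u, p, q))"
        by (rule ext) (rule smooth_on_fibre_x(2)[OF L b])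
      then show "dd (axis \<beta> 1) (dd (axis \<alpha> 1) (\<lambda>p. L (x, y, u, p, q))) p = 0"
        using smooth_on_fibre_x(2)[OF smooth_on_d_jet(1)[OF L] b] xx b by simp
    qed
    have q: "L (x, y, u, p, q) = L (x, y, u, p, 0)
        + (\<Sum>\<beta>\<in>UNIV. (L (x, y, u, p, axis \<beta> 1) - L (x, y, u, p, 0)) * q $ \<beta>)" for p q
    proof (rule affine_if_second_partials_zero[OF smooth_on_fibre_y(1)[OF L b]])
      fix \<alpha> \<beta> q
      have "dd (axis \<alpha> 1) (\<lambda>q. L (x, y, u, p, q)) = (\<lambda>q. d_uy \<alpha> L (x, y, u, p, q))"
        by (rule ext) (rule smooth_on_fibre_y(2)[OF L b])
      then show "dd (axis \<beta> 1) (dd (axis \<alpha> 1) (\<lambda>q. L (x, y, u, p, q))) q = 0"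
        using smooth_on_fibre_y(2)[OF smooth_on_d_jet(2)[OF L] b] yy b by simp
    qed
    let ?b = "(x, y, u)"
    have q0: "L (x, y, u, 0, q) = R ?b + (\<Sum>\<beta>\<in>UNIV. Q \<beta> ?b * q $ \<beta>)"
      using q[of 0 q] by (simp add: R_def Q_def)
    have q1: "L (x, y, u, axis \<alpha> 1, q) - L (x, y, u, 0, q) =
        P \<alpha> ?b + (\<Sum>\<beta>\<in>UNIV. h \<alpha> \<beta> ?b * q $ \<beta>)" for \<alpha>
      unfolding q0 using q[of "axis \<alpha> 1" q]
      by (simp add: P_def R_def h_def left_diff_distrib sum_subtractf)
    show ?thesis
      unfolding z p[of p q] q1 unfolding q0
      by (simp add: bipoly_eq sum.distrib sum_distrib_left sum_distrib_right algebra_simps)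
  qed
  with sm that show thesis by blast
qed

section \<open>Reduction to equations for the coefficients\<close>

definition lower :: "('m \<Rightarrow> 'm \<Rightarrow> 'm base \<Rightarrow> real) \<Rightarrow> ('m \<Rightarrow> ('m::finite) base \<Rightarrow> real) \<Rightarrow> 'm \<Rightarrow> 'm base \<Rightarrow> real" where
  "lower M X \<alpha> b = (\<Sum>\<sigma>\<in>UNIV. M \<alpha> \<sigma> b * X \<sigma> b)"

text \<open>Coefficient by coefficient, \<open>h p q + P p + Q q + R\<close> is a Lagrangian for
  \<open>M u\<^sub>x\<^sub>y + c p q + a p + b q + g\<close> over \<open>V\<close>.\<close>

definition lagrangian_coeffs where
  "lagrangian_coeffs V M c a b g h P Q R \<longleftrightarrow>
    (\<forall>\<beta> \<gamma>. smooth_on V (h \<beta> \<gamma>)) \<and> (\<forall>\<beta>. smooth_on V (P \<beta>)) \<and> (\<forall>\<beta>. smooth_on V (Q \<beta>)) \<and> smooth_on V R \<and>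
    (\<forall>w\<in>V. \<forall>\<alpha> \<beta>. M \<alpha> \<beta> w = - (h \<alpha> \<beta> w + h \<beta> \<alpha> w)) \<and>
    (\<forall>w\<in>V. \<forall>\<alpha> \<beta> \<gamma>. c \<alpha> \<beta> \<gamma> w = EL_c h \<alpha> \<beta> \<gamma> w) \<and>
    (\<forall>w\<in>V. \<forall>\<alpha> \<beta>. a \<alpha> \<beta> w = EL_a h P \<alpha> \<beta> w) \<and>
    (\<forall>w\<in>V. \<forall>\<alpha> \<beta>. b \<alpha> \<beta> w = EL_b h Q \<alpha> \<beta> w) \<and>
    (\<forall>w\<in>V. \<forall>\<alpha>. g \<alpha> w = EL_g P Q R \<alpha> w)"

lemma sys_rhs_bipoly:
  "sys_rhs C A B G \<alpha> z = bipoly (\<lambda>\<beta> \<gamma> w. - C \<alpha> \<beta> \<gamma> w) (\<lambda>\<gamma> w. - A \<alpha> \<gamma> w) (\<lambda>\<gamma> w. - B \<alpha> \<gamma> w) (\<lambda>w. - G \<alpha> w) z"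
  by (cases z) (simp add: bipoly_eq sum_negf mult_ac)

lemma sum_multiplier_bipoly:
  "(\<Sum>\<sigma>\<in>UNIV. M \<alpha> \<sigma> (base_pt z) * bipoly (c \<sigma>) (a \<sigma>) (b \<sigma>) (g \<sigma>) z) =
    bipoly (\<lambda>\<beta> \<gamma>. lower M (\<lambda>\<sigma>. c \<sigma> \<beta> \<gamma>) \<alpha>) (\<lambda>\<beta>. lower M (\<lambda>\<sigma>. a \<sigma> \<beta>) \<alpha>) (\<lambda>\<beta>. lower M (\<lambda>\<sigma>. b \<sigma> \<beta>) \<alpha>)
      (lower M g \<alpha>) z"
proof -
  have 0: "(\<Sum>\<sigma>\<in>UNIV. M \<alpha> \<sigma> w * (\<Sum>\<beta>\<in>UNIV. X \<sigma> \<beta>)) = (\<Sum>\<beta>\<in>UNIV. \<Sum>\<sigma>\<in>UNIV. M \<alpha> \<sigma> w * X \<sigma> \<beta>)"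
    for w and X :: "'a \<Rightarrow> 'a \<Rightarrow> real"
    unfolding sum_distrib_left by (rule sum.swap)
  have 1: "(\<Sum>\<sigma>\<in>UNIV. M \<alpha> \<sigma> w * (\<Sum>\<beta>\<in>UNIV. k \<sigma> \<beta> * p \<beta>)) =
      (\<Sum>\<beta>\<in>UNIV. (\<Sum>\<sigma>\<in>UNIV. M \<alpha> \<sigma> w * k \<sigma> \<beta>) * p \<beta>)"
    for w k and p :: "'a \<Rightarrow> real"
    unfolding sum_distrib_left sum_distrib_right by (subst sum.swap) (simp add: mult_ac)
  have 2: "(\<Sum>\<sigma>\<in>UNIV. M \<alpha> \<sigma> w * (\<Sum>\<beta>\<in>UNIV. \<Sum>\<gamma>\<in>UNIV. k \<sigma> \<beta> \<gamma> * p \<beta> \<gamma>)) =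
      (\<Sum>\<beta>\<in>UNIV. \<Sum>\<gamma>\<in>UNIV. (\<Sum>\<sigma>\<in>UNIV. M \<alpha> \<sigma> w * k \<sigma> \<beta> \<gamma>) * p \<beta> \<gamma>)"
    for w k and p :: "'a \<Rightarrow> 'a \<Rightarrow> real"
    by (simp only: 0 sum_distrib_right mult.assoc)
  show ?thesis
    by (simp add: bipoly_def distrib_left sum.distrib 1 2 lower_def)
qed

lemma bipoly_minus:
  "bipoly (\<lambda>\<beta> \<gamma> w. - c \<beta> \<gamma> w) (\<lambda>\<beta> w. - a \<beta> w) (\<lambda>\<beta> w. - b \<beta> w) (\<lambda>w. - g w) z = - bipoly c a b g z"
  by (simp add: bipoly_def sum_negf)

abbreviation (input) "lower2 M X \<alpha> \<beta> \<equiv> lower M (\<lambda>\<sigma>. X \<sigma> \<beta>) \<alpha>"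
abbreviation (input) "lower3 M X \<alpha> \<beta> \<gamma> \<equiv> lower M (\<lambda>\<sigma>. X \<sigma> \<beta> \<gamma>) \<alpha>"

lemma multiplier_times_sys_rhs:
  "(\<Sum>\<sigma>\<in>UNIV. M \<alpha> \<sigma> (base_pt z) * sys_rhs C A B G \<sigma> z) =
    - bipoly (lower3 M C \<alpha>) (lower2 M A \<alpha>) (lower2 M B \<alpha>) (lower M G \<alpha>) z"
  by (simp add: sys_rhs_bipoly bipoly_minus sum_negf sum_multiplier_bipoly)

text \<open>The Euler-Lagrange expression is affine in \<open>u\<^sub>x\<^sub>x\<close> and \<open>u\<^sub>y\<^sub>y\<close> with coefficients
  \<open>- L\<^sub>p\<^sub>p\<close> and \<open>- L\<^sub>q\<^sub>q\<close>.  The right-hand side is free of both, so \<open>L\<close> is bi-affine, and then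
  coefficients of \<open>u\<^sub>x\<^sub>y\<close> and of the monomials in \<open>p, q\<close> can be compared.\<close>

lemma lagrangian_iff_coeffs:
  assumes V: "open V"
  shows "(\<exists>L. smooth_on (jets_over V) L \<and>
        (\<forall>x y u p q r s t \<alpha>. (x, y, u) \<in> V \<longrightarrow>
           euler_lagrange \<alpha> L (x, y, u, p, q) r s t =
             (\<Sum>\<beta>\<in>UNIV. M \<alpha> \<beta> (x, y, u) * (s $ \<beta> - sys_rhs C A B G \<beta> (x, y, u, p, q)))))
    \<longleftrightarrow> (\<exists>h P Q R. lagrangian_coeffs V M (lower3 M C) (lower2 M A) (lower2 M B) (lower M G) h P Q R)"
    (is "(\<exists>L. ?lag L) \<longleftrightarrow> _")
proof -
  have rhs: "(\<Sum>\<beta>\<in>UNIV. M \<alpha> \<beta> (x, y, u) * (s $ \<beta> - sys_rhs C A B G \<beta> (x, y, u, p, q))) =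
      (\<Sum>\<beta>\<in>UNIV. M \<alpha> \<beta> (x, y, u) * s $ \<beta>)
      + bipoly (lower3 M C \<alpha>) (lower2 M A \<alpha>) (lower2 M B \<alpha>) (lower M G \<alpha>) (x, y, u, p, q)"
    for x y u p q s \<alpha>
    using multiplier_times_sys_rhs[of M \<alpha> "(x, y, u, p, q)" C A B G]
    by (simp add: right_diff_distrib sum_subtractf base_pt_def)
  show ?thesis
  proof
    assume "\<exists>L. ?lag L"
    then obtain L where L: "smooth_on (jets_over V) L" and EL:
      "\<And>x y u p q r s t \<alpha>. (x, y, u) \<in> V \<Longrightarrow> euler_lagrange \<alpha> L (x, y, u, p, q) r s t =
        (\<Sum>\<beta>\<in>UNIV. M \<alpha> \<beta> (x, y, u) * s $ \<beta>)
        + bipoly (lower3 M C \<alpha>) (lower2 M A \<alpha>) (lower2 M B \<alpha>) (lower M G \<alpha>) (x, y, u, p, q)"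
      unfolding rhs by blast
    have xx: "d_ux \<beta> (d_ux \<alpha> L) z = 0" if "z \<in> jets_over V" for z \<alpha> \<beta>
    proof -
      obtain x y u p q where z: "z = (x, y, u, p, q)" by (metis prod_cases5)
      have "euler_lagrange \<alpha> L (x, y, u, p, q) (axis \<beta> 1) 0 0 = euler_lagrange \<alpha> L (x, y, u, p, q) 0 0 0"
        using that z by (simp add: EL)
      then show ?thesis by (simp add: euler_lagrange_def z)
    qed
    have yy: "d_uy \<beta> (d_uy \<alpha> L) z = 0" if "z \<in> jets_over V" for z \<alpha> \<beta>
    proof -
      obtain x y u p q where z: "z = (x, y, u, p, q)" by (metis prod_cases5)
      have "euler_lagrange \<alpha> L (x, y, u, p, q) 0 0 (axis \<beta> 1) = euler_lagrange \<alpha> L (x, y, u, p, q) 0 0 0"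
        using that z by (simp add: EL)
      then show ?thesis by (simp add: euler_lagrange_def z)
    qed
    obtain h P Q R where sm: "\<And>\<beta> \<gamma>. smooth_on V (h \<beta> \<gamma>)" "\<And>\<beta>. smooth_on V (P \<beta>)"
      "\<And>\<beta>. smooth_on V (Q \<beta>)" "smooth_on V R"
      and Leq: "\<And>z. z \<in> jets_over V \<Longrightarrow> L z = bipoly h P Q R z"
      using biaffine_lagrangian[OF V L xx yy] by blast
    have eq: "(\<Sum>\<beta>\<in>UNIV. M \<alpha> \<beta> (x, y, u) * s $ \<beta>)
        + bipoly (lower3 M C \<alpha>) (lower2 M A \<alpha>) (lower2 M B \<alpha>) (lower M G \<alpha>) (x, y, u, p, q) =
        - (\<Sum>\<beta>\<in>UNIV. (h \<alpha> \<beta> (x, y, u) + h \<beta> \<alpha> (x, y, u)) * s $ \<beta>)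
        + bipoly (EL_c h \<alpha>) (EL_a h P \<alpha>) (EL_b h Q \<alpha>) (EL_g P Q R \<alpha>) (x, y, u, p, q)"
      if "(x, y, u) \<in> V" for x y u p q s \<alpha>
      using EL[OF that, of \<alpha> p q 0 s 0] euler_lagrange_bipoly[OF V that sm Leq, of \<alpha> p q 0 s 0] by simp
    have "lagrangian_coeffs V M (lower3 M C) (lower2 M A) (lower2 M B) (lower M G) h P Q R"
      unfolding lagrangian_coeffs_def
    proof (intro conjI allI ballI sm)
      fix w \<alpha> \<beta> \<gamma> assume w: "w \<in> V"
      obtain x y u where [simp]: "w = (x, y, u)" by (metis prod_cases3)
      note e = eq[of x y u, OF w[simplified]]
      have b: "bipoly (lower3 M C \<alpha>) (lower2 M A \<alpha>) (lower2 M B \<alpha>) (lower M G \<alpha>) (x, y, u, p, q) =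
          bipoly (EL_c h \<alpha>) (EL_a h P \<alpha>) (EL_b h Q \<alpha>) (EL_g P Q R \<alpha>) (x, y, u, p, q)" for p q
        using e[of \<alpha> 0 p q] by simp
      show "M \<alpha> \<beta> w = - (h \<alpha> \<beta> w + h \<beta> \<alpha> w)"
        using e[of \<alpha> "axis \<beta> 1" 0 0] b[of 0 0] by simp
      show "lower3 M C \<alpha> \<beta> \<gamma> w = EL_c h \<alpha> \<beta> \<gamma> w" "lower2 M A \<alpha> \<beta> w = EL_a h P \<alpha> \<beta> w"
        "lower2 M B \<alpha> \<beta> w = EL_b h Q \<alpha> \<beta> w" "lower M G \<alpha> w = EL_g P Q R \<alpha> w"
        using bipoly_coeffs_unique[OF b] by simp_all
    qed
    then show "\<exists>h P Q R. lagrangian_coeffs V M (lower3 M C) (lower2 M A) (lower2 M B) (lower M G) h P Q R"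
      by blast
  next
    assume "\<exists>h P Q R. lagrangian_coeffs V M (lower3 M C) (lower2 M A) (lower2 M B) (lower M G) h P Q R"
    then obtain h P Q R where lc: "lagrangian_coeffs V M (lower3 M C) (lower2 M A) (lower2 M B) (lower M G) h P Q R"
      by blast
    then have sm: "\<And>\<beta> \<gamma>. smooth_on V (h \<beta> \<gamma>)" "\<And>\<beta>. smooth_on V (P \<beta>)"
      "\<And>\<beta>. smooth_on V (Q \<beta>)" "smooth_on V R"
      by (simp_all add: lagrangian_coeffs_def)
    have "?lag (bipoly h P Q R)"
    proof (intro conjI allI impI)
      show "smooth_on (jets_over V) (bipoly h P Q R)" by (rule smooth_on_bipoly[OF V sm])
      fix x y u p q r s t \<alpha> assume w: "(x, y, u) \<in> V"
      have "bipoly (EL_c h \<alpha>) (EL_a h P \<alpha>) (EL_b h Q \<alpha>) (EL_g P Q R \<alpha>) (x, y, u, p, q) =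
          bipoly (lower3 M C \<alpha>) (lower2 M A \<alpha>) (lower2 M B \<alpha>) (lower M G \<alpha>) (x, y, u, p, q)"
        by (rule bipoly_cong) (use lc w in \<open>simp_all add: lagrangian_coeffs_def base_pt_def\<close>)
      moreover have "- (\<Sum>\<beta>\<in>UNIV. (h \<alpha> \<beta> (x, y, u) + h \<beta> \<alpha> (x, y, u)) * s $ \<beta>) =
          (\<Sum>\<beta>\<in>UNIV. M \<alpha> \<beta> (x, y, u) * s $ \<beta>)"
      proof -
        have "M \<alpha> \<beta> (x, y, u) = - (h \<alpha> \<beta> (x, y, u) + h \<beta> \<alpha> (x, y, u))" for \<beta>
          using lc w by (simp add: lagrangian_coeffs_def)
        then show ?thesis by (simp only: sum_negf[symmetric] mult_minus_left)
      qed
      ultimately show "euler_lagrange \<alpha> (bipoly h P Q R) (x, y, u, p, q) r s t =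
          (\<Sum>\<beta>\<in>UNIV. M \<alpha> \<beta> (x, y, u) * (s $ \<beta> - sys_rhs C A B G \<beta> (x, y, u, p, q)))"
        unfolding rhs euler_lagrange_bipoly[OF V w sm refl] by simp
    qed
    then show "\<exists>L. ?lag L" by blast
  qed
qed

section \<open>Helmholtz conditions\<close>

text \<open>The coefficients, as a bi-affine function of \<open>p, q\<close>, of the zero-order Helmholtz expression
  \<open>\<partial>F\<^sub>\<alpha>/\<partial>u\<^sup>\<beta> - \<partial>F\<^sub>\<beta>/\<partial>u\<^sup>\<alpha> - D\<^sub>x (\<partial>F\<^sub>\<alpha>/\<partial>p\<^sup>\<beta>) + D\<^sub>y (\<partial>F\<^sub>\<beta>/\<partial>q\<^sup>\<alpha>)\<close>
  of \<open>F = c p q + a p + b q + g\<close>, with \<open>u\<^sub>x\<^sub>y\<close> set to zero.\<close>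

definition helm_c where
  "helm_c c \<alpha> \<beta> \<gamma> \<delta> w = Du \<beta> (c \<alpha> \<gamma> \<delta>) w - Du \<alpha> (c \<beta> \<gamma> \<delta>) w - Du \<gamma> (c \<alpha> \<beta> \<delta>) w + Du \<delta> (c \<beta> \<gamma> \<alpha>) w"
definition helm_a where
  "helm_a c a \<alpha> \<beta> \<gamma> w = Du \<beta> (a \<alpha> \<gamma>) w - Du \<alpha> (a \<beta> \<gamma>) w - Du \<gamma> (a \<alpha> \<beta>) w + Dy (c \<beta> \<gamma> \<alpha>) w"
definition helm_b where
  "helm_b c b \<alpha> \<beta> \<delta> w = Du \<beta> (b \<alpha> \<delta>) w - Du \<alpha> (b \<beta> \<delta>) w - Dx (c \<alpha> \<beta> \<delta>) w + Du \<delta> (b \<beta> \<alpha>) w"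
definition helm_g where
  "helm_g a b g \<alpha> \<beta> w = Du \<beta> (g \<alpha>) w - Du \<alpha> (g \<beta>) w - Dx (a \<alpha> \<beta>) w + Dy (b \<beta> \<alpha>) w"

lemmas helm_defs = helm_c_def helm_a_def helm_b_def helm_g_def
lemmas EL_defs = EL_c_def[abs_def] EL_a_def[abs_def] EL_b_def[abs_def] EL_g_def[abs_def]

lemma smooth_on_EL:
  assumes V: "open V" and sm: "\<And>\<beta> \<gamma>. smooth_on V (h \<beta> \<gamma>)" "\<And>\<beta>. smooth_on V (P \<beta>)"
    "\<And>\<beta>. smooth_on V (Q \<beta>)" "smooth_on V R"
  shows "smooth_on V (EL_c h \<alpha> \<beta> \<gamma>)" "smooth_on V (EL_a h P \<alpha> \<beta>)" "smooth_on V (EL_b h Q \<alpha> \<beta>)"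
    "smooth_on V (EL_g P Q R \<alpha>)"
  unfolding EL_defs by (intro smooth_on_diff V smooth_on_dd sm)+

text \<open>Inserting the Euler-Lagrange coefficients leaves second derivatives of \<open>h, P, Q, R\<close> only, and they
  cancel in pairs since mixed derivatives commute.\<close>

lemma helm_EL:
  assumes V: "open V" and sm: "\<And>\<beta> \<gamma>. smooth_on V (h \<beta> \<gamma>)" "\<And>\<beta>. smooth_on V (P \<beta>)"
    "\<And>\<beta>. smooth_on V (Q \<beta>)" "smooth_on V R" and w: "w \<in> V"
  shows "helm_c (EL_c h) \<alpha> \<beta> \<gamma> \<delta> w = 0" "helm_a (EL_c h) (EL_a h P) \<alpha> \<beta> \<gamma> w = 0"
    "helm_b (EL_c h) (EL_b h Q) \<alpha> \<beta> \<gamma> w = 0" "helm_g (EL_a h P) (EL_b h Q) (EL_g P Q R) \<alpha> \<beta> w = 0"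
proof -
  have diff: "dd v (dd v' F) differentiable (at w)" "dd v F differentiable (at w)" if "smooth_on V F" for v v' F
    using smooth_on_imp_differentiable[OF _ w] smooth_on_dd that by blast+
  have D3: "dd v (\<lambda>z. dd v1 F1 z - dd v2 F2 z - dd v3 F3 z) w =
      dd v (dd v1 F1) w - dd v (dd v2 F2) w - dd v (dd v3 F3) w"
    if "smooth_on V F1" "smooth_on V F2" "smooth_on V F3" for v v1 v2 v3 F1 F2 F3
    using that by (simp add: dd_diff diff differentiable_diff)
  note comm = dd_commute[OF V w]
  show "helm_c (EL_c h) \<alpha> \<beta> \<gamma> \<delta> w = 0"
    unfolding helm_defs EL_defs D3[OF sm(1) sm(1) sm(1)]
    using comm[OF sm(1)] by (simp add: algebra_simps)
  show "helm_a (EL_c h) (EL_a h P) \<alpha> \<beta> \<gamma> w = 0"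
    unfolding helm_defs EL_defs D3[OF sm(1) sm(1) sm(1)] D3[OF sm(2) sm(2) sm(1)]
    using comm[OF sm(1)] comm[OF sm(2)] by (simp add: algebra_simps)
  show "helm_b (EL_c h) (EL_b h Q) \<alpha> \<beta> \<gamma> w = 0"
    unfolding helm_defs EL_defs D3[OF sm(1) sm(1) sm(1)] D3[OF sm(3) sm(3) sm(1)]
    using comm[OF sm(1)] comm[OF sm(3)] by (simp add: algebra_simps)
  show "helm_g (EL_a h P) (EL_b h Q) (EL_g P Q R) \<alpha> \<beta> w = 0"
    unfolding helm_defs EL_defs D3[OF sm(2) sm(2) sm(1)] D3[OF sm(3) sm(3) sm(1)] D3[OF sm(4) sm(2) sm(3)]
    using comm[OF sm(1)] comm[OF sm(2)] comm[OF sm(3)] comm[OF sm(4)] by (simp add: algebra_simps)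
qed

definition helmholtz where
  "helmholtz V M c a b g \<longleftrightarrow> (\<forall>w\<in>V.
     (\<forall>\<alpha> \<beta> \<gamma>. Du \<gamma> (M \<alpha> \<beta>) w = c \<alpha> \<beta> \<gamma> w + c \<beta> \<alpha> \<gamma> w) \<and>
     (\<forall>\<alpha> \<beta>. Dy (M \<alpha> \<beta>) w = a \<alpha> \<beta> w + a \<beta> \<alpha> w) \<and>
     (\<forall>\<alpha> \<beta>. Dx (M \<alpha> \<beta>) w = b \<alpha> \<beta> w + b \<beta> \<alpha> w) \<and>
     (\<forall>\<alpha> \<beta> \<gamma>. c \<alpha> \<beta> \<gamma> w - c \<alpha> \<gamma> \<beta> w = - (c \<beta> \<alpha> \<gamma> w - c \<beta> \<gamma> \<alpha> w)) \<and>
     (\<forall>\<alpha> \<beta> \<gamma> \<delta>. helm_c c \<alpha> \<beta> \<gamma> \<delta> w = 0) \<and> (\<forall>\<alpha> \<beta> \<gamma>. helm_a c a \<alpha> \<beta> \<gamma> w = 0) \<and>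
     (\<forall>\<alpha> \<beta> \<gamma>. helm_b c b \<alpha> \<beta> \<gamma> w = 0) \<and> (\<forall>\<alpha> \<beta>. helm_g a b g \<alpha> \<beta> w = 0))"

lemma lagrangian_coeffs_imp_helmholtz:
  assumes V: "open V" and lc: "lagrangian_coeffs V M c a b g h P Q R"
  shows "helmholtz V M c a b g"
proof -
  have sm: "\<And>\<beta> \<gamma>. smooth_on V (h \<beta> \<gamma>)" "\<And>\<beta>. smooth_on V (P \<beta>)"
    "\<And>\<beta>. smooth_on V (Q \<beta>)" "smooth_on V R"
    using lc by (simp_all add: lagrangian_coeffs_def)
  have M: "\<And>w \<alpha> \<beta>. w \<in> V \<Longrightarrow> M \<alpha> \<beta> w = - (h \<alpha> \<beta> w + h \<beta> \<alpha> w)"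
    and eqs: "\<And>w \<alpha> \<beta> \<gamma>. w \<in> V \<Longrightarrow> c \<alpha> \<beta> \<gamma> w = EL_c h \<alpha> \<beta> \<gamma> w"
    "\<And>w \<alpha> \<beta>. w \<in> V \<Longrightarrow> a \<alpha> \<beta> w = EL_a h P \<alpha> \<beta> w"
    "\<And>w \<alpha> \<beta>. w \<in> V \<Longrightarrow> b \<alpha> \<beta> w = EL_b h Q \<alpha> \<beta> w"
    "\<And>w \<alpha>. w \<in> V \<Longrightarrow> g \<alpha> w = EL_g P Q R \<alpha> w"
    using lc by (simp_all add: lagrangian_coeffs_def)
  have dM: "dd v (M \<alpha> \<beta>) w = - dd v (h \<alpha> \<beta>) w - dd v (h \<beta> \<alpha>) w" if "w \<in> V" for w v \<alpha> \<beta>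
  proof -
    have d: "h \<alpha> \<beta> differentiable (at w)" for \<alpha> \<beta> using smooth_on_imp_differentiable[OF sm(1) that] .
    have "dd v (M \<alpha> \<beta>) w = dd v (\<lambda>w. - (h \<alpha> \<beta> w + h \<beta> \<alpha> w)) w"
      by (rule dd_cong[OF V that M])
    also have "\<dots> = - dd v (\<lambda>w. h \<alpha> \<beta> w + h \<beta> \<alpha> w) w"
      by (rule dd_minus[OF differentiable_add[OF d d]])
    finally show ?thesis by (simp add: dd_add[OF d d])
  qed
  have Z: "helm_c c \<alpha> \<beta> \<gamma> \<delta> w = helm_c (EL_c h) \<alpha> \<beta> \<gamma> \<delta> w"
    "helm_a c a \<alpha> \<beta> \<gamma> w = helm_a (EL_c h) (EL_a h P) \<alpha> \<beta> \<gamma> w"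
    "helm_b c b \<alpha> \<beta> \<gamma> w = helm_b (EL_c h) (EL_b h Q) \<alpha> \<beta> \<gamma> w"
    "helm_g a b g \<alpha> \<beta> w = helm_g (EL_a h P) (EL_b h Q) (EL_g P Q R) \<alpha> \<beta> w"
    if "w \<in> V" for \<alpha> \<beta> \<gamma> \<delta> w
  proof -
    have "dd v (c \<alpha> \<beta> \<gamma>) w = dd v (EL_c h \<alpha> \<beta> \<gamma>) w" "dd v (a \<alpha> \<beta>) w = dd v (EL_a h P \<alpha> \<beta>) w"
      "dd v (b \<alpha> \<beta>) w = dd v (EL_b h Q \<alpha> \<beta>) w" "dd v (g \<alpha>) w = dd v (EL_g P Q R \<alpha>) w"
      for v \<alpha> \<beta> \<gamma>
      by (rule dd_cong[OF V that], erule eqs)+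
    then show "helm_c c \<alpha> \<beta> \<gamma> \<delta> w = helm_c (EL_c h) \<alpha> \<beta> \<gamma> \<delta> w"
      "helm_a c a \<alpha> \<beta> \<gamma> w = helm_a (EL_c h) (EL_a h P) \<alpha> \<beta> \<gamma> w"
      "helm_b c b \<alpha> \<beta> \<gamma> w = helm_b (EL_c h) (EL_b h Q) \<alpha> \<beta> \<gamma> w"
      "helm_g a b g \<alpha> \<beta> w = helm_g (EL_a h P) (EL_b h Q) (EL_g P Q R) \<alpha> \<beta> w"
      unfolding helm_defs by simp_all
  qed
  show ?thesis
    unfolding helmholtz_def
  proof (intro ballI conjI allI)
    fix w \<alpha> \<beta> \<gamma> \<delta> assume w: "w \<in> V"
    show "helm_c c \<alpha> \<beta> \<gamma> \<delta> w = 0" "helm_a c a \<alpha> \<beta> \<gamma> w = 0" "helm_b c b \<alpha> \<beta> \<gamma> w = 0" "helm_g a b g \<alpha> \<beta> w = 0"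
      unfolding Z[OF w] using helm_EL[OF V sm w] by simp_all
  qed (simp_all add: dM eqs EL_c_def EL_a_def EL_b_def)
qed

section \<open>Potentials for skew closed coefficients\<close>

text \<open>Contraction of a form with the radial field \<open>(u - u0) \<partial>/\<partial>u\<close>, averaged along the segment to \<open>u0\<close>:
  the homotopy operator of the Poincare lemma in the variables \<open>u\<close>, where \<open>x\<close> and \<open>y\<close> are parameters.
  A form with \<open>k\<close> legs along the fibre needs the weight \<open>t ^ (k - 1)\<close>.\<close>

definition contract :: "real^'m \<Rightarrow> nat \<Rightarrow> ('m \<Rightarrow> 'm base \<Rightarrow> real) \<Rightarrow> ('m::finite) base \<Rightarrow> real" where
  "contract u0 n \<phi> w = (\<Sum>\<delta>\<in>UNIV. (snd (snd w) $ \<delta> - u0 $ \<delta>) *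
     seg_int (\<lambda>w. (fst w, fst (snd w), u0)) (\<lambda>w. (0, 0, snd (snd w) - u0)) n (\<phi> \<delta>) w)"

lemma has_derivative_u_component:
  "((\<lambda>w :: ('m::finite) base. snd (snd w) $ \<delta>) has_derivative (\<lambda>v. snd (snd v) $ \<delta>)) F"
  by (intro bounded_linear_imp_has_derivative bounded_linear_compose[OF bounded_linear_vec_nth]
      bounded_linear_compose[OF bounded_linear_snd] bounded_linear_snd)

locale fibre_star =
  fixes V :: "('m::finite) base set" and u0 :: "real^'m"
  assumes open_V: "open V" and convex_V: "convex V"
    and star: "\<And>x y u t. (x, y, u) \<in> V \<Longrightarrow> 0 \<le> t \<Longrightarrow> t \<le> 1 \<Longrightarrow> (x, y, u0 + t *\<^sub>R (u - u0)) \<in> V"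
begin

abbreviation "J \<equiv> seg_int (\<lambda>w. (fst w, fst (snd w), u0)) (\<lambda>w. (0, 0, snd (snd w) - u0))"
abbreviation "Ctr \<equiv> contract u0"

sublocale dilation "\<lambda>w. (fst w, fst (snd w), u0)" "\<lambda>w. (0, 0, snd (snd w) - u0)"
  "\<lambda>v. (fst v, fst (snd v), 0)" "\<lambda>v. (0, 0, snd (snd v))" V V
proof
  show "((\<lambda>w. (fst w, fst (snd w), u0)) has_derivative (\<lambda>v. (fst v, fst (snd v), 0))) (at z)" for z :: "'m base"
    by (auto intro!: derivative_eq_intros)
  show "((\<lambda>w. (0, 0, snd (snd w) - u0)) has_derivative (\<lambda>v. (0, 0, snd (snd v)))) (at z)" for z :: "'m base"
    by (auto intro!: derivative_eq_intros)
  show "(fst z, fst (snd z), u0) + t *\<^sub>R (0, 0, snd (snd z) - u0) \<in> V" if "z \<in> V" "0 \<le> t" "t \<le> 1" for z t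
    using star[of "fst z" "fst (snd z)" "snd (snd z)" t] that by simp
qed (rule open_V convex_V)+

lemma smooth_on_contract:
  assumes "\<And>\<delta>. smooth_on V (\<phi> \<delta>)" shows "smooth_on V (Ctr n \<phi>)"
  unfolding contract_def[abs_def]
proof (intro smooth_on_sum smooth_on_mult smooth_on_seg_int smooth_on_diff open_V assms smooth_on_const)
  show "smooth_on V (\<lambda>w. snd (snd w) $ \<delta>)" for \<delta>
    by (rule smooth_on_affine[OF open_V has_derivative_u_component])
qed

lemma contract_cong:
  "(\<And>\<delta> w. w \<in> V \<Longrightarrow> \<phi> \<delta> w = \<psi> \<delta> w) \<Longrightarrow> w \<in> V \<Longrightarrow> Ctr n \<phi> w = Ctr n \<psi> w"
  unfolding contract_def by (intro sum.cong refl arg_cong2[of _ _ _ _ "(*)"] seg_int_cong) auto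

lemma contract_add:
  assumes "\<And>\<delta>. smooth_on V (\<phi> \<delta>)" "\<And>\<delta>. smooth_on V (\<psi> \<delta>)" "w \<in> V"
  shows "Ctr n (\<lambda>\<delta> z. \<phi> \<delta> z + \<psi> \<delta> z) w = Ctr n \<phi> w + Ctr n \<psi> w"
  using assms by (simp add: contract_def seg_int_add smooth_on_imp_continuous distrib_left sum.distrib)

lemma contract_minus: "Ctr n (\<lambda>\<delta> z. - \<phi> \<delta> z) w = - Ctr n \<phi> w"
  using seg_int_cmult[of n "-1"] by (simp add: contract_def sum_negf)

lemma contract_diff:
  assumes "\<And>\<delta>. smooth_on V (\<phi> \<delta>)" "\<And>\<delta>. smooth_on V (\<psi> \<delta>)" "w \<in> V"
  shows "Ctr n (\<lambda>\<delta> z. \<phi> \<delta> z - \<psi> \<delta> z) w = Ctr n \<phi> w - Ctr n \<psi> w"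
  using contract_add[of \<phi> "\<lambda>\<delta> z. - \<psi> \<delta> z" w n] assms smooth_on_minus[OF open_V]
  by (simp add: contract_minus)

lemma seg_int_dd_zero:
  assumes "smooth_on V F" "w \<in> V" shows "J n (dd (0, 0, 0) F) w = 0"
proof -
  have "dd (0, 0, 0) F z = 0" if "z \<in> V" for z
    using linear_0[OF linear_dd[OF smooth_on_imp_differentiable[OF assms(1) that]]] by (simp add: zero_prod_def)
  then have "J n (dd (0, 0, 0) F) w = J n (\<lambda>_. 0) w" by (rule seg_int_cong[OF _ assms(2)])
  then show ?thesis by (simp add: seg_int_def)
qed

text \<open>The homotopy operator commutes with derivatives along the parameters \<open>x, y\<close>.  A derivative along the
  fibre also hits the factor \<open>u - u0\<close> and uncovers an index.\<close>

lemma dd_contract: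
  assumes \<phi>: "\<And>\<delta>. smooth_on V (\<phi> \<delta>)" and w: "w \<in> V"
  shows Dx_contract: "Dx (Ctr n \<phi>) w = Ctr n (\<lambda>\<delta>. Dx (\<phi> \<delta>)) w"
    and Dy_contract: "Dy (Ctr n \<phi>) w = Ctr n (\<lambda>\<delta>. Dy (\<phi> \<delta>)) w"
    and Du_contract: "Du \<alpha> (Ctr n \<phi>) w = J n (\<phi> \<alpha>) w + Ctr (Suc n) (\<lambda>\<delta>. Du \<alpha> (\<phi> \<delta>)) w"
proof -
  have D: "(Ctr n \<phi> has_derivative (\<lambda>v. \<Sum>\<delta>\<in>UNIV. (snd (snd w) $ \<delta> - u0 $ \<delta>) *
      (J n (dd (fst v, fst (snd v), 0) (\<phi> \<delta>)) w + J (Suc n) (dd (0, 0, snd (snd v)) (\<phi> \<delta>)) w)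
      + snd (snd v) $ \<delta> * J n (\<phi> \<delta>) w)) (at w)"
    unfolding contract_def[abs_def]
  proof (intro has_derivative_sum has_derivative_mult has_derivative_seg_int \<phi> w)
    show "((\<lambda>w. snd (snd w) $ \<delta> - u0 $ \<delta>) has_derivative (\<lambda>v. snd (snd v) $ \<delta>)) (at w)" for \<delta>
      using has_derivative_diff[OF has_derivative_u_component has_derivative_const] by simp
  qed
  show "Dx (Ctr n \<phi>) w = Ctr n (\<lambda>\<delta>. Dx (\<phi> \<delta>)) w" "Dy (Ctr n \<phi>) w = Ctr n (\<lambda>\<delta>. Dy (\<phi> \<delta>)) w"
    "Du \<alpha> (Ctr n \<phi>) w = J n (\<phi> \<alpha>) w + Ctr (Suc n) (\<lambda>\<delta>. Du \<alpha> (\<phi> \<delta>)) w"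
    unfolding dd_eq[OF D] by (simp_all add: contract_def seg_int_dd_zero \<phi> w sum.distrib)
qed

text \<open>The radial direction is a combination of the fibre directions, so \<open>seg_int_homotopy\<close> becomes a
  statement about the partial derivatives along \<open>u\<close>.\<close>

lemma contract_homotopy:
  assumes F: "smooth_on V F" and w: "w \<in> V"
  shows "real (Suc n) * J n F w + Ctr (Suc n) (\<lambda>\<delta>. Du \<delta> F) w = F w"
proof -
  obtain x y u where [simp]: "w = (x, y, u)" by (metis prod_cases3)
  have e: "(0, 0, u - u0) = (\<Sum>\<delta>\<in>UNIV. (u $ \<delta> - u0 $ \<delta>) *\<^sub>R ((0, 0, axis \<delta> 1) :: 'm base))"
  proof -
    have "u - u0 = (\<Sum>\<delta>\<in>UNIV. (u - u0) $ \<delta> *\<^sub>R axis \<delta> 1)"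
      by (rule axis_expansion[symmetric])
    then show ?thesis by (simp add: prod_eq_iff fst_sum snd_sum)
  qed
  have "J (Suc n) (dd (0, 0, u - u0) F) w =
      J (Suc n) (\<lambda>z. \<Sum>\<delta>\<in>UNIV. (u $ \<delta> - u0 $ \<delta>) * Du \<delta> F z) w"
    unfolding e by (intro seg_int_cong dd_lincomb smooth_on_imp_differentiable[OF F] w)
  also have "\<dots> = Ctr (Suc n) (\<lambda>\<delta>. Du \<delta> F) w"
    unfolding contract_def
    by (subst seg_int_sum) (simp_all add: w[simplified] seg_int_cmult continuous_on_mult_left
        smooth_on_imp_continuous smooth_on_dd F)
  finally show ?thesis
    using seg_int_homotopy[OF F w, of n] by simp
qed

text \<open>The form in which closedness is used: the four terms of each \<open>helm\<close> expression split into the derivative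
  of one coefficient along the radial index, and three terms whose contractions make up an Euler-Lagrange coefficient.\<close>

lemma contract_homotopy3:
  assumes F: "smooth_on V F" and w: "w \<in> V"
    and sm: "\<And>\<delta>. smooth_on V (X \<delta>)" "\<And>\<delta>. smooth_on V (Y \<delta>)" "\<And>\<delta>. smooth_on V (W \<delta>)"
    and eq: "\<And>\<delta> z. z \<in> V \<Longrightarrow> X \<delta> z - Y \<delta> z - W \<delta> z = Du \<delta> F z"
  shows "real (Suc n) * J n F w + (Ctr (Suc n) X w - Ctr (Suc n) Y w - Ctr (Suc n) W w) = F w"
proof -
  have "Ctr (Suc n) (\<lambda>\<delta>. Du \<delta> F) w = Ctr (Suc n) (\<lambda>\<delta> z. X \<delta> z - Y \<delta> z - W \<delta> z) w"
    by (rule contract_cong[OF eq[symmetric] w])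
  also have "\<dots> = Ctr (Suc n) X w - Ctr (Suc n) Y w - Ctr (Suc n) W w"
    by (simp add: contract_diff sm smooth_on_diff open_V w)
  finally show ?thesis using contract_homotopy[OF F w, of n] by simp
qed

lemma seg_int_skew:
  assumes "\<And>z. z \<in> V \<Longrightarrow> F z = - G z" "w \<in> V" shows "J n F w = - J n G w"
  using seg_int_cong[of F "\<lambda>z. -1 * G z" w n] seg_int_cmult[of n "-1" G w] assms by simp

lemma dd_skew:
  assumes "\<And>z. z \<in> V \<Longrightarrow> F z = - G z" "smooth_on V G" "w \<in> V" shows "dd v F w = - dd v G w"
  using dd_cong[OF open_V assms(3,1)] dd_minus[OF smooth_on_imp_differentiable[OF assms(2,3)]] by simp

text \<open>With \<open>h\<close> skew the Lagrangian contributes nothing to the coefficient of \<open>u\<^sub>x\<^sub>y\<close>, hence the multiplier \<open>0\<close> in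
  the conclusion.  The coefficients
  \<open>c, a, b, g\<close> have 3, 2, 2, 1 fibre indices; contracting each of them with weight \<open>t\<^sup>2, t, t, 1\<close> gives
  \<open>h, P, Q, R\<close>.  In the Euler-Lagrange coefficients of these, the terms in which the derivative uncovers an index add up,
  by skewness, to 3, 2, 2, 1 times the same segment integral, and the remaining terms are the contraction of
  the fibre gradient by closedness.\<close>

lemma skew_closed_imp_EL:
  assumes sm: "\<And>\<alpha> \<beta> \<gamma>. smooth_on V (c \<alpha> \<beta> \<gamma>)" "\<And>\<alpha> \<beta>. smooth_on V (a \<alpha> \<beta>)"
      "\<And>\<alpha> \<beta>. smooth_on V (b \<alpha> \<beta>)" "\<And>\<alpha>. smooth_on V (g \<alpha>)"
    and c1: "\<And>\<alpha> \<beta> \<gamma> w. w \<in> V \<Longrightarrow> c \<alpha> \<beta> \<gamma> w = - c \<beta> \<alpha> \<gamma> w"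
    and c2: "\<And>\<alpha> \<beta> \<gamma> w. w \<in> V \<Longrightarrow> c \<alpha> \<beta> \<gamma> w = - c \<alpha> \<gamma> \<beta> w"
    and a: "\<And>\<alpha> \<beta> w. w \<in> V \<Longrightarrow> a \<alpha> \<beta> w = - a \<beta> \<alpha> w"
    and b: "\<And>\<alpha> \<beta> w. w \<in> V \<Longrightarrow> b \<alpha> \<beta> w = - b \<beta> \<alpha> w"
    and Zc: "\<And>\<alpha> \<beta> \<gamma> \<delta> w. w \<in> V \<Longrightarrow> helm_c c \<alpha> \<beta> \<gamma> \<delta> w = 0"
    and Za: "\<And>\<alpha> \<beta> \<gamma> w. w \<in> V \<Longrightarrow> helm_a c a \<alpha> \<beta> \<gamma> w = 0"
    and Zb: "\<And>\<alpha> \<beta> \<gamma> w. w \<in> V \<Longrightarrow> helm_b c b \<alpha> \<beta> \<gamma> w = 0"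
    and Zg: "\<And>\<alpha> \<beta> w. w \<in> V \<Longrightarrow> helm_g a b g \<alpha> \<beta> w = 0"
  obtains h P Q R where "lagrangian_coeffs V (\<lambda>_ _ _. 0) c a b g h P Q R"
proof -
  define h where "h \<beta> \<gamma> = Ctr 2 (\<lambda>\<delta>. c \<delta> \<beta> \<gamma>)" for \<beta> \<gamma>
  define P where "P \<beta> = Ctr 1 (\<lambda>\<delta>. a \<delta> \<beta>)" for \<beta>
  define Q where "Q \<beta> = Ctr 1 (\<lambda>\<delta>. b \<delta> \<beta>)" for \<beta>
  define R where "R = Ctr 0 g"
  note defs = h_def P_def Q_def R_def
  have smh: "smooth_on V (h \<beta> \<gamma>)" "smooth_on V (P \<beta>)" "smooth_on V (Q \<beta>)" "smooth_on V R" for \<beta> \<gamma>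
    unfolding defs by (intro smooth_on_contract sm)+
  have skew: "h \<beta> \<gamma> w = - h \<gamma> \<beta> w" if "w \<in> V" for \<beta> \<gamma> w
    unfolding h_def contract_minus[symmetric] by (rule contract_cong[OF c2 that])
  have dsk: "dd v (c \<alpha> \<beta> \<gamma>) w = - dd v (c \<alpha> \<gamma> \<beta>) w" "dd v (c \<alpha> \<beta> \<gamma>) w = - dd v (c \<beta> \<alpha> \<gamma>) w"
    "dd v (b \<alpha> \<beta>) w = - dd v (b \<beta> \<alpha>) w" if w: "w \<in> V" for v w \<alpha> \<beta> \<gamma>
  proof -
    show "dd v (c \<alpha> \<beta> \<gamma>) w = - dd v (c \<alpha> \<gamma> \<beta>) w" by (rule dd_skew[OF _ sm(1) w]) (rule c2)
    show "dd v (c \<alpha> \<beta> \<gamma>) w = - dd v (c \<beta> \<alpha> \<gamma>) w" by (rule dd_skew[OF _ sm(1) w]) (rule c1)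
    show "dd v (b \<alpha> \<beta>) w = - dd v (b \<beta> \<alpha>) w" by (rule dd_skew[OF _ sm(3) w]) (rule b)
  qed
  note d_contract = Dx_contract Dy_contract Du_contract
  have eg: "g \<alpha> w = EL_g P Q R \<alpha> w" if w: "w \<in> V" for \<alpha> w
  proof -
    have "real (Suc 0) * J 0 (g \<alpha>) w + (Ctr (Suc 0) (\<lambda>\<delta>. Du \<alpha> (g \<delta>)) w - Ctr (Suc 0) (\<lambda>\<delta>. Dx (a \<delta> \<alpha>)) w
        - Ctr (Suc 0) (\<lambda>\<delta>. Dy (b \<delta> \<alpha>)) w) = g \<alpha> w"
    proof (rule contract_homotopy3)
      show "Du \<alpha> (g \<delta>) z - Dx (a \<delta> \<alpha>) z - Dy (b \<delta> \<alpha>) z = Du \<delta> (g \<alpha>) z" if "z \<in> V" for \<delta> z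
        using Zg[OF that, of \<delta> \<alpha>] dsk(3)[OF that, of "(0,1,0)" \<delta> \<alpha>] by (simp add: helm_defs)
    qed (intro smooth_on_dd sm w)+
    then show ?thesis by (simp add: EL_g_def defs d_contract sm w)
  qed
  have ea: "a \<alpha> \<beta> w = EL_a h P \<alpha> \<beta> w" if w: "w \<in> V" for \<alpha> \<beta> w
  proof -
    have "real (Suc 1) * J 1 (a \<alpha> \<beta>) w + (Ctr (Suc 1) (\<lambda>\<delta>. Du \<alpha> (a \<delta> \<beta>)) w - Ctr (Suc 1) (\<lambda>\<delta>. Du \<beta> (a \<delta> \<alpha>)) w
        - Ctr (Suc 1) (\<lambda>\<delta>. Dy (c \<delta> \<beta> \<alpha>)) w) = a \<alpha> \<beta> w"
    proof (rule contract_homotopy3)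
      show "Du \<alpha> (a \<delta> \<beta>) z - Du \<beta> (a \<delta> \<alpha>) z - Dy (c \<delta> \<beta> \<alpha>) z = Du \<delta> (a \<alpha> \<beta>) z" if "z \<in> V" for \<delta> z
        using Za[OF that, of \<delta> \<alpha> \<beta>] dsk(1)[OF that, of "(0,1,0)" \<alpha> \<beta> \<delta>]
          dsk(2)[OF that, of "(0,1,0)" \<alpha> \<delta> \<beta>] dsk(1)[OF that, of "(0,1,0)" \<delta> \<alpha> \<beta>] by (simp add: helm_defs)
    qed (intro smooth_on_dd sm w)+
    moreover have "J 1 (a \<beta> \<alpha>) w = - J 1 (a \<alpha> \<beta>) w" by (rule seg_int_skew[OF a w])
    ultimately show ?thesis by (simp add: EL_a_def defs d_contract sm w numeral_2_eq_2)
  qed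
  have eb: "b \<alpha> \<beta> w = EL_b h Q \<alpha> \<beta> w" if w: "w \<in> V" for \<alpha> \<beta> w
  proof -
    have "real (Suc 1) * J 1 (b \<alpha> \<beta>) w + (Ctr (Suc 1) (\<lambda>\<delta>. Du \<alpha> (b \<delta> \<beta>)) w - Ctr (Suc 1) (\<lambda>\<delta>. Du \<beta> (b \<delta> \<alpha>)) w
        - Ctr (Suc 1) (\<lambda>\<delta>. Dx (c \<delta> \<alpha> \<beta>)) w) = b \<alpha> \<beta> w"
    proof (rule contract_homotopy3)
      show "Du \<alpha> (b \<delta> \<beta>) z - Du \<beta> (b \<delta> \<alpha>) z - Dx (c \<delta> \<alpha> \<beta>) z = Du \<delta> (b \<alpha> \<beta>) z" if "z \<in> V" for \<delta> z
        using Zb[OF that, of \<delta> \<alpha> \<beta>] dsk(3)[OF that, of "(0,0,axis \<beta> 1)" \<alpha> \<delta>] by (simp add: helm_defs)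
    qed (intro smooth_on_dd sm w)+
    moreover have "J 1 (b \<beta> \<alpha>) w = - J 1 (b \<alpha> \<beta>) w" by (rule seg_int_skew[OF b w])
    ultimately show ?thesis by (simp add: EL_b_def defs d_contract sm w numeral_2_eq_2)
  qed
  have ec: "c \<alpha> \<beta> \<gamma> w = EL_c h \<alpha> \<beta> \<gamma> w" if w: "w \<in> V" for \<alpha> \<beta> \<gamma> w
  proof -
    have "real (Suc 2) * J 2 (c \<alpha> \<beta> \<gamma>) w + (Ctr (Suc 2) (\<lambda>\<delta>. Du \<alpha> (c \<delta> \<beta> \<gamma>)) w - Ctr (Suc 2) (\<lambda>\<delta>. Du \<beta> (c \<delta> \<alpha> \<gamma>)) w
        - Ctr (Suc 2) (\<lambda>\<delta>. Du \<gamma> (c \<delta> \<beta> \<alpha>)) w) = c \<alpha> \<beta> \<gamma> w"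
    proof (rule contract_homotopy3)
      show "Du \<alpha> (c \<delta> \<beta> \<gamma>) z - Du \<beta> (c \<delta> \<alpha> \<gamma>) z - Du \<gamma> (c \<delta> \<beta> \<alpha>) z = Du \<delta> (c \<alpha> \<beta> \<gamma>) z" if "z \<in> V" for \<delta> z
        using Zc[OF that, of \<delta> \<alpha> \<beta> \<gamma>] dsk(1)[OF that, of "(0,0,axis \<gamma> 1)" \<alpha> \<beta> \<delta>]
          dsk(2)[OF that, of "(0,0,axis \<gamma> 1)" \<alpha> \<delta> \<beta>] dsk(1)[OF that, of "(0,0,axis \<gamma> 1)" \<delta> \<alpha> \<beta>]
        by (simp add: helm_defs)
    qed (intro smooth_on_dd sm w)+
    moreover have "J 2 (c \<beta> \<alpha> \<gamma>) w = - J 2 (c \<alpha> \<beta> \<gamma>) w" by (rule seg_int_skew[OF c1 w])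
    moreover have "J 2 (c \<gamma> \<beta> \<alpha>) w = - J 2 (c \<alpha> \<beta> \<gamma>) w"
    proof (rule seg_int_skew[OF _ w])
      show "c \<gamma> \<beta> \<alpha> z = - c \<alpha> \<beta> \<gamma> z" if "z \<in> V" for z
        using c1[OF that, of \<gamma> \<beta> \<alpha>] c2[OF that, of \<beta> \<gamma> \<alpha>] c1[OF that, of \<beta> \<alpha> \<gamma>] by simp
    qed
    ultimately show ?thesis by (simp add: EL_c_def defs d_contract sm w)
  qed
  have "0 = - (h \<alpha> \<beta> w + h \<beta> \<alpha> w)" if "w \<in> V" for \<alpha> \<beta> w
    using skew[OF that, of \<alpha> \<beta>] by simp
  then have "lagrangian_coeffs V (\<lambda>_ _ _. 0) c a b g h P Q R"
    unfolding lagrangian_coeffs_def by (intro conjI allI ballI smh ec ea eb eg)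
  then show thesis by (rule that)
qed

end

text \<open>A product of three balls is both convex and invariant under contraction of \<open>u\<close> to the centre.\<close>

lemma obtain_fibre_star:
  fixes U :: "('m::finite) base set"
  assumes "open U" "b \<in> U"
  obtains V u0 where "fibre_star V u0" "b \<in> V" "V \<subseteq> U"
proof -
  obtain x0 y0 u0 where b: "b = (x0, y0, u0)" by (metis prod_cases3)
  obtain A B where AB: "open A" "open B" "b \<in> A \<times> B" "A \<times> B \<subseteq> U"
    using open_prod_elim[OF assms] by blast
  then obtain B1 B2 where B12: "open B1" "open B2" "(y0, u0) \<in> B1 \<times> B2" "B1 \<times> B2 \<subseteq> B"
    using open_prod_elim[OF AB(2), of "(y0, u0)"] b by auto
  obtain e1 where e1: "e1 > 0" "ball x0 e1 \<subseteq> A" using AB(1,3) b openE[of A x0] by auto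
  obtain e2 where e2: "e2 > 0" "ball y0 e2 \<subseteq> B1" using B12(1,3) openE[of B1 y0] by auto
  obtain e3 where e3: "e3 > 0" "ball u0 e3 \<subseteq> B2" using B12(2,3) openE[of B2 u0] by auto
  let ?V = "ball x0 e1 \<times> ball y0 e2 \<times> ball u0 e3"
  have "fibre_star ?V u0"
  proof
    show "open ?V" by (intro open_Times open_ball)
    show "convex ?V" by (intro convex_Times convex_ball)
    fix x y u and t :: real assume t: "(x, y, u) \<in> ?V" "0 \<le> t" "t \<le> 1"
    have "t * norm (u - u0) \<le> 1 * norm (u - u0)" using t by (intro mult_right_mono) auto
    then show "(x, y, u0 + t *\<^sub>R (u - u0)) \<in> ?V"
      using t by (auto simp: dist_norm norm_minus_commute)
  qed
  moreover have "b \<in> ?V" using b e1 e2 e3 by auto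
  moreover have "?V \<subseteq> U" using e1 e2 e3 AB(4) B12(4) by blast
  ultimately show thesis using that by blast
qed

text \<open>With \<open>h0 = - M / 2\<close> the Lagrangian \<open>h0 p q\<close> produces the term \<open>M u\<^sub>x\<^sub>y\<close>.  The first-order conditions
  express the derivatives of \<open>M\<close> by \<open>c, a, b\<close>, and show that the remainders \<open>c', a', b'\<close> are skew: \<open>c'\<close> is \<open>c\<close> minus
  the Christoffel symbols of \<open>M\<close>.  The remainder is closed because \<open>c, a, b, g\<close> and
  the Euler-Lagrange coefficients of \<open>h0 p q\<close> are.\<close>

lemma helmholtz_imp_lagrangian_coeffs:
  assumes star: "fibre_star V u0"
    and sm: "\<And>\<alpha> \<beta>. smooth_on V (M \<alpha> \<beta>)" "\<And>\<alpha> \<beta> \<gamma>. smooth_on V (c \<alpha> \<beta> \<gamma>)" "\<And>\<alpha> \<beta>. smooth_on V (a \<alpha> \<beta>)"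
      "\<And>\<alpha> \<beta>. smooth_on V (b \<alpha> \<beta>)" "\<And>\<alpha>. smooth_on V (g \<alpha>)"
    and M: "\<And>\<alpha> \<beta> w. w \<in> V \<Longrightarrow> M \<alpha> \<beta> w = M \<beta> \<alpha> w"
    and hh: "helmholtz V M c a b g"
  obtains h P Q R where "lagrangian_coeffs V M c a b g h P Q R"
proof -
  interpret fibre_star V u0 by (rule star)
  note V = open_V
  define h0 where "h0 \<alpha> \<beta> = (\<lambda>w. - 1 / 2 * M \<alpha> \<beta> w)" for \<alpha> \<beta>
  define z0 :: "'a \<Rightarrow> 'a base \<Rightarrow> real" where "z0 = (\<lambda>_ _. 0)"
  define c' where "c' \<alpha> \<beta> \<gamma> = (\<lambda>w. c \<alpha> \<beta> \<gamma> w - EL_c h0 \<alpha> \<beta> \<gamma> w)" for \<alpha> \<beta> \<gamma>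
  define a' where "a' \<alpha> \<beta> = (\<lambda>w. a \<alpha> \<beta> w - EL_a h0 z0 \<alpha> \<beta> w)" for \<alpha> \<beta>
  define b' where "b' \<alpha> \<beta> = (\<lambda>w. b \<alpha> \<beta> w - EL_b h0 z0 \<alpha> \<beta> w)" for \<alpha> \<beta>
  have sm0: "\<And>\<alpha> \<beta>. smooth_on V (h0 \<alpha> \<beta>)" "\<And>\<alpha>. smooth_on V (z0 \<alpha>)" "smooth_on V (\<lambda>_. 0)"
    unfolding h0_def z0_def by (intro smooth_on_mult smooth_on_const V sm)+
  note smEL = smooth_on_EL[where h=h0 and P=z0 and Q=z0 and R="\<lambda>_. 0", OF V sm0(1) sm0(2) sm0(2) sm0(3)]
  have sm': "smooth_on V (c' \<alpha> \<beta> \<gamma>)" "smooth_on V (a' \<alpha> \<beta>)" "smooth_on V (b' \<alpha> \<beta>)" for \<alpha> \<beta> \<gamma>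
    unfolding c'_def a'_def b'_def by (intro smooth_on_diff V sm smEL)+
  have dz0: "dd v (z0 \<alpha>) w = 0" for v w \<alpha> by (simp add: z0_def)
  have dh0: "dd v (h0 \<alpha> \<beta>) w = - 1 / 2 * dd v (M \<alpha> \<beta>) w" if "w \<in> V" for v w \<alpha> \<beta>
    unfolding h0_def by (rule dd_cmult[OF smooth_on_imp_differentiable[OF sm(1) that]])
  have H: "Du \<gamma> (M \<alpha> \<beta>) w = c \<alpha> \<beta> \<gamma> w + c \<beta> \<alpha> \<gamma> w" "Dy (M \<alpha> \<beta>) w = a \<alpha> \<beta> w + a \<beta> \<alpha> w"
    "Dx (M \<alpha> \<beta>) w = b \<alpha> \<beta> w + b \<beta> \<alpha> w"
    "c \<alpha> \<beta> \<gamma> w - c \<alpha> \<gamma> \<beta> w = - (c \<beta> \<alpha> \<gamma> w - c \<beta> \<gamma> \<alpha> w)"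
    "helm_c c \<alpha> \<beta> \<gamma> \<delta> w = 0" "helm_a c a \<alpha> \<beta> \<gamma> w = 0" "helm_b c b \<alpha> \<beta> \<gamma> w = 0" "helm_g a b g \<alpha> \<beta> w = 0"
    if "w \<in> V" for w \<alpha> \<beta> \<gamma> \<delta>
    using bspec[OF hh[unfolded helmholtz_def] that] by simp_all
  have c'_eq: "c' \<alpha> \<beta> \<gamma> w = c \<alpha> \<beta> \<gamma> w - (- (c \<beta> \<gamma> \<alpha> w + c \<gamma> \<beta> \<alpha> w) + (c \<alpha> \<gamma> \<beta> w + c \<gamma> \<alpha> \<beta> w)
      + (c \<beta> \<alpha> \<gamma> w + c \<alpha> \<beta> \<gamma> w)) / 2" if "w \<in> V" for \<alpha> \<beta> \<gamma> w
    by (simp add: c'_def EL_c_def dh0 H(1) that field_simps)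
  have skc1: "c' \<alpha> \<beta> \<gamma> w = - c' \<beta> \<alpha> \<gamma> w" if w: "w \<in> V" for \<alpha> \<beta> \<gamma> w
    using H(4)[OF w, of \<alpha> \<beta> \<gamma>] H(4)[OF w, of \<beta> \<gamma> \<alpha>] H(4)[OF w, of \<gamma> \<alpha> \<beta>]
    by (simp add: c'_eq w field_simps)
  have skc2: "c' \<alpha> \<beta> \<gamma> w = - c' \<alpha> \<gamma> \<beta> w" if w: "w \<in> V" for \<alpha> \<beta> \<gamma> w
    using H(4)[OF w, of \<alpha> \<beta> \<gamma>] H(4)[OF w, of \<beta> \<gamma> \<alpha>] H(4)[OF w, of \<gamma> \<alpha> \<beta>]
    by (simp add: c'_eq w field_simps)
  have ska: "a' \<alpha> \<beta> w = - a' \<beta> \<alpha> w" and skb: "b' \<alpha> \<beta> w = - b' \<beta> \<alpha> w" if w: "w \<in> V" for \<alpha> \<beta> w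
    by (simp_all add: a'_def b'_def EL_a_def EL_b_def dh0 dz0 H(2,3) w field_simps)
  have diff: "F differentiable (at w)" if "smooth_on V F" "w \<in> V" for F w
    using smooth_on_imp_differentiable that .
  have dd': "dd v (c' \<alpha> \<beta> \<gamma>) w = dd v (c \<alpha> \<beta> \<gamma>) w - dd v (EL_c h0 \<alpha> \<beta> \<gamma>) w"
    "dd v (a' \<alpha> \<beta>) w = dd v (a \<alpha> \<beta>) w - dd v (EL_a h0 z0 \<alpha> \<beta>) w"
    "dd v (b' \<alpha> \<beta>) w = dd v (b \<alpha> \<beta>) w - dd v (EL_b h0 z0 \<alpha> \<beta>) w" if "w \<in> V" for v w \<alpha> \<beta> \<gamma>
    unfolding c'_def a'_def b'_def by (intro dd_diff diff sm smEL that)+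
  have EL_g0: "EL_g z0 z0 (\<lambda>_. 0) \<alpha> = z0 \<alpha>" for \<alpha>
    unfolding EL_g_def[abs_def] dz0 by (simp add: z0_def)
  have Z': "helm_c c' \<alpha> \<beta> \<gamma> \<delta> w = 0" "helm_a c' a' \<alpha> \<beta> \<gamma> w = 0" "helm_b c' b' \<alpha> \<beta> \<gamma> w = 0" "helm_g a' b' g \<alpha> \<beta> w = 0"
    if w: "w \<in> V" for \<alpha> \<beta> \<gamma> \<delta> w
  proof -
    note Z0 = helm_EL[where h=h0 and P=z0 and Q=z0 and R="\<lambda>_. 0", OF V sm0(1) sm0(2) sm0(2) sm0(3) w]
    show "helm_c c' \<alpha> \<beta> \<gamma> \<delta> w = 0"
      using H(5)[OF w, of \<alpha> \<beta> \<gamma> \<delta>] Z0(1)[of \<alpha> \<beta> \<gamma> \<delta>] unfolding helm_defs dd'[OF w] by linarith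
    show "helm_a c' a' \<alpha> \<beta> \<gamma> w = 0"
      using H(6)[OF w, of \<alpha> \<beta> \<gamma>] Z0(2)[of \<alpha> \<beta> \<gamma>] unfolding helm_defs dd'[OF w] by linarith
    show "helm_b c' b' \<alpha> \<beta> \<gamma> w = 0"
      using H(7)[OF w, of \<alpha> \<beta> \<gamma>] Z0(3)[of \<alpha> \<beta> \<gamma>] unfolding helm_defs dd'[OF w] by linarith
    show "helm_g a' b' g \<alpha> \<beta> w = 0"
      using H(8)[OF w, of \<alpha> \<beta>] Z0(4)[of \<alpha> \<beta>] unfolding helm_defs dd'[OF w] EL_g0 dz0 by linarith
  qed
  obtain h P Q R where lc: "lagrangian_coeffs V (\<lambda>_ _ _. 0) c' a' b' g h P Q R"
    by (rule skew_closed_imp_EL[OF sm' sm(5) skc1 skc2 ska skb Z'])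
  have skh: "0 = - (h \<beta> \<gamma> w + h \<gamma> \<beta> w)" if "w \<in> V" for \<beta> \<gamma> w
    using lc that unfolding lagrangian_coeffs_def by blast
  from lc have smh: "\<And>\<beta> \<gamma>. smooth_on V (h \<beta> \<gamma>)" "\<And>\<beta>. smooth_on V (P \<beta>)"
    "\<And>\<beta>. smooth_on V (Q \<beta>)" "smooth_on V R"
    and eqs: "\<And>\<alpha> \<beta> \<gamma> w. w \<in> V \<Longrightarrow> c' \<alpha> \<beta> \<gamma> w = EL_c h \<alpha> \<beta> \<gamma> w"
    "\<And>\<alpha> \<beta> w. w \<in> V \<Longrightarrow> a' \<alpha> \<beta> w = EL_a h P \<alpha> \<beta> w"
    "\<And>\<alpha> \<beta> w. w \<in> V \<Longrightarrow> b' \<alpha> \<beta> w = EL_b h Q \<alpha> \<beta> w"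
    "\<And>\<alpha> w. w \<in> V \<Longrightarrow> g \<alpha> w = EL_g P Q R \<alpha> w"
    by (auto simp: lagrangian_coeffs_def)
  define h1 where "h1 \<alpha> \<beta> = (\<lambda>w. h0 \<alpha> \<beta> w + h \<alpha> \<beta> w)" for \<alpha> \<beta>
  have dh1: "dd v (h1 \<alpha> \<beta>) w = dd v (h0 \<alpha> \<beta>) w + dd v (h \<alpha> \<beta>) w" if "w \<in> V" for v w \<alpha> \<beta>
    unfolding h1_def by (intro dd_add diff sm0 smh that)
  have "lagrangian_coeffs V M c a b g h1 P Q R"
    unfolding lagrangian_coeffs_def
  proof (intro conjI allI ballI smh eqs(4))
    show "smooth_on V (h1 \<alpha> \<beta>)" for \<alpha> \<beta> unfolding h1_def by (intro smooth_on_add V sm0 smh)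
    fix w \<alpha> \<beta> \<gamma> assume w: "w \<in> V"
    show "M \<alpha> \<beta> w = - (h1 \<alpha> \<beta> w + h1 \<beta> \<alpha> w)"
      using M[OF w, of \<alpha> \<beta>] skh[OF w, of \<alpha> \<beta>] by (simp add: h1_def h0_def)
    show "c \<alpha> \<beta> \<gamma> w = EL_c h1 \<alpha> \<beta> \<gamma> w"
      using eqs(1)[OF w, of \<alpha> \<beta> \<gamma>] unfolding c'_def EL_c_def dh1[OF w] by linarith
    show "a \<alpha> \<beta> w = EL_a h1 P \<alpha> \<beta> w"
      using eqs(2)[OF w, of \<alpha> \<beta>] unfolding a'_def EL_a_def dh1[OF w] dz0 by linarith
    show "b \<alpha> \<beta> w = EL_b h1 Q \<alpha> \<beta> w"
      using eqs(3)[OF w, of \<alpha> \<beta>] unfolding b'_def EL_b_def dh1[OF w] dz0 by linarith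
  qed
  then show thesis by (rule that)
qed

section \<open>The algebraic conditions\<close>

lemma dd_base:
  fixes F :: "('m::finite) base \<Rightarrow> real"
  assumes "F differentiable (at w)"
  shows "dd (dx, dy, du) F w = dx * Dx F w + dy * Dy F w + (\<Sum>\<tau>\<in>UNIV. du $ \<tau> * Du \<tau> F w)"
proof -
  have "(dx, dy, du) = dx *\<^sub>R (1, 0, 0) + dy *\<^sub>R (0, 1, 0) + (\<Sum>\<tau>\<in>UNIV. du $ \<tau> *\<^sub>R ((0, 0, axis \<tau> 1) :: 'm base))"
    by (simp add: prod_eq_iff fst_sum snd_sum axis_expansion)
  then show ?thesis
    by (simp add: linear_add[OF linear_dd[OF assms]] linear_scale[OF linear_dd[OF assms]] dd_lincomb[OF assms]
        del: scaleR_Pair)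
qed

lemma total_dd:
  fixes F :: "('m::finite) jet \<Rightarrow> real"
  assumes "F differentiable (at (x, y, u, p, q))"
  shows total_x_dd: "total_x F (x, y, u, p, q) r s = dd (1, 0, p, r, s) F (x, y, u, p, q)"
    and total_y_dd: "total_y F (x, y, u, p, q) s t = dd (0, 1, q, s, t) F (x, y, u, p, q)"
proof -
  have e: "(d1, d2, k1, k2, k3) = (d1, d2, 0, 0, 0) + (\<Sum>\<tau>\<in>UNIV. k1 $ \<tau> *\<^sub>R (0, 0, axis \<tau> 1, 0, 0))
      + (\<Sum>\<tau>\<in>UNIV. k2 $ \<tau> *\<^sub>R (0, 0, 0, axis \<tau> 1, 0)) + (\<Sum>\<tau>\<in>UNIV. k3 $ \<tau> *\<^sub>R ((0, 0, 0, 0, axis \<tau> 1) :: 'm jet))"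
    for d1 d2 k1 k2 k3
    by (simp add: prod_eq_iff fst_sum snd_sum axis_expansion)
  show "total_x F (x, y, u, p, q) r s = dd (1, 0, p, r, s) F (x, y, u, p, q)"
    "total_y F (x, y, u, p, q) s t = dd (0, 1, q, s, t) F (x, y, u, p, q)"
    by (subst e, simp add: linear_add[OF linear_dd[OF assms]] dd_lincomb[OF assms] d_x_def d_y_def d_u_def d_ux_def d_uy_def
        dd_def[symmetric] mult.commute del: scaleR_Pair)+
qed

text \<open>Index bookkeeping common to \<open>M H\<close> and \<open>M K\<close>.  Here \<open>mx\<close> stands for the total derivative of
  row \<open>\<alpha>\<close> of \<open>M\<close>, rewritten by the first-order conditions, and \<open>dF\<close>, \<open>tF\<close> for derivatives of \<open>F\<^sub>\<alpha> = - M f\<close>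
  given by the product rule.  The first half of \<open>mx\<close> cancels the quadratic term of \<open>H\<close>; the second half
  leaves the double sum on the right.\<close>

lemma sum_multiplier_algebra:
  fixes m fq :: "'m::finite \<Rightarrow> 'm \<Rightarrow> real" and fu fp D mu f mx :: "'m \<Rightarrow> real"
  assumes mx: "\<And>\<sigma>. mx \<sigma> = - (\<Sum>\<tau>\<in>UNIV. m \<alpha> \<tau> * fq \<tau> \<sigma>) - (\<Sum>\<tau>\<in>UNIV. m \<sigma> \<tau> * fq \<tau> \<alpha>)"
    and dF: "dF = - (\<Sum>\<sigma>\<in>UNIV. mu \<sigma> * f \<sigma> + m \<alpha> \<sigma> * fu \<sigma>)"
    and tF: "tF = - (\<Sum>\<sigma>\<in>UNIV. mx \<sigma> * fp \<sigma> + m \<alpha> \<sigma> * D \<sigma>)"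
  shows "(\<Sum>\<sigma>\<in>UNIV. m \<alpha> \<sigma> * (fu \<sigma> + (\<Sum>\<tau>\<in>UNIV. fq \<sigma> \<tau> * fp \<tau>) - D \<sigma>)) =
    tF - dF - (\<Sum>\<sigma>\<in>UNIV. mu \<sigma> * f \<sigma>) - (\<Sum>\<sigma>\<in>UNIV. \<Sum>\<tau>\<in>UNIV. m \<sigma> \<tau> * fq \<tau> \<alpha> * fp \<sigma>)"
proof -
  have "(\<Sum>\<sigma>\<in>UNIV. \<Sum>\<tau>\<in>UNIV. m \<alpha> \<sigma> * (fq \<sigma> \<tau> * fp \<tau>)) = (\<Sum>\<sigma>\<in>UNIV. \<Sum>\<tau>\<in>UNIV. m \<alpha> \<tau> * (fq \<tau> \<sigma> * fp \<sigma>))"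
    by (rule sum.swap)
  then show ?thesis
    unfolding dF tF mx
    by (simp add: sum.distrib sum_subtractf sum_distrib_left sum_distrib_right sum_negf algebra_simps)
qed

lemma smooth_on_lower:
  assumes "open V" "\<And>\<alpha> \<beta>. smooth_on V (M \<alpha> \<beta>)" "\<And>\<sigma>. smooth_on V (X \<sigma>)"
  shows "smooth_on V (lower M X \<alpha>)"
  unfolding lower_def[abs_def] by (intro smooth_on_sum smooth_on_mult assms)

lemma inv_H_eq:
  "inv_H f \<gamma> \<alpha> (x, y, u, p, q) r = d_u \<alpha> (f \<gamma>) (x, y, u, p, q)
     + (\<Sum>\<sigma>\<in>UNIV. d_uy \<sigma> (f \<gamma>) (x, y, u, p, q) * d_ux \<alpha> (f \<sigma>) (x, y, u, p, q))
     - total_x (d_ux \<alpha> (f \<gamma>)) (x, y, u, p, q) r (\<chi> \<beta>. f \<beta> (x, y, u, p, q))"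
  by (simp add: Let_def)

lemma inv_K_eq:
  "inv_K f \<gamma> \<alpha> (x, y, u, p, q) t = d_u \<alpha> (f \<gamma>) (x, y, u, p, q)
     + (\<Sum>\<sigma>\<in>UNIV. d_ux \<sigma> (f \<gamma>) (x, y, u, p, q) * d_uy \<alpha> (f \<sigma>) (x, y, u, p, q))
     - total_y (d_uy \<alpha> (f \<gamma>)) (x, y, u, p, q) (\<chi> \<beta>. f \<beta> (x, y, u, p, q)) t"
  by (simp add: Let_def)

lemma dd_multiplier:
  assumes "\<And>\<sigma>. M \<alpha> \<sigma> differentiable (at (base_pt z))" "\<And>\<sigma>. X \<sigma> differentiable (at z)"
  shows "dd v (\<lambda>z. - (\<Sum>\<sigma>\<in>UNIV. M \<alpha> \<sigma> (base_pt z) * X \<sigma> z)) z =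
    - (\<Sum>\<sigma>\<in>UNIV. dd (base_pt v) (M \<alpha> \<sigma>) (base_pt z) * X \<sigma> z + M \<alpha> \<sigma> (base_pt z) * dd v (X \<sigma>) z)"
proof (rule dd_eq)
  have "((\<lambda>z. M \<alpha> \<sigma> (base_pt z)) has_derivative (\<lambda>v. dd (base_pt v) (M \<alpha> \<sigma>) (base_pt z))) (at z)" for \<sigma>
    by (rule has_derivative_compose[OF has_derivative_jet_proj(1) has_derivative_dd[OF assms(1)]])
  then have "((\<lambda>z. M \<alpha> \<sigma> (base_pt z) * X \<sigma> z) has_derivative
      (\<lambda>v. M \<alpha> \<sigma> (base_pt z) * dd v (X \<sigma>) z + dd (base_pt v) (M \<alpha> \<sigma>) (base_pt z) * X \<sigma> z)) (at z)" for \<sigma>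
    by (rule has_derivative_mult[OF _ has_derivative_dd[OF assms(2)]])
  then show "((\<lambda>z. - (\<Sum>\<sigma>\<in>UNIV. M \<alpha> \<sigma> (base_pt z) * X \<sigma> z)) has_derivative
      (\<lambda>v. - (\<Sum>\<sigma>\<in>UNIV. dd (base_pt v) (M \<alpha> \<sigma>) (base_pt z) * X \<sigma> z + M \<alpha> \<sigma> (base_pt z) * dd v (X \<sigma>) z))) (at z)"
    by (intro has_derivative_minus has_derivative_sum) (simp add: add.commute)
qed

lemma helmholtz_pointwise: "helmholtz V M c a b g \<longleftrightarrow> (\<forall>w\<in>V. helmholtz {w} M c a b g)"
  by (simp only: helmholtz_def ball_simps simp_thms)

text \<open>The setting of the theorem, with the lowered coefficients abbreviated as \<open>c, a, b, g\<close>; \<open>F \<alpha>\<close> is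
  \<open>M (u\<^sub>x\<^sub>y - f)\<close> without its term in \<open>u\<^sub>x\<^sub>y\<close>.\<close>

locale multiplier_system =
  fixes U :: "('m::finite) base set"
    and C :: "'m \<Rightarrow> 'm \<Rightarrow> 'm \<Rightarrow> 'm base \<Rightarrow> real"
    and A B M :: "'m \<Rightarrow> 'm \<Rightarrow> 'm base \<Rightarrow> real"
    and G :: "'m \<Rightarrow> 'm base \<Rightarrow> real"
  assumes open_U: "open U"
    and smooth_C: "\<And>\<alpha> \<beta> \<gamma>. smooth_on U (C \<alpha> \<beta> \<gamma>)"
    and smooth_A: "\<And>\<alpha> \<gamma>. smooth_on U (A \<alpha> \<gamma>)"
    and smooth_B: "\<And>\<alpha> \<gamma>. smooth_on U (B \<alpha> \<gamma>)"
    and smooth_G: "\<And>\<alpha>. smooth_on U (G \<alpha>)"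
    and smooth_M: "\<And>\<alpha> \<beta>. smooth_on U (M \<alpha> \<beta>)"
    and M_sym: "\<And>\<alpha> \<beta> b. b \<in> U \<Longrightarrow> M \<alpha> \<beta> b = M \<beta> \<alpha> b"
begin

abbreviation "f \<equiv> sys_rhs C A B G"
abbreviation "c \<equiv> lower3 M C"
abbreviation "a \<equiv> lower2 M A"
abbreviation "b \<equiv> lower2 M B"
abbreviation "g \<equiv> lower M G"
abbreviation "F \<alpha> \<equiv> bipoly (c \<alpha>) (a \<alpha>) (b \<alpha>) (g \<alpha>)"

lemma smooth_lowered:
  "smooth_on U (c \<alpha> \<beta> \<gamma>)" "smooth_on U (a \<alpha> \<beta>)" "smooth_on U (b \<alpha> \<beta>)" "smooth_on U (g \<alpha>)"
  by (intro smooth_on_lower open_U smooth_M smooth_C smooth_A smooth_B smooth_G)+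

lemmas d_F = d_bipoly[OF smooth_lowered(4) smooth_lowered(1) smooth_lowered(2) smooth_lowered(3)]

lemma smooth_neg:
  "smooth_on U (\<lambda>w. - C \<alpha> \<beta> \<gamma> w)" "smooth_on U (\<lambda>w. - A \<alpha> \<beta> w)" "smooth_on U (\<lambda>w. - B \<alpha> \<beta> w)"
  "smooth_on U (\<lambda>w. - G \<alpha> w)"
  by (intro smooth_on_minus open_U smooth_C smooth_A smooth_B smooth_G)+

lemma f_bipoly: "f \<alpha> = bipoly (\<lambda>\<beta> \<gamma> w. - C \<alpha> \<beta> \<gamma> w) (\<lambda>\<gamma> w. - A \<alpha> \<gamma> w) (\<lambda>\<gamma> w. - B \<alpha> \<gamma> w) (\<lambda>w. - G \<alpha> w)"
  by (rule ext) (rule sys_rhs_bipoly)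

lemma smooth_f: "smooth_on (jets_over U) (f \<alpha>)"
  unfolding f_bipoly by (intro smooth_on_bipoly smooth_neg open_U)

lemma d_uy_f:
  assumes "z \<in> jets_over U"
  shows "d_uy \<beta> (f \<sigma>) z = bipoly (\<lambda>_ _ _. 0) (\<lambda>\<gamma> w. - C \<sigma> \<gamma> \<beta> w) (\<lambda>_ _. 0) (\<lambda>w. - B \<sigma> \<beta> w) z"
  unfolding f_bipoly by (rule d_uy_bipoly, (rule smooth_neg assms)+)

lemma inv_S_f:
  assumes z: "z \<in> jets_over U"
  shows "inv_S f \<gamma> \<alpha> \<beta> z = C \<gamma> \<alpha> \<beta> (base_pt z) - C \<gamma> \<beta> \<alpha> (base_pt z)"
proof -
  have "d_ux \<beta> (d_uy \<alpha> (f \<gamma>)) z = - C \<gamma> \<beta> \<alpha> (base_pt z)" for \<alpha> \<beta>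
  proof -
    have "d_ux \<beta> (d_uy \<alpha> (f \<gamma>)) z =
        d_ux \<beta> (bipoly (\<lambda>_ _ _. 0) (\<lambda>\<delta> w. - C \<gamma> \<delta> \<alpha> w) (\<lambda>_ _. 0) (\<lambda>w. - B \<gamma> \<alpha> w)) z"
      by (rule d_cong(4)[OF open_U z d_uy_f])
    also have "\<dots> = bipoly (\<lambda>_ _ _. 0) (\<lambda>_ _. 0) (\<lambda>_ _. 0) (\<lambda>w. - C \<gamma> \<beta> \<alpha> w) z"
      by (rule d_ux_bipoly, (rule smooth_neg z smooth_on_const open_U)+)
    finally show ?thesis by (simp add: bipoly_def)
  qed
  then show ?thesis by (simp add: inv_S_def)
qed

lemma multiplier_inv_S:
  assumes "(x, y, u) \<in> U"
  shows "(\<Sum>\<sigma>\<in>UNIV. M \<alpha> \<sigma> (x, y, u) * inv_S f \<sigma> \<beta> \<gamma> (x, y, u, p, q)) = c \<alpha> \<beta> \<gamma> (x, y, u) - c \<alpha> \<gamma> \<beta> (x, y, u)"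
  using assms by (simp add: inv_S_f base_pt_def lower_def right_diff_distrib sum_subtractf)

lemma multiplier_Omega:
  "(\<Sum>\<sigma>\<in>UNIV. M \<alpha> \<sigma> w * Omega C A B \<sigma> \<beta> w (dx, dy, du)) =
    (\<Sum>\<tau>\<in>UNIV. c \<alpha> \<beta> \<tau> w * du $ \<tau>) + a \<alpha> \<beta> w * dy + b \<alpha> \<beta> w * dx"
proof -
  have "(\<Sum>\<sigma>\<in>UNIV. \<Sum>\<tau>\<in>UNIV. M \<alpha> \<sigma> w * (C \<sigma> \<beta> \<tau> w * du $ \<tau>)) =
      (\<Sum>\<tau>\<in>UNIV. \<Sum>\<sigma>\<in>UNIV. M \<alpha> \<sigma> w * (C \<sigma> \<beta> \<tau> w * du $ \<tau>))" by (rule sum.swap)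
  then show ?thesis
    by (simp add: lower_def distrib_left sum.distrib sum_distrib_left sum_distrib_right mult.assoc)
qed

lemma dM_iff:
  assumes w: "w \<in> U"
  shows "(\<forall>v. dd v (M \<alpha> \<beta>) w = (\<Sum>\<sigma>\<in>UNIV. M \<alpha> \<sigma> w * Omega C A B \<sigma> \<beta> w v)
      + (\<Sum>\<sigma>\<in>UNIV. M \<beta> \<sigma> w * Omega C A B \<sigma> \<alpha> w v)) \<longleftrightarrow>
    (\<forall>\<gamma>. Du \<gamma> (M \<alpha> \<beta>) w = c \<alpha> \<beta> \<gamma> w + c \<beta> \<alpha> \<gamma> w) \<and> Dy (M \<alpha> \<beta>) w = a \<alpha> \<beta> w + a \<beta> \<alpha> w
    \<and> Dx (M \<alpha> \<beta>) w = b \<alpha> \<beta> w + b \<beta> \<alpha> w" (is "(\<forall>v. ?l v = ?r v) \<longleftrightarrow> ?R")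
proof
  assume L: "\<forall>v. ?l v = ?r v"
  show ?R
    using L[rule_format, of "(1, 0, 0)"] L[rule_format, of "(0, 1, 0)"] L[rule_format, of "(0, 0, axis _ 1)"]
    unfolding multiplier_Omega by simp
next
  assume R: ?R
  then have Du: "Du \<gamma> (M \<alpha> \<beta>) w = c \<alpha> \<beta> \<gamma> w + c \<beta> \<alpha> \<gamma> w" for \<gamma> by blast
  have "?l (dx, dy, du) = ?r (dx, dy, du)" for dx dy du
    unfolding multiplier_Omega dd_base[OF smooth_on_imp_differentiable[OF smooth_M w], where dx=dx and dy=dy and du=du] Du
      conjunct1[OF conjunct2[OF R]] conjunct2[OF conjunct2[OF R]]
    by (simp add: distrib_left sum.distrib mult.commute)
  then show "\<forall>v. ?l v = ?r v" by auto
qed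

lemma F_eq: "F \<alpha> z = - (\<Sum>\<sigma>\<in>UNIV. M \<alpha> \<sigma> (base_pt z) * f \<sigma> z)"
  unfolding multiplier_times_sys_rhs by simp

lemma dd_multiplier_f:
  assumes z: "z \<in> jets_over U" and X: "\<And>\<sigma>. smooth_on (jets_over U) (X \<sigma>)"
    and E: "\<And>w. w \<in> jets_over U \<Longrightarrow> E w = - (\<Sum>\<sigma>\<in>UNIV. M \<alpha> \<sigma> (base_pt w) * X \<sigma> w)"
  shows "dd v E z =
    - (\<Sum>\<sigma>\<in>UNIV. dd (base_pt v) (M \<alpha> \<sigma>) (base_pt z) * X \<sigma> z + M \<alpha> \<sigma> (base_pt z) * dd v (X \<sigma>) z)"
proof -
  have "dd v E z = dd v (\<lambda>w. - (\<Sum>\<sigma>\<in>UNIV. M \<alpha> \<sigma> (base_pt w) * X \<sigma> w)) z"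
    by (rule dd_cong[OF open_jets_over[OF open_U] z E])
  also have "\<dots> = - (\<Sum>\<sigma>\<in>UNIV. dd (base_pt v) (M \<alpha> \<sigma>) (base_pt z) * X \<sigma> z + M \<alpha> \<sigma> (base_pt z) * dd v (X \<sigma>) z)"
    by (rule dd_multiplier)
       (use z in \<open>auto simp: jets_over_eq intro: smooth_on_imp_differentiable[OF smooth_M] smooth_on_imp_differentiable[OF X]\<close>)
  finally show ?thesis .
qed

lemma dd_M_vertical: "z \<in> jets_over U \<Longrightarrow> dd (0, 0, 0) (M \<alpha> \<sigma>) (base_pt z) = 0"
  using linear_0[OF linear_dd[OF smooth_on_imp_differentiable[OF smooth_M, of "base_pt z"]]]
  by (simp add: jets_over_eq zero_prod_def)

lemma d_F_multiplier:
  assumes z: "z \<in> jets_over U"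
  shows "d_u \<beta> (F \<alpha>) z = - (\<Sum>\<sigma>\<in>UNIV. Du \<beta> (M \<alpha> \<sigma>) (base_pt z) * f \<sigma> z + M \<alpha> \<sigma> (base_pt z) * d_u \<beta> (f \<sigma>) z)"
    and "d_ux \<beta> (F \<alpha>) z = - (\<Sum>\<sigma>\<in>UNIV. M \<alpha> \<sigma> (base_pt z) * d_ux \<beta> (f \<sigma>) z)"
    and "d_uy \<beta> (F \<alpha>) z = - (\<Sum>\<sigma>\<in>UNIV. M \<alpha> \<sigma> (base_pt z) * d_uy \<beta> (f \<sigma>) z)"
  unfolding d_u_def d_ux_def d_uy_def dd_def[symmetric] dd_multiplier_f[OF z smooth_f F_eq]
  by (simp_all add: base_pt_def[of "(_, _)"] dd_M_vertical[OF z])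

lemma total_d_F_multiplier:
  assumes w: "(x, y, u) \<in> U"
  shows "total_x (d_ux \<beta> (F \<alpha>)) (x, y, u, p, q) r s =
      - (\<Sum>\<sigma>\<in>UNIV. dd (1, 0, p) (M \<alpha> \<sigma>) (x, y, u) * d_ux \<beta> (f \<sigma>) (x, y, u, p, q)
         + M \<alpha> \<sigma> (x, y, u) * total_x (d_ux \<beta> (f \<sigma>)) (x, y, u, p, q) r s)"
    and "total_y (d_uy \<beta> (F \<alpha>)) (x, y, u, p, q) s t =
      - (\<Sum>\<sigma>\<in>UNIV. dd (0, 1, q) (M \<alpha> \<sigma>) (x, y, u) * d_uy \<beta> (f \<sigma>) (x, y, u, p, q)
         + M \<alpha> \<sigma> (x, y, u) * total_y (d_uy \<beta> (f \<sigma>)) (x, y, u, p, q) s t)"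
proof -
  have z: "(x, y, u, p, q) \<in> jets_over U" using w by simp
  have smF: "smooth_on (jets_over U) (F \<alpha>)" by (intro smooth_on_bipoly open_U smooth_lowered)
  have diff: "d_ux \<beta> H differentiable (at (x, y, u, p, q))" "d_uy \<beta> H differentiable (at (x, y, u, p, q))"
    if "smooth_on (jets_over U) H" for H
    using smooth_on_imp_differentiable[OF smooth_on_d_jet(1)[OF that] z]
      smooth_on_imp_differentiable[OF smooth_on_d_jet(2)[OF that] z] .
  have d_ux: "dd v (d_ux \<beta> (F \<alpha>)) (x, y, u, p, q) =
      - (\<Sum>\<sigma>\<in>UNIV. dd (base_pt v) (M \<alpha> \<sigma>) (base_pt (x, y, u, p, q)) * d_ux \<beta> (f \<sigma>) (x, y, u, p, q)
         + M \<alpha> \<sigma> (base_pt (x, y, u, p, q)) * dd v (d_ux \<beta> (f \<sigma>)) (x, y, u, p, q))" for v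
    by (rule dd_multiplier_f[OF z smooth_on_d_jet(1)[OF smooth_f]]) (rule d_F_multiplier(2))
  show "total_x (d_ux \<beta> (F \<alpha>)) (x, y, u, p, q) r s =
      - (\<Sum>\<sigma>\<in>UNIV. dd (1, 0, p) (M \<alpha> \<sigma>) (x, y, u) * d_ux \<beta> (f \<sigma>) (x, y, u, p, q)
         + M \<alpha> \<sigma> (x, y, u) * total_x (d_ux \<beta> (f \<sigma>)) (x, y, u, p, q) r s)"
    using d_ux unfolding total_x_dd[OF diff(1)[OF smF]] total_x_dd[OF diff(1)[OF smooth_f]]
    by (simp add: base_pt_def)
  have d_uy: "dd v (d_uy \<beta> (F \<alpha>)) (x, y, u, p, q) =
      - (\<Sum>\<sigma>\<in>UNIV. dd (base_pt v) (M \<alpha> \<sigma>) (base_pt (x, y, u, p, q)) * d_uy \<beta> (f \<sigma>) (x, y, u, p, q)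
         + M \<alpha> \<sigma> (base_pt (x, y, u, p, q)) * dd v (d_uy \<beta> (f \<sigma>)) (x, y, u, p, q))" for v
    by (rule dd_multiplier_f[OF z smooth_on_d_jet(2)[OF smooth_f]]) (rule d_F_multiplier(3))
  show "total_y (d_uy \<beta> (F \<alpha>)) (x, y, u, p, q) s t =
      - (\<Sum>\<sigma>\<in>UNIV. dd (0, 1, q) (M \<alpha> \<sigma>) (x, y, u) * d_uy \<beta> (f \<sigma>) (x, y, u, p, q)
         + M \<alpha> \<sigma> (x, y, u) * total_y (d_uy \<beta> (f \<sigma>)) (x, y, u, p, q) s t)"
    using d_uy unfolding total_y_dd[OF diff(2)[OF smF]] total_y_dd[OF diff(2)[OF smooth_f]]
    by (simp add: base_pt_def)
qed

text \<open>Differentiating \<open>F = - M f\<close> expresses \<open>M H\<close> by derivatives of \<open>F\<close>, of \<open>M\<close>, and the double sum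
  \<open>M f\<^sub>q f\<^sub>p\<close>; the same holds for \<open>M K\<close> with \<open>p\<close> and \<open>q\<close> exchanged.  The double sums agree because \<open>M\<close> is
  symmetric.  Up to sign, the derivatives of \<open>F\<close> combine to the zero-order Helmholtz expression, evaluated at \<open>u\<^sub>x\<^sub>y = f\<close>; its
  part proportional to \<open>f\<close> cancels against the derivatives of \<open>M\<close> by the first-order conditions.  In particular, the
  values of \<open>u\<^sub>x\<^sub>x\<close> and \<open>u\<^sub>y\<^sub>y\<close> drop out.\<close>

lemma multiplier_H_K:
  assumes w: "(x, y, u) \<in> U"
    and Du: "\<And>\<alpha> \<beta> \<gamma>. Du \<gamma> (M \<alpha> \<beta>) (x, y, u) = c \<alpha> \<beta> \<gamma> (x, y, u) + c \<beta> \<alpha> \<gamma> (x, y, u)"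
    and Dy: "\<And>\<alpha> \<beta>. Dy (M \<alpha> \<beta>) (x, y, u) = a \<alpha> \<beta> (x, y, u) + a \<beta> \<alpha> (x, y, u)"
    and Dx: "\<And>\<alpha> \<beta>. Dx (M \<alpha> \<beta>) (x, y, u) = b \<alpha> \<beta> (x, y, u) + b \<beta> \<alpha> (x, y, u)"
    and S: "\<And>\<alpha> \<beta> \<gamma>. c \<alpha> \<beta> \<gamma> (x, y, u) - c \<alpha> \<gamma> \<beta> (x, y, u) = - (c \<beta> \<alpha> \<gamma> (x, y, u) - c \<beta> \<gamma> \<alpha> (x, y, u))"
  shows "(\<Sum>\<sigma>\<in>UNIV. M \<alpha> \<sigma> (x, y, u) * inv_H f \<sigma> \<beta> (x, y, u, p, q) r) =
    (\<Sum>\<sigma>\<in>UNIV. M \<beta> \<sigma> (x, y, u) * inv_K f \<sigma> \<alpha> (x, y, u, p, q) t)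
    - bipoly (helm_c c \<alpha> \<beta>) (helm_a c a \<alpha> \<beta>) (helm_b c b \<alpha> \<beta>) (helm_g a b g \<alpha> \<beta>) (x, y, u, p, q)"
proof -
  let ?w = "(x, y, u)" and ?z = "(x, y, u, p, q)"
  let ?s = "\<chi> \<beta>. f \<beta> ?z"
  have z: "?z \<in> jets_over U" using w by simp
  have bz [simp]: "base_pt ?z = ?w" by (simp add: base_pt_def)
  have diffM: "M \<alpha> \<beta> differentiable (at ?w)" for \<alpha> \<beta>
    using smooth_on_imp_differentiable[OF smooth_M w] .
  note dF = d_F_multiplier[OF z, unfolded bz]
  have Fy: "d_uy \<sigma> (F \<alpha>) ?z = (\<Sum>\<gamma>\<in>UNIV. c \<alpha> \<gamma> \<sigma> ?w * p $ \<gamma>) + b \<alpha> \<sigma> ?w" for \<alpha> \<sigma>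
    unfolding d_F(5)[OF z] by (simp add: bipoly_eq)
  have Fx: "d_ux \<sigma> (F \<alpha>) ?z = (\<Sum>\<gamma>\<in>UNIV. c \<alpha> \<sigma> \<gamma> ?w * q $ \<gamma>) + a \<alpha> \<sigma> ?w" for \<alpha> \<sigma>
    unfolding d_F(4)[OF z] by (simp add: bipoly_eq)
  \<comment> \<open>The first-order conditions say that the total derivatives of \<open>M\<close> are the symmetrised derivatives of \<open>F\<close> along \<open>q\<close> and along \<open>p\<close>.\<close>
  have Mx: "dd (1, 0, p) (M \<alpha> \<sigma>) ?w = - (\<Sum>\<tau>\<in>UNIV. M \<alpha> \<tau> ?w * d_uy \<sigma> (f \<tau>) ?z)
      - (\<Sum>\<tau>\<in>UNIV. M \<sigma> \<tau> ?w * d_uy \<alpha> (f \<tau>) ?z)" for \<alpha> \<sigma>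
  proof -
    have "Du \<gamma> (M \<alpha> \<sigma>) ?w = c \<alpha> \<gamma> \<sigma> ?w + c \<sigma> \<gamma> \<alpha> ?w" for \<gamma>
      using Du[of \<gamma> \<alpha> \<sigma>] S[where \<alpha>=\<alpha> and \<beta>=\<sigma> and \<gamma>=\<gamma>] by linarith
    then have "dd (1, 0, p) (M \<alpha> \<sigma>) ?w = d_uy \<sigma> (F \<alpha>) ?z + d_uy \<alpha> (F \<sigma>) ?z"
      unfolding dd_base[OF diffM, where dx=1 and dy=0 and du=p] Fy Dx by (simp add: distrib_left sum.distrib mult.commute)
    then show ?thesis unfolding dF by simp
  qed
  have My: "dd (0, 1, q) (M \<alpha> \<sigma>) ?w = - (\<Sum>\<tau>\<in>UNIV. M \<alpha> \<tau> ?w * d_ux \<sigma> (f \<tau>) ?z)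
      - (\<Sum>\<tau>\<in>UNIV. M \<sigma> \<tau> ?w * d_ux \<alpha> (f \<tau>) ?z)" for \<alpha> \<sigma>
  proof -
    have "dd (0, 1, q) (M \<alpha> \<sigma>) ?w = d_ux \<sigma> (F \<alpha>) ?z + d_ux \<alpha> (F \<sigma>) ?z"
      unfolding dd_base[OF diffM, where dx=0 and dy=1 and du=q] Fx Dy Du by (simp add: distrib_left sum.distrib mult.commute)
    then show ?thesis unfolding dF by simp
  qed
  have H: "(\<Sum>\<sigma>\<in>UNIV. M \<alpha> \<sigma> ?w * inv_H f \<sigma> \<beta> ?z r) =
      total_x (d_ux \<beta> (F \<alpha>)) ?z r ?s - d_u \<beta> (F \<alpha>) ?z - (\<Sum>\<sigma>\<in>UNIV. Du \<beta> (M \<alpha> \<sigma>) ?w * f \<sigma> ?z)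
      - (\<Sum>\<sigma>\<in>UNIV. \<Sum>\<tau>\<in>UNIV. M \<sigma> \<tau> ?w * d_uy \<alpha> (f \<tau>) ?z * d_ux \<beta> (f \<sigma>) ?z)"
    unfolding inv_H_eq
    by (rule sum_multiplier_algebra[OF Mx dF(1) total_d_F_multiplier(1)[OF w]])
  have K: "(\<Sum>\<sigma>\<in>UNIV. M \<beta> \<sigma> ?w * inv_K f \<sigma> \<alpha> ?z t) =
      total_y (d_uy \<alpha> (F \<beta>)) ?z ?s t - d_u \<alpha> (F \<beta>) ?z - (\<Sum>\<sigma>\<in>UNIV. Du \<alpha> (M \<beta> \<sigma>) ?w * f \<sigma> ?z)
      - (\<Sum>\<sigma>\<in>UNIV. \<Sum>\<tau>\<in>UNIV. M \<sigma> \<tau> ?w * d_ux \<beta> (f \<tau>) ?z * d_uy \<alpha> (f \<sigma>) ?z)"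
    unfolding inv_K_eq
    by (rule sum_multiplier_algebra[OF My dF(1) total_d_F_multiplier(2)[OF w]])
  have cross: "(\<Sum>\<sigma>\<in>UNIV. \<Sum>\<tau>\<in>UNIV. M \<sigma> \<tau> ?w * d_uy \<alpha> (f \<tau>) ?z * d_ux \<beta> (f \<sigma>) ?z) =
      (\<Sum>\<sigma>\<in>UNIV. \<Sum>\<tau>\<in>UNIV. M \<sigma> \<tau> ?w * d_ux \<beta> (f \<tau>) ?z * d_uy \<alpha> (f \<sigma>) ?z)"
  proof -
    have "M \<sigma> \<tau> ?w * d_uy \<alpha> (f \<tau>) ?z * d_ux \<beta> (f \<sigma>) ?z = M \<tau> \<sigma> ?w * d_ux \<beta> (f \<sigma>) ?z * d_uy \<alpha> (f \<tau>) ?z" for \<sigma> \<tau>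
      using M_sym[OF w, of \<sigma> \<tau>] by simp
    then show ?thesis by (subst sum.swap) (simp only:)
  qed
  have tx: "total_x (d_ux \<beta> (F \<alpha>)) ?z r ?s = bipoly (\<lambda>\<gamma> \<delta>. Du \<gamma> (c \<alpha> \<beta> \<delta>)) (\<lambda>\<gamma>. Du \<gamma> (a \<alpha> \<beta>))
      (\<lambda>\<delta>. Dx (c \<alpha> \<beta> \<delta>)) (Dx (a \<alpha> \<beta>)) ?z + (\<Sum>\<sigma>\<in>UNIV. c \<alpha> \<beta> \<sigma> ?w * f \<sigma> ?z)"
  proof -
    have "total_x (d_ux \<beta> (F \<alpha>)) ?z r ?s = total_x (bipoly (\<lambda>_ _ _. 0) (\<lambda>_ _. 0) (c \<alpha> \<beta>) (a \<alpha> \<beta>)) ?z r ?s"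
      by (intro total_cong(1)[OF open_U z] d_F(4))
    then show ?thesis unfolding total_x_bipoly[OF open_U w smooth_lowered(1) smooth_lowered(2)] by simp
  qed
  have ty: "total_y (d_uy \<alpha> (F \<beta>)) ?z ?s t = bipoly (\<lambda>\<gamma> \<delta>. Du \<delta> (c \<beta> \<gamma> \<alpha>)) (\<lambda>\<gamma>. Dy (c \<beta> \<gamma> \<alpha>))
      (\<lambda>\<delta>. Du \<delta> (b \<beta> \<alpha>)) (Dy (b \<beta> \<alpha>)) ?z + (\<Sum>\<sigma>\<in>UNIV. c \<beta> \<sigma> \<alpha> ?w * f \<sigma> ?z)"
  proof -
    have "total_y (d_uy \<alpha> (F \<beta>)) ?z ?s t = total_y (bipoly (\<lambda>_ _ _. 0) (\<lambda>\<gamma>. c \<beta> \<gamma> \<alpha>) (\<lambda>_ _. 0) (b \<beta> \<alpha>)) ?z ?s t"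
      by (intro total_cong(2)[OF open_U z] d_F(5))
    then show ?thesis unfolding total_y_bipoly[OF open_U w smooth_lowered(1) smooth_lowered(3)] by simp
  qed
  \<comment> \<open>The coefficients of \<open>f\<close> agree since the skew part of \<open>c\<close> is totally skew.\<close>
  have sf: "(\<Sum>\<sigma>\<in>UNIV. c \<alpha> \<beta> \<sigma> ?w * f \<sigma> ?z) - (\<Sum>\<sigma>\<in>UNIV. Du \<beta> (M \<alpha> \<sigma>) ?w * f \<sigma> ?z) =
      (\<Sum>\<sigma>\<in>UNIV. c \<beta> \<sigma> \<alpha> ?w * f \<sigma> ?z) - (\<Sum>\<sigma>\<in>UNIV. Du \<alpha> (M \<beta> \<sigma>) ?w * f \<sigma> ?z)"
  proof -
    have "c \<alpha> \<beta> \<sigma> ?w - Du \<beta> (M \<alpha> \<sigma>) ?w = c \<beta> \<sigma> \<alpha> ?w - Du \<alpha> (M \<beta> \<sigma>) ?w" for \<sigma>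
      using Du[of \<beta> \<alpha> \<sigma>] Du[of \<alpha> \<beta> \<sigma>] S[where \<alpha>=\<alpha> and \<beta>=\<beta> and \<gamma>=\<sigma>] S[where \<alpha>=\<sigma> and \<beta>=\<alpha> and \<gamma>=\<beta>] S[where \<alpha>=\<beta> and \<beta>=\<sigma> and \<gamma>=\<alpha>] by linarith
    then show ?thesis unfolding sum_subtractf[symmetric] left_diff_distrib[symmetric] by simp
  qed
  have Z: "bipoly (helm_c c \<alpha> \<beta>) (helm_a c a \<alpha> \<beta>) (helm_b c b \<alpha> \<beta>) (helm_g a b g \<alpha> \<beta>) ?z =
      d_u \<beta> (F \<alpha>) ?z - d_u \<alpha> (F \<beta>) ?z
      - bipoly (\<lambda>\<gamma> \<delta>. Du \<gamma> (c \<alpha> \<beta> \<delta>)) (\<lambda>\<gamma>. Du \<gamma> (a \<alpha> \<beta>)) (\<lambda>\<delta>. Dx (c \<alpha> \<beta> \<delta>)) (Dx (a \<alpha> \<beta>)) ?z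
      + bipoly (\<lambda>\<gamma> \<delta>. Du \<delta> (c \<beta> \<gamma> \<alpha>)) (\<lambda>\<gamma>. Dy (c \<beta> \<gamma> \<alpha>)) (\<lambda>\<delta>. Du \<delta> (b \<beta> \<alpha>)) (Dy (b \<beta> \<alpha>)) ?z"
    unfolding d_F(3)[OF z]
    by (simp add: bipoly_eq helm_defs distrib_right left_diff_distrib sum.distrib sum_subtractf)
  show ?thesis unfolding H K cross tx ty Z using sf by linarith
qed

text \<open>The conditions on \<open>dM\<close> and \<open>S\<close> have to be traded first: only in their presence is the \<open>H, K\<close> condition
  equivalent to the zero-order one.\<close>

lemma helmholtz_iff_algebraic:
  "helmholtz U M c a b g \<longleftrightarrow>
    (\<forall>x y u p q r t \<alpha> \<beta>. (x, y, u) \<in> U \<longrightarrow>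
       (\<Sum>\<sigma>\<in>UNIV. M \<alpha> \<sigma> (x, y, u) * inv_H f \<sigma> \<beta> (x, y, u, p, q) r) =
       (\<Sum>\<sigma>\<in>UNIV. M \<beta> \<sigma> (x, y, u) * inv_K f \<sigma> \<alpha> (x, y, u, p, q) t)) \<and>
    (\<forall>x y u p q \<alpha> \<beta> \<gamma>. (x, y, u) \<in> U \<longrightarrow>
       (\<Sum>\<sigma>\<in>UNIV. M \<alpha> \<sigma> (x, y, u) * inv_S f \<sigma> \<beta> \<gamma> (x, y, u, p, q)) =
       - (\<Sum>\<sigma>\<in>UNIV. M \<beta> \<sigma> (x, y, u) * inv_S f \<sigma> \<alpha> \<gamma> (x, y, u, p, q))) \<and>
    (\<forall>b\<in>U. \<forall>v \<alpha> \<beta>.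
       frechet_derivative (M \<alpha> \<beta>) (at b) v =
       (\<Sum>\<sigma>\<in>UNIV. M \<alpha> \<sigma> b * Omega C A B \<sigma> \<beta> b v) +
       (\<Sum>\<sigma>\<in>UNIV. M \<beta> \<sigma> b * Omega C A B \<sigma> \<alpha> b v))" (is "_ \<longleftrightarrow> ?HK \<and> ?S \<and> ?dM")
proof -
  let ?dMw = "\<lambda>w. \<forall>\<alpha> \<beta>. (\<forall>\<gamma>. Du \<gamma> (M \<alpha> \<beta>) w = c \<alpha> \<beta> \<gamma> w + c \<beta> \<alpha> \<gamma> w) \<and>
    Dy (M \<alpha> \<beta>) w = a \<alpha> \<beta> w + a \<beta> \<alpha> w \<and> Dx (M \<alpha> \<beta>) w = b \<alpha> \<beta> w + b \<beta> \<alpha> w"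
  let ?Sw = "\<lambda>w. \<forall>\<alpha> \<beta> \<gamma>. c \<alpha> \<beta> \<gamma> w - c \<alpha> \<gamma> \<beta> w = - (c \<beta> \<alpha> \<gamma> w - c \<beta> \<gamma> \<alpha> w)"
  let ?Zw = "\<lambda>w. (\<forall>\<alpha> \<beta> \<gamma> \<delta>. helm_c c \<alpha> \<beta> \<gamma> \<delta> w = 0) \<and> (\<forall>\<alpha> \<beta> \<gamma>. helm_a c a \<alpha> \<beta> \<gamma> w = 0) \<and>
     (\<forall>\<alpha> \<beta> \<gamma>. helm_b c b \<alpha> \<beta> \<gamma> w = 0) \<and> (\<forall>\<alpha> \<beta>. helm_g a b g \<alpha> \<beta> w = 0)"
  have helm: "helmholtz U M c a b g \<longleftrightarrow> (\<forall>w\<in>U. ?dMw w \<and> ?Sw w \<and> ?Zw w)"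
    by (simp only: helmholtz_def all_conj_distrib conj_assoc)
  have dM: "?dM \<longleftrightarrow> (\<forall>w\<in>U. ?dMw w)"
    unfolding dd_def[symmetric] using dM_iff by blast
  have S: "?S \<longleftrightarrow> (\<forall>w\<in>U. ?Sw w)"
    by (simp only: Ball_def split_paired_All multiplier_inv_S all_simps simp_thms cong: imp_cong)
  have HK: "?HK \<longleftrightarrow> (\<forall>w\<in>U. ?Zw w)" if "\<forall>w\<in>U. ?dMw w" "\<forall>w\<in>U. ?Sw w"
  proof -
    have key: "(\<Sum>\<sigma>\<in>UNIV. M \<alpha> \<sigma> (x, y, u) * inv_H f \<sigma> \<beta> (x, y, u, p, q) r) =
        (\<Sum>\<sigma>\<in>UNIV. M \<beta> \<sigma> (x, y, u) * inv_K f \<sigma> \<alpha> (x, y, u, p, q) t)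
        - bipoly (helm_c c \<alpha> \<beta>) (helm_a c a \<alpha> \<beta>) (helm_b c b \<alpha> \<beta>) (helm_g a b g \<alpha> \<beta>) (x, y, u, p, q)"
      if w: "(x, y, u) \<in> U" for x y u p q r t \<alpha> \<beta>
    proof (rule multiplier_H_K[OF w])
      note 1 = bspec[OF \<open>\<forall>w\<in>U. ?dMw w\<close> w] and 2 = bspec[OF \<open>\<forall>w\<in>U. ?Sw w\<close> w]
      show "\<And>\<alpha> \<beta> \<gamma>. Du \<gamma> (M \<alpha> \<beta>) (x, y, u) = c \<alpha> \<beta> \<gamma> (x, y, u) + c \<beta> \<alpha> \<gamma> (x, y, u)"
        "\<And>\<alpha> \<beta>. Dy (M \<alpha> \<beta>) (x, y, u) = a \<alpha> \<beta> (x, y, u) + a \<beta> \<alpha> (x, y, u)"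
        "\<And>\<alpha> \<beta>. Dx (M \<alpha> \<beta>) (x, y, u) = b \<alpha> \<beta> (x, y, u) + b \<beta> \<alpha> (x, y, u)"
        using 1 by simp_all
      show "\<And>\<alpha> \<beta> \<gamma>. c \<alpha> \<beta> \<gamma> (x, y, u) - c \<alpha> \<gamma> \<beta> (x, y, u) = - (c \<beta> \<alpha> \<gamma> (x, y, u) - c \<beta> \<gamma> \<alpha> (x, y, u))"
        using 2 by blast
    qed
    have zero: "bipoly (\<lambda>_ _ _. 0) (\<lambda>_ _. 0) (\<lambda>_ _. 0) (\<lambda>_. 0) z = 0" for z :: "'m jet"
      by (simp add: bipoly_def)
    have "?HK \<longleftrightarrow> (\<forall>x y u p q \<alpha> \<beta>. (x, y, u) \<in> U \<longrightarrow>
        bipoly (helm_c c \<alpha> \<beta>) (helm_a c a \<alpha> \<beta>) (helm_b c b \<alpha> \<beta>) (helm_g a b g \<alpha> \<beta>) (x, y, u, p, q) =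
        bipoly (\<lambda>_ _ _. 0) (\<lambda>_ _. 0) (\<lambda>_ _. 0) (\<lambda>_. 0) (x, y, u, p, q))" (is "_ \<longleftrightarrow> ?Z0")
      unfolding zero
    proof (intro iffI allI impI)
      fix x y u p q \<alpha> \<beta> assume L: ?HK and w: "(x, y, u) \<in> U"
      have "(\<Sum>\<sigma>\<in>UNIV. M \<alpha> \<sigma> (x, y, u) * inv_H f \<sigma> \<beta> (x, y, u, p, q) 0) =
         (\<Sum>\<sigma>\<in>UNIV. M \<beta> \<sigma> (x, y, u) * inv_K f \<sigma> \<alpha> (x, y, u, p, q) 0)"
        using L w by blast
      then show "bipoly (helm_c c \<alpha> \<beta>) (helm_a c a \<alpha> \<beta>) (helm_b c b \<alpha> \<beta>) (helm_g a b g \<alpha> \<beta>) (x, y, u, p, q) = 0"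
        using key[OF w, of \<alpha> \<beta> p q 0 0] by linarith
    next
      fix x y u p q r t \<alpha> \<beta>
      assume R: "\<forall>x y u p q \<alpha> \<beta>. (x, y, u) \<in> U \<longrightarrow>
        bipoly (helm_c c \<alpha> \<beta>) (helm_a c a \<alpha> \<beta>) (helm_b c b \<alpha> \<beta>) (helm_g a b g \<alpha> \<beta>) (x, y, u, p, q) = 0"
        and w: "(x, y, u) \<in> U"
      have "bipoly (helm_c c \<alpha> \<beta>) (helm_a c a \<alpha> \<beta>) (helm_b c b \<alpha> \<beta>) (helm_g a b g \<alpha> \<beta>) (x, y, u, p, q) = 0"
        using R w by blast
      then show "(\<Sum>\<sigma>\<in>UNIV. M \<alpha> \<sigma> (x, y, u) * inv_H f \<sigma> \<beta> (x, y, u, p, q) r) =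
         (\<Sum>\<sigma>\<in>UNIV. M \<beta> \<sigma> (x, y, u) * inv_K f \<sigma> \<alpha> (x, y, u, p, q) t)"
        using key[OF w, of \<alpha> \<beta> p q r t] by linarith
    qed
    also have "\<dots> \<longleftrightarrow> (\<forall>w\<in>U. ?Zw w)"
    proof
      assume Z0: ?Z0
      show "\<forall>w\<in>U. ?Zw w"
      proof
        fix w assume w: "w \<in> U"
        obtain x y u where [simp]: "w = (x, y, u)" by (metis prod_cases3)
        have "bipoly (helm_c c \<alpha> \<beta>) (helm_a c a \<alpha> \<beta>) (helm_b c b \<alpha> \<beta>) (helm_g a b g \<alpha> \<beta>) (x, y, u, p, q) =
            bipoly (\<lambda>_ _ _. 0) (\<lambda>_ _. 0) (\<lambda>_ _. 0) (\<lambda>_. 0) (x, y, u, p, q)" for \<alpha> \<beta> p q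
          using Z0 w by simp
        from bipoly_coeffs_unique[OF this] show "?Zw w" by simp
      qed
    next
      assume "\<forall>w\<in>U. ?Zw w"
      then show ?Z0 by (intro allI impI bipoly_cong) (simp_all add: base_pt_def)
    qed
    finally show ?thesis .
  qed
  have split: "(\<forall>w\<in>U. P w \<and> Q w \<and> R w) \<longleftrightarrow> (\<forall>w\<in>U. P w) \<and> (\<forall>w\<in>U. Q w) \<and> (\<forall>w\<in>U. R w)" for P Q R
    by blast
  have rearrange: "(P \<Longrightarrow> Q \<Longrightarrow> H \<longleftrightarrow> R) \<Longrightarrow> P \<and> Q \<and> R \<longleftrightarrow> H \<and> Q \<and> P" for P Q R H by blast
  show ?thesis
    unfolding helm dM S split[of ?dMw ?Sw ?Zw] by (rule rearrange) (rule HK)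
qed

lemma multiplier_variational_iff_helmholtz:
  "multiplier_variational U f M \<longleftrightarrow> (\<forall>b\<in>U. det (\<chi> \<alpha> \<beta>. M \<alpha> \<beta> b) \<noteq> 0) \<and> helmholtz U M c a b g"
proof -
  have "(\<forall>w\<in>U. \<exists>V. open V \<and> w \<in> V \<and> V \<subseteq> U \<and> (\<exists>h P Q R. lagrangian_coeffs V M c a b g h P Q R))
      \<longleftrightarrow> helmholtz U M c a b g" (is "?loc \<longleftrightarrow> _")
  proof
    assume ?loc
    then have "\<forall>w\<in>U. \<exists>V. w \<in> V \<and> helmholtz V M c a b g"
      using lagrangian_coeffs_imp_helmholtz by metis
    then show "helmholtz U M c a b g"
      using helmholtz_pointwise by blast
  next
    assume hU: "helmholtz U M c a b g"
    show ?loc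
    proof
      fix w assume "w \<in> U"
      then obtain V u0 where V: "fibre_star V u0" "w \<in> V" "V \<subseteq> U"
        using obtain_fibre_star[OF open_U] by blast
      then have oV: "open V" by (simp add: fibre_star_def)
      have hV: "helmholtz V M c a b g"
        using hU V(3) helmholtz_pointwise by blast
      note subset = smooth_on_subset[OF _ V(3) oV]
      have "\<exists>h P Q R. lagrangian_coeffs V M c a b g h P Q R"
      proof (rule helmholtz_imp_lagrangian_coeffs[OF V(1) _ _ _ _ _ _ hV])
        show "M \<alpha> \<beta> w = M \<beta> \<alpha> w" if "w \<in> V" for \<alpha> \<beta> w using M_sym that V(3) by blast
      qed (blast | rule subset, rule smooth_M smooth_lowered)+
      then show "\<exists>V. open V \<and> w \<in> V \<and> V \<subseteq> U \<and> (\<exists>h P Q R. lagrangian_coeffs V M c a b g h P Q R)"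
        using V oV by blast
    qed
  qed
  moreover have "multiplier_variational U f M \<longleftrightarrow> (\<forall>b\<in>U. det (\<chi> \<alpha> \<beta>. M \<alpha> \<beta> b) \<noteq> 0) \<and> ?loc"
    unfolding multiplier_variational_def
    by (simp add: lagrangian_iff_coeffs[symmetric] cong: conj_cong)
  ultimately show ?thesis by simp
qed

end

theorem proposition2p2:
  fixes U :: "('m::finite) base set"
    and C :: "'m \<Rightarrow> 'm \<Rightarrow> 'm \<Rightarrow> 'm base \<Rightarrow> real"
    and A B M :: "'m \<Rightarrow> 'm \<Rightarrow> 'm base \<Rightarrow> real"
    and G :: "'m \<Rightarrow> 'm base \<Rightarrow> real"
    and f :: "'m \<Rightarrow> 'm jet \<Rightarrow> real"
  assumes "open U"
    and "\<And>\<alpha> \<beta> \<gamma>. smooth_on U (C \<alpha> \<beta> \<gamma>)"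
    and "\<And>\<alpha> \<gamma>. smooth_on U (A \<alpha> \<gamma>)"
    and "\<And>\<alpha> \<gamma>. smooth_on U (B \<alpha> \<gamma>)"
    and "\<And>\<alpha>. smooth_on U (G \<alpha>)"
    and "\<And>\<alpha> \<beta>. smooth_on U (M \<alpha> \<beta>)"
    and "\<And>\<alpha> \<beta> b. b \<in> U \<Longrightarrow> M \<alpha> \<beta> b = M \<beta> \<alpha> b"
    and "f = sys_rhs C A B G"
  shows "multiplier_variational U f M \<longleftrightarrow>
    (\<forall>b\<in>U. det (\<chi> \<alpha> \<beta>. M \<alpha> \<beta> b) \<noteq> 0) \<and>
    (\<forall>x y u p q r t \<alpha> \<beta>. (x, y, u) \<in> U \<longrightarrow>
       (\<Sum>\<sigma>\<in>UNIV. M \<alpha> \<sigma> (x, y, u) * inv_H f \<sigma> \<beta> (x, y, u, p, q) r) =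
       (\<Sum>\<sigma>\<in>UNIV. M \<beta> \<sigma> (x, y, u) * inv_K f \<sigma> \<alpha> (x, y, u, p, q) t)) \<and>
    (\<forall>x y u p q \<alpha> \<beta> \<gamma>. (x, y, u) \<in> U \<longrightarrow>
       (\<Sum>\<sigma>\<in>UNIV. M \<alpha> \<sigma> (x, y, u) * inv_S f \<sigma> \<beta> \<gamma> (x, y, u, p, q)) =
       - (\<Sum>\<sigma>\<in>UNIV. M \<beta> \<sigma> (x, y, u) * inv_S f \<sigma> \<alpha> \<gamma> (x, y, u, p, q))) \<and>
    (\<forall>b\<in>U. \<forall>v \<alpha> \<beta>.
       frechet_derivative (M \<alpha> \<beta>) (at b) v =
       (\<Sum>\<sigma>\<in>UNIV. M \<alpha> \<sigma> b * Omega C A B \<sigma> \<beta> b v) +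
       (\<Sum>\<sigma>\<in>UNIV. M \<beta> \<sigma> b * Omega C A B \<sigma> \<alpha> b v))"
proof -
  interpret multiplier_system U C A B M G
    by unfold_locales (rule assms)+
  show ?thesis
    unfolding assms(8) multiplier_variational_iff_helmholtz helmholtz_iff_algebraic ..
qed

end
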